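(* Let $\{X_t\}_{t\in\mathcal{B}}$ be the Kuranishi family of the Iwasawa manifold $X=X_0$, defined by the Beltrami differentials $\phi(t)$, let $\wedge^{\bullet,\bullet}\subset A^{\bullet,\bullet}(X)$ be the space of left invariant forms, and put $D(t)=t_{11}t_{22}-t_{21}t_{12}$. Then for every $t\in\mathcal{B}$ the bounded double complex $(\wedge^{\bullet},d_{\phi(t)}=\partial+\bar\partial_{\phi(t)})$ is isomorphic, as a double complex, to the following direct sum of indecomposable double complexes (notation $\mathrm{Dot},\mathrm{H},\mathrm{V},\mathrm{Q},\mathrm{L},\mathrm{R}$ as defined in the context; $mC$ means the direct sum of $m$ copies of $C$). (i) If $(t_{11},t_{12},t_{21},t_{22})=0$ (so $D(t)=0$): - one square $\mathrm{Q}^{1,1}$; - horizontal zigzags of length 2: $\mathrm{H}^{1,0}$, $2\mathrm{H}^{1,1}$, $2\mathrm{H}^{1,2}$, $\mathrm{H}^{1,3}$; - vertical zigzags of length 2: $\mathrm{V}^{0,1}$, $2\mathrm{V}^{1,1}$, $2\mathrm{V}^{2,1}$, $\mathrm{V}^{3,1}$; - dots: $\mathrm{Dot}^{0,0}$, $2\mathrm{Dot}^{1,0}$, $2\mathrm{Dot}^{2,0}$, $\mathrm{Dot}^{3,0}$, $2\mathrm{Dot}^{0,1}$, $4\mathrm{Dot}^{1,1}$, $4\mathrm{Dot}^{2,1}$, $2\mathrm{Dot}^{3,1}$, $2\mathrm{Dot}^{0,2}$, $4\mathrm{Dot}^{1,2}$, $4\mathrm{Dot}^{2,2}$, $2\mathrm{Dot}^{3,2}$,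 $\mathrm{Dot}^{0,3}$, $2\mathrm{Dot}^{1,3}$, $2\mathrm{Dot}^{2,3}$, $\mathrm{Dot}^{3,3}$. (ii) If $(t_{11},t_{12},t_{21},t_{22})\neq 0$ and $D(t)=0$: - one square $\mathrm{Q}^{1,1}$; - horizontal zigzags of length 2: $\mathrm{H}^{1,1}$, $\mathrm{H}^{1,2}$; - vertical zigzags of length 2: $\mathrm{V}^{0,1}$, $2\mathrm{V}^{1,1}$, $2\mathrm{V}^{2,1}$, $\mathrm{V}^{3,1}$; - zigzags of length 3: $\mathrm{L}^{1,0}$, $\mathrm{L}^{1,2}$, $\mathrm{R}^{2,1}$, $\mathrm{R}^{2,3}$; - dots: $\mathrm{Dot}^{0,0}$, $2\mathrm{Dot}^{1,0}$, $\mathrm{Dot}^{2,0}$, $\mathrm{Dot}^{3,0}$, $2\mathrm{Dot}^{0,1}$, $3\mathrm{Dot}^{1,1}$, $4\mathrm{Dot}^{2,1}$, $2\mathrm{Dot}^{3,1}$, $2\mathrm{Dot}^{0,2}$, $4\mathrm{Dot}^{1,2}$, $3\mathrm{Dot}^{2,2}$, $2\mathrm{Dot}^{3,2}$, $\mathrm{Dot}^{0,3}$, $\mathrm{Dot}^{1,3}$, $2\mathrm{Dot}^{2,3}$, $\mathrm{Dot}^{3,3}$. (iii) If $(t_{11},t_{12},t_{21},t_{22})\neq 0$ and $D(t)\neq 0$: - one square $\mathrm{Q}^{1,1}$; - no horizontal zigzags of length 2; - vertical zigzags of length 2: $\mathrm{V}^{0,1}$, $2\mathrm{V}^{1,1}$,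 $2\mathrm{V}^{2,1}$, $\mathrm{V}^{3,1}$; - zigzags of length 3: $\mathrm{L}^{1,0}$, $2\mathrm{L}^{1,2}$, $2\mathrm{R}^{2,1}$, $\mathrm{R}^{2,3}$; - dots: $\mathrm{Dot}^{0,0}$, $2\mathrm{Dot}^{1,0}$, $\mathrm{Dot}^{3,0}$, $2\mathrm{Dot}^{0,1}$, $3\mathrm{Dot}^{1,1}$, $4\mathrm{Dot}^{2,1}$, $2\mathrm{Dot}^{3,1}$, $2\mathrm{Dot}^{0,2}$, $4\mathrm{Dot}^{1,2}$, $3\mathrm{Dot}^{2,2}$, $2\mathrm{Dot}^{3,2}$, $\mathrm{Dot}^{0,3}$, $2\mathrm{Dot}^{2,3}$, $\mathrm{Dot}^{3,3}$.
   Context: **Iwasawa manifold.** $G$ is the complex Heisenberg group of upper triangular unipotent matrices $\begin{pmatrix}1&z^1&z^3\\0&1&z^2\\0&0&1\end{pmatrix}$, $z^i\in\mathbb{C}$; $\Gamma\subset G$ is the subgroup of matrices with entries in $\mathbb{Z}[\sqrt{-1}]$; $X=\Gamma\backslash G$ is the Iwasawa manifold. Left invariant $(1,0)$-forms: $\varphi^1=dz^1$, $\varphi^2=dz^2$, $\varphi^3=dz^3-z^1dz^2$, with dual left invariant vector fields $\theta^1=\partial/\partial z^1$, $\theta^2=\partial/\partial z^2+z^1\partial/\partial z^3$, $\theta^3=\partial/\partial z^3$. The structure equations are $d\varphi^1=d\varphi^2=0$, $d\varphi^3=-\varphi^1\wedge\varphi^2$ (and their conjugates). $A^{p,q}(X)$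 is the space of smooth $(p,q)$-forms on $X$, and $\wedge^{p,q}\subset A^{p,q}(X)$ is the space of left invariant $(p,q)$-forms, i.e. the span of $\varphi^{I}\wedge\bar\varphi^{J}$ with $|I|=p$, $|J|=q$, $I,J\subset\{1,2,3\}$; $\wedge^{\bullet}=\bigoplus_{p,q}\wedge^{p,q}$. **Kuranishi family.** For $\epsilon>0$ sufficiently small, $\mathcal{B}=\{t=(t_{11},t_{12},t_{21},t_{22},t_{31},t_{32})\in\mathbb{C}^6 : |t_{i\lambda}|<\epsilon\}$, and $$\phi(t)=\sum_{i=1}^3\sum_{\lambda=1}^2 t_{i\lambda}\,\theta^i\otimes\bar\varphi^{\lambda}-D(t)\,\theta^3\otimes\bar\varphi^3,\qquad D(t)=t_{11}t_{22}-t_{21}t_{12}.$$ $X_t$ is the compact complex manifold whose complex structure is determined by the Beltrami differential $\phi(t)$. **Deformed double complex.** For $\phi=\sum\theta\otimes\bar\psi$ (with $\theta$ of type $(1,0)$ and $\bar\psi$ of type $(0,1)$), the contraction operator is $i_\phi\alpha=\sum\bar\psi\wedge(\theta\lrcorner\alpha)$. Put $\mathcal{L}^{1,0}_{\phi(t)}=i_{\phi(t)}\partial-\partial i_{\phi(t)}$ and $\bar\partial_{\phi(t)}=\bar\partial-\mathcal{L}^{1,0}_{\phi(t)}$. Since $\phi(t)$ is left invariant, $(\wedge^{\bullet},d_{\phi(t)}=\partial+\bar\partial_{\phi(t)})$ is a double complex with $\partial_1=\partial:\wedge^{p,q}\to\wedge^{p+1,q}$ and $\partial_2=\bar\partial_{\phi(t)}:\wedge^{p,q}\to\wedge^{p,q+1}$.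 **Double complexes.** A double complex over $\mathbb{C}$ is a bigraded vector space $A=\bigoplus A^{p,q}$ with linear maps $\partial_1:A^{p,q}\to A^{p+1,q}$, $\partial_2:A^{p,q}\to A^{p,q+1}$ such that $(\partial_1+\partial_2)^2=0$. Morphisms are bidegree-preserving linear maps commuting with $\partial_1$ and $\partial_2$. The following are, up to isomorphism, uniquely determined indecomposable double complexes; in each, every listed component is one-dimensional, every listed arrow is an isomorphism, and all other components and maps vanish: - $\mathrm{Dot}^{p,q}$: single component at $(p,q)$; - $\mathrm{H}^{p,q}$: $(p,q)\xrightarrow{\partial_1}(p+1,q)$; - $\mathrm{V}^{p,q}$: $(p,q)\xrightarrow{\partial_2}(p,q+1)$; - $\mathrm{L}^{p,q}$: $(p,q+1)\xleftarrow{\partial_2}(p,q)\xrightarrow{\partial_1}(p+1,q)$; - $\mathrm{R}^{p,q}$: $(p-1,q)\xrightarrow{\partial_1}(p,q)\xleftarrow{\partial_2}(p,q-1)$; - $\mathrm{Q}^{p,q}$ (square): components at $(p,q),(p+1,q),(p,q+1),(p+1,q+1)$ with all four arrows between horizontally/vertically adjacent components. *)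

theory Defs
  imports "HOL-Analysis.Analysis" "HOL-Library.Function_Algebras"
begin

section \<open>Complex vector spaces\<close>

class complex_vector = ab_group_add +
  fixes scaleC :: "complex \<Rightarrow> 'a \<Rightarrow> 'a" (infixr \<open>*\<^sub>C\<close> 75)
  assumes scaleC_add_right: "c *\<^sub>C (x + y) = c *\<^sub>C x + c *\<^sub>C y"
    and scaleC_add_left: "(c + d) *\<^sub>C x = c *\<^sub>C x + d *\<^sub>C x"
    and scaleC_scaleC: "c *\<^sub>C d *\<^sub>C x = (c * d) *\<^sub>C x"
    and scaleC_one: "1 *\<^sub>C x = x"

lemma vector_space_scaleC:
  "vector_space (scaleC :: complex \<Rightarrow> 'a::complex_vector \<Rightarrow> 'a)"
  by unfold_locales (simp_all add: scaleC_add_right scaleC_add_left scaleC_scaleC scaleC_one)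

instantiation complex :: complex_vector
begin
definition scaleC_complex :: "complex \<Rightarrow> complex \<Rightarrow> complex"
  where "scaleC_complex c x = c * x"
instance by standard (simp_all add: scaleC_complex_def algebra_simps)
end

instantiation "fun" :: (type, complex_vector) complex_vector
begin
definition scaleC_fun :: "complex \<Rightarrow> ('a \<Rightarrow> 'b) \<Rightarrow> 'a \<Rightarrow> 'b"
  where "scaleC_fun c f = (\<lambda>x. c *\<^sub>C f x)"
instance by standard
    (simp_all add: scaleC_fun_def fun_eq_iff scaleC_add_right scaleC_add_left scaleC_scaleC
      scaleC_one)
end


section \<open>Double complexes\<close>

text \<open>The bigraded vector space is the external direct sum of the subspaces \<open>gr A p q\<close> of an
  ambient space; the values of \<open>d1 A p q\<close> and \<open>d2 A p q\<close> outside \<open>gr A p q\<close> are irrelevant.\<close>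

record 'a dcomplex =
  gr :: "int \<Rightarrow> int \<Rightarrow> 'a set"
  d1 :: "int \<Rightarrow> int \<Rightarrow> 'a \<Rightarrow> 'a"
  d2 :: "int \<Rightarrow> int \<Rightarrow> 'a \<Rightarrow> 'a"

definition linear_map_on ::
    "'a::complex_vector set \<Rightarrow> 'b::complex_vector set \<Rightarrow> ('a \<Rightarrow> 'b) \<Rightarrow> bool" where
  "linear_map_on V W f \<longleftrightarrow> f ` V \<subseteq> W \<and>
     (\<forall>x\<in>V. \<forall>y\<in>V. f (x + y) = f x + f y) \<and> (\<forall>c. \<forall>x\<in>V. f (c *\<^sub>C x) = c *\<^sub>C f x)"

text \<open>The last three equations are the bihomogeneous parts of \<open>(d1 + d2)\<^sup>2 = 0\<close>.\<close>

definition double_complex :: "'a::complex_vector dcomplex \<Rightarrow> bool" where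
  "double_complex A \<longleftrightarrow> (\<forall>p q.
     module.subspace scaleC (gr A p q) \<and>
     linear_map_on (gr A p q) (gr A (p + 1) q) (d1 A p q) \<and>
     linear_map_on (gr A p q) (gr A p (q + 1)) (d2 A p q) \<and>
     (\<forall>x\<in>gr A p q.
        d1 A (p + 1) q (d1 A p q x) = 0 \<and>
        d2 A p (q + 1) (d2 A p q x) = 0 \<and>
        d1 A p (q + 1) (d2 A p q x) + d2 A (p + 1) q (d1 A p q x) = 0))"

definition bounded_dcomplex :: "'a::complex_vector dcomplex \<Rightarrow> bool" where
  "bounded_dcomplex A \<longleftrightarrow> finite {(p, q). gr A p q \<noteq> {0}}"

definition dc_iso :: "'a::complex_vector dcomplex \<Rightarrow> 'b::complex_vector dcomplex \<Rightarrow> bool"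
    (infix \<open>\<cong>\<^sub>d\<^sub>c\<close> 50) where
  "A \<cong>\<^sub>d\<^sub>c B \<longleftrightarrow> (\<exists>f :: int \<Rightarrow> int \<Rightarrow> 'a \<Rightarrow> 'b. \<forall>p q.
     linear_map_on (gr A p q) (gr B p q) (f p q) \<and>
     bij_betw (f p q) (gr A p q) (gr B p q) \<and>
     (\<forall>x\<in>gr A p q.
        f (p + 1) q (d1 A p q x) = d1 B p q (f p q x) \<and>
        f p (q + 1) (d2 A p q x) = d2 B p q (f p q x)))"

definition dc_sum :: "'a::complex_vector dcomplex list \<Rightarrow> (nat \<Rightarrow> 'a) dcomplex" where
  "dc_sum As = \<lparr>
     gr = (\<lambda>p q. {x. (\<forall>i<length As. x i \<in> gr (As ! i) p q) \<and> (\<forall>i\<ge>length As. x i = 0)}),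
     d1 = (\<lambda>p q x i. if i < length As then d1 (As ! i) p q (x i) else 0),
     d2 = (\<lambda>p q x i. if i < length As then d2 (As ! i) p q (x i) else 0)\<rparr>"

text \<open>An entry \<open>(m, C)\<close> stands for the direct sum of \<open>m\<close> copies of \<open>C\<close>.\<close>

definition dc_sum_mult ::
    "(nat \<times> 'a::complex_vector dcomplex) list \<Rightarrow> (nat \<Rightarrow> 'a) dcomplex" where
  "dc_sum_mult ms = dc_sum (concat (map (\<lambda>(m, C). replicate m C) ms))"


subsection \<open>The indecomposable double complexes\<close>

text \<open>\<open>zigzag S E1 E2\<close> has a copy of the complex numbers at each bidegree in \<open>S\<close>; \<open>E1\<close> and \<open>E2\<close> are
  the sources of the horizontal and of the vertical arrows. The sign \<open>(-1)\<^sup>i\<close> in the vertical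
  arrows makes the arrows of a square anticommute; up to isomorphism it is immaterial otherwise.\<close>

definition zigzag ::
    "(int \<times> int) set \<Rightarrow> (int \<times> int) set \<Rightarrow> (int \<times> int) set \<Rightarrow> complex dcomplex" where
  "zigzag S E1 E2 = \<lparr>
     gr = (\<lambda>i j. if (i, j) \<in> S then UNIV else {0}),
     d1 = (\<lambda>i j x. if (i, j) \<in> E1 then x else 0),
     d2 = (\<lambda>i j x. if (i, j) \<in> E2 then (if even i then x else - x) else 0)\<rparr>"

definition Dot :: "int \<Rightarrow> int \<Rightarrow> complex dcomplex" where
  "Dot p q = zigzag {(p, q)} {} {}"

definition Hor :: "int \<Rightarrow> int \<Rightarrow> complex dcomplex" where
  "Hor p q = zigzag {(p, q), (p + 1, q)} {(p, q)} {}"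

definition Ver :: "int \<Rightarrow> int \<Rightarrow> complex dcomplex" where
  "Ver p q = zigzag {(p, q), (p, q + 1)} {} {(p, q)}"

definition Lzz :: "int \<Rightarrow> int \<Rightarrow> complex dcomplex" where
  "Lzz p q = zigzag {(p, q), (p + 1, q), (p, q + 1)} {(p, q)} {(p, q)}"

definition Rzz :: "int \<Rightarrow> int \<Rightarrow> complex dcomplex" where
  "Rzz p q = zigzag {(p, q), (p - 1, q), (p, q - 1)} {(p - 1, q)} {(p, q - 1)}"

definition Sq :: "int \<Rightarrow> int \<Rightarrow> complex dcomplex" where
  "Sq p q = zigzag {(p, q), (p + 1, q), (p, q + 1), (p + 1, q + 1)}
     {(p, q), (p, q + 1)} {(p, q), (p + 1, q)}"


section \<open>Differential forms on the complex Heisenberg group\<close>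

text \<open>\<open>G\<close> is identified with the space of the coordinates \<open>(z\<^sup>1, z\<^sup>2, z\<^sup>3)\<close>, and a differential form
  on \<open>X = \<Gamma>\G\<close> with its pullback to \<open>G\<close>; left invariant forms on \<open>G\<close> all descend to \<open>X\<close>.

  A form \<open>\<alpha>\<close> is given by its coefficients in the coordinate coframe
  \<open>e\<^sub>1, e\<^sub>2, e\<^sub>3 = dz\<^sup>1, dz\<^sup>2, dz\<^sup>3\<close> and \<open>e\<^sub>4, e\<^sub>5, e\<^sub>6\<close> = their conjugates: for
  \<open>K = {k\<^sub>1 < \<dots> < k\<^sub>r} \<subseteq> {1..6}\<close>, \<open>\<alpha> z K\<close> is the coefficient at \<open>z\<close> of
  \<open>e\<^bsub>k\<^sub>1\<^esub> \<and> \<dots> \<and> e\<^bsub>k\<^sub>r\<^esub>\<close>. The components of points are indexed by the numeral type \<open>3\<close>, hence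
  the coercions \<open>of_nat\<close> (with \<open>of_nat 3 = (3 :: 3)\<close>).\<close>

type_synonym point = "complex^3"
type_synonym form = "point \<Rightarrow> nat set \<Rightarrow> complex"

definition coframe :: "nat \<Rightarrow> form" where
  "coframe k = (\<lambda>z K. if K = {k} then 1 else 0)"

definition dz :: "nat \<Rightarrow> form" where
  "dz i = coframe i"

definition dzbar :: "nat \<Rightarrow> form" where
  "dzbar i = coframe (i + 3)"

definition one_form0 :: form where
  "one_form0 = (\<lambda>z K. if K = {} then 1 else 0)"

definition fmult :: "(point \<Rightarrow> complex) \<Rightarrow> form \<Rightarrow> form" where
  "fmult f \<alpha> = (\<lambda>z K. f z * \<alpha> z K)"

definition shuffle_sign :: "nat set \<Rightarrow> nat set \<Rightarrow> complex" where
  "shuffle_sign A B = (-1) ^ card {(a, b). a \<in> A \<and> b \<in> B \<and> b < a}"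

definition wedge :: "form \<Rightarrow> form \<Rightarrow> form" (infixr \<open>\<and>\<^sub>f\<close> 70) where
  "\<alpha> \<and>\<^sub>f \<beta> = (\<lambda>z K. \<Sum>A\<in>Pow K. shuffle_sign A (K - A) * \<alpha> z A * \<beta> z (K - A))"

text \<open>The Wirtinger derivatives with respect to \<open>z\<^sup>k\<close> and to its conjugate.
  They are meaningful for real differentiable functions only; the coefficients of left invariant
  forms are polynomials in \<open>z\<^sup>1\<close> and its conjugate.\<close>

definition wirt :: "nat \<Rightarrow> (point \<Rightarrow> complex) \<Rightarrow> point \<Rightarrow> complex" where
  "wirt k f z = (frechet_derivative f (at z) (axis (of_nat k) 1)
     - \<i> * frechet_derivative f (at z) (axis (of_nat k) \<i>)) / 2"

definition wirt_bar :: "nat \<Rightarrow> (point \<Rightarrow> complex) \<Rightarrow> point \<Rightarrow> complex" where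
  "wirt_bar k f z = (frechet_derivative f (at z) (axis (of_nat k) 1)
     + \<i> * frechet_derivative f (at z) (axis (of_nat k) \<i>)) / 2"

definition del :: "form \<Rightarrow> form" where
  "del \<alpha> = (\<Sum>k\<in>{1..3}. dz k \<and>\<^sub>f (\<lambda>z K. wirt k (\<lambda>w. \<alpha> w K) z))"

definition delbar :: "form \<Rightarrow> form" where
  "delbar \<alpha> = (\<Sum>k\<in>{1..3}. dzbar k \<and>\<^sub>f (\<lambda>z K. wirt_bar k (\<lambda>w. \<alpha> w K) z))"


subsection \<open>Left invariant forms\<close>

definition phi_form :: "nat \<Rightarrow> form" where
  "phi_form i = (if i = 3 then dz 3 - fmult (\<lambda>z. z $ 1) (dz 2) else dz i)"

definition phibar_form :: "nat \<Rightarrow> form" where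
  "phibar_form i = (if i = 3 then dzbar 3 - fmult (\<lambda>z. cnj (z $ 1)) (dzbar 2) else dzbar i)"

definition inv_monomial :: "nat set \<Rightarrow> nat set \<Rightarrow> form" where
  "inv_monomial I J = foldr (\<and>\<^sub>f)
     (map phi_form (sorted_list_of_set I) @ map phibar_form (sorted_list_of_set J)) one_form0"

definition inv_forms :: "int \<Rightarrow> int \<Rightarrow> form set" where
  "inv_forms p q = module.span scaleC
     {inv_monomial I J | I J. I \<subseteq> {1..3} \<and> J \<subseteq> {1..3} \<and> int (card I) = p \<and> int (card J) = q}"


subsection \<open>Contraction with vector valued forms\<close>

text \<open>\<open>v z k\<close> is the coefficient of \<open>\<partial>/\<partial>z\<^sup>k\<close> (with \<open>k \<in> {1..3}\<close>) in the \<open>(1,0)\<close>-vector field \<open>v\<close>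
  at \<open>z\<close>. Likewise the form \<open>\<phi> k\<close> is the coefficient of \<open>\<partial>/\<partial>z\<^sup>k\<close> in the vector valued form \<open>\<phi>\<close>.\<close>

type_synonym vfield = "point \<Rightarrow> nat \<Rightarrow> complex"
type_synonym vform = "nat \<Rightarrow> form"

definition interior_coord :: "nat \<Rightarrow> form \<Rightarrow> form" where
  "interior_coord k \<alpha> =
     (\<lambda>z K. if k \<in> K then 0 else (-1) ^ card {j \<in> K. j < k} * \<alpha> z (insert k K))"

definition interior_prod :: "vfield \<Rightarrow> form \<Rightarrow> form" where
  "interior_prod v \<alpha> = (\<Sum>k\<in>{1..3}. fmult (\<lambda>z. v z k) (interior_coord k \<alpha>))"

definition tensor :: "vfield \<Rightarrow> form \<Rightarrow> vform" where
  "tensor v \<psi> = (\<lambda>k. fmult (\<lambda>z. v z k) \<psi>)"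

definition contr :: "vform \<Rightarrow> form \<Rightarrow> form" where
  "contr \<phi> \<alpha> = (\<Sum>k\<in>{1..3}. \<phi> k \<and>\<^sub>f interior_coord k \<alpha>)"

lemma sum_fun_apply: "(\<Sum>k\<in>S. f k) x = (\<Sum>k\<in>S. f k x)"
  by (induction S rule: infinite_finite_induct) auto

lemma contr_add: "contr (\<phi> + \<phi>') \<alpha> = contr \<phi> \<alpha> + contr \<phi>' \<alpha>"
  by (simp add: contr_def wedge_def fun_eq_iff sum_fun_apply algebra_simps sum.distrib)

lemma contr_scaleC: "contr (c *\<^sub>C \<phi>) \<alpha> = c *\<^sub>C contr \<phi> \<alpha>"
  by (simp add: contr_def wedge_def fun_eq_iff sum_fun_apply scaleC_fun_def scaleC_complex_def
      sum_distrib_left mult_ac)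

lemma contr_tensor: "contr (tensor v \<psi>) \<alpha> = \<psi> \<and>\<^sub>f interior_prod v \<alpha>"
proof (intro ext)
  fix z K
  have "(\<psi> \<and>\<^sub>f interior_prod v \<alpha>) z K =
      (\<Sum>A\<in>Pow K. \<Sum>k\<in>{1..3}.
         shuffle_sign A (K - A) * \<psi> z A * (v z k * interior_coord k \<alpha> z (K - A)))"
    by (simp only: wedge_def interior_prod_def fmult_def sum_fun_apply sum_distrib_left)
  also have "\<dots> = contr (tensor v \<psi>) \<alpha> z K"
    by (subst sum.swap)
      (simp add: contr_def wedge_def tensor_def fmult_def sum_fun_apply mult_ac)
  finally show "contr (tensor v \<psi>) \<alpha> z K = (\<psi> \<and>\<^sub>f interior_prod v \<alpha>) z K" ..
qed


section \<open>The Kuranishi family of the Iwasawa manifold\<close>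

text \<open>The parameter \<open>t\<^bsub>i\<lambda>\<^esub>\<close> is \<open>t $ i $ \<lambda>\<close>. A small radius \<open>\<epsilon>\<close> is needed for
  \<open>beltrami t\<close> to define a complex manifold \<open>X\<^sub>t\<close>, but not for \<open>inv_dcomplex t\<close>.\<close>

type_synonym kparam = "complex^2^3"

definition Kuranishi_base :: "real \<Rightarrow> kparam set" where
  "Kuranishi_base \<epsilon> = {t. \<forall>i l. norm (t $ i $ l) < \<epsilon>}"

definition theta :: "nat \<Rightarrow> vfield" where
  "theta i = (\<lambda>z k. if k = i then 1 else if i = 2 \<and> k = 3 then z $ 1 else 0)"

definition D_par :: "kparam \<Rightarrow> complex" where
  "D_par t = t $ 1 $ 1 * t $ 2 $ 2 - t $ 2 $ 1 * t $ 1 $ 2"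

definition beltrami :: "kparam \<Rightarrow> vform" where
  "beltrami t =
     (\<Sum>i\<in>{1..3}. \<Sum>l\<in>{1..2}. (t $ of_nat i $ of_nat l) *\<^sub>C tensor (theta i) (phibar_form l))
     - D_par t *\<^sub>C tensor (theta 3) (phibar_form 3)"

definition lie10 :: "vform \<Rightarrow> form \<Rightarrow> form" where
  "lie10 \<phi> \<alpha> = contr \<phi> (del \<alpha>) - del (contr \<phi> \<alpha>)"

definition delbar_phi :: "vform \<Rightarrow> form \<Rightarrow> form" where
  "delbar_phi \<phi> \<alpha> = delbar \<alpha> - lie10 \<phi> \<alpha>"

definition inv_dcomplex :: "kparam \<Rightarrow> form dcomplex" where
  "inv_dcomplex t = \<lparr>gr = inv_forms, d1 = (\<lambda>p q. del), d2 = (\<lambda>p q. delbar_phi (beltrami t))\<rparr>"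

end

theory Submission
  imports Defs
begin

text \<open>Left multiplications by \<open>\<phi>\<^sup>1, \<phi>\<^sup>2, \<phi>\<^sup>3\<close> and their conjugates are anticommuting operators, and both
  \<open>\<partial>\<close> and \<open>\<partial>\<^bsub>\<phi>(t)\<^esub>\<close>-bar are antiderivations with respect to them. So the double complex only depends on
  the values on generators: all of them are closed except that \<open>\<phi>\<^sup>3\<close> is mapped to \<open>-\<phi>\<^sup>1 \<and> \<phi>\<^sup>2\<close> by \<open>\<partial>\<close> and to
  \<open>\<eta> = \<Sum>\<^sub>i\<^sub>j n\<^sub>i\<^sub>j \<phi>\<^sup>i \<and> \<phi>\<^sup>j\<close>-bar by the second differential, where \<open>n = (t\<^sub>2\<^sub>1, t\<^sub>2\<^sub>2; -t\<^sub>1\<^sub>1, -t\<^sub>1\<^sub>2)\<close> has determinant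
  \<open>D(t)\<close>, while the conjugate of \<open>\<phi>\<^sup>3\<close> is mapped to minus the product of the conjugates of \<open>\<phi>\<^sup>1, \<phi>\<^sup>2\<close>.
  Unimodular changes of \<open>\<phi>\<^sup>1, \<phi>\<^sup>2\<close> and of their conjugates preserve these equations and make \<open>n\<close>
  diagonal; the three cases are the three possible ranks of \<open>n\<close>. For diagonal \<open>n\<close> a basis adapted to
  the zigzags is written down explicitly; since the dimensions are known, it is enough that the
  images of the zigzags span.\<close>

text \<open>The wedge enters only through left multiplications nested to the right, so
  anticommutation is all that is required of it. The Wirtinger derivatives obey the rules of
  calculus only on differentiable coefficients. This is why the abstract complex carries a domain
  \<open>V\<close>, closed under the generators, on which alone the differentials are assumed
  linear. The form \<eta> is the contraction of \<phi>^1 \<and> \<phi>^2 with the Beltrami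
  differential, by \<partial>\<phi>^3 = -\<phi>^1 \<and> \<phi>^2: contracting \<phi>^2 gives the
  row of t_21, t_22, and contracting \<phi>^1 gives the row of t_11, t_12, with a minus sign from
  reordering. Determinant one is what leaves \<phi>^1 \<and> \<phi>^2 and its conjugate unchanged
  under a change of generators, and it preserves the determinant of n. For n = 0 the complex is the
  tensor product of a horizontal and a vertical complex. Each nonzero diagonal entry of n makes the
  second differential of \<phi>^3 join horizontal zigzags to dots, which is the origin of the
  zigzags of length 3.\<close>

interpretation cvs: vector_space "scaleC :: complex \<Rightarrow> 'a::complex_vector \<Rightarrow> 'a"
  by (rule vector_space_scaleC)

section \<open>Isomorphisms onto direct sums of zigzags\<close>

text \<open>If \<open>x j\<close> were nonzero, \<open>v j\<close> would be a combination of the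
  other vectors, and \<open>V\<close> would be spanned by fewer than \<open>card I\<close> vectors.
  This turns a count and a spanning statement into independence. The family is indexed, so repeated
  vectors are counted with multiplicity.\<close>

lemma vanishing_combination:
  fixes v :: "'i \<Rightarrow> 'a::complex_vector"
  assumes "finite I" and span: "V \<subseteq> cvs.span (v ` I)" and card: "card I \<le> cvs.dim V"
    and sum: "(\<Sum>i\<in>I. x i *\<^sub>C v i) = 0" and j: "j \<in> I"
  shows "x j = 0"
proof (rule ccontr)
  assume nz: "x j \<noteq> 0"
  let ?W = "cvs.span (v ` (I - {j}))"
  have "x j *\<^sub>C v j + (\<Sum>i\<in>I - {j}. x i *\<^sub>C v i) = 0"
    using sum sum.remove[OF \<open>finite I\<close> j, of "\<lambda>i. x i *\<^sub>C v i"] by simp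
  then have "x j *\<^sub>C v j = - (\<Sum>i\<in>I - {j}. x i *\<^sub>C v i)"
    by (simp add: eq_neg_iff_add_eq_0)
  also have "\<dots> \<in> ?W"
    by (intro cvs.span_neg cvs.span_sum cvs.span_scale cvs.span_base) auto
  finally have "inverse (x j) *\<^sub>C x j *\<^sub>C v j \<in> ?W"
    by (rule cvs.span_scale)
  then have "v j \<in> ?W"
    using nz by (simp add: scaleC_scaleC scaleC_one)
  then have "v ` I \<subseteq> ?W"
    by (auto intro: cvs.span_base)
  then have "V \<subseteq> ?W"
    using span cvs.span_minimal[OF _ cvs.subspace_span] by blast
  then have "cvs.dim V \<le> card (v ` (I - {j}))"
    by (rule cvs.dim_le_card) (use \<open>finite I\<close> in simp)
  also have "\<dots> \<le> card (I - {j})"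
    using \<open>finite I\<close> by (simp add: card_image_le)
  also have "\<dots> < card I"
    using \<open>finite I\<close> j by (rule card_Diff1_less)
  finally show False
    using card by simp
qed

text \<open>A morphism \<open>C \<rightarrow> A\<close> from a zigzag is given by the images \<open>v p q\<close> of the unit vectors.\<close>

definition dc_hom :: "complex dcomplex \<Rightarrow> 'a::complex_vector dcomplex \<Rightarrow> (int \<Rightarrow> int \<Rightarrow> 'a) \<Rightarrow> bool"
  where "dc_hom C A v \<longleftrightarrow> (\<forall>p q. v p q \<in> gr A p q \<and>
    (gr C p q = UNIV \<or> gr C p q = {0} \<and> v p q = 0) \<and>
    (\<forall>x\<in>gr C p q.
       d1 A p q (x *\<^sub>C v p q) = d1 C p q x *\<^sub>C v (p + 1) q \<and>
       d2 A p q (x *\<^sub>C v p q) = d2 C p q x *\<^sub>C v p (q + 1)))"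

lemma linear_map_on_sum:
  assumes "linear_map_on V W f" "cvs.subspace V" "\<And>i. i \<in> I \<Longrightarrow> y i \<in> V"
  shows "f (\<Sum>i\<in>I. y i) = (\<Sum>i\<in>I. f (y i))"
proof -
  have "f (0 *\<^sub>C 0) = 0 *\<^sub>C f 0"
    using assms(1) cvs.subspace_0[OF assms(2)] unfolding linear_map_on_def by blast
  then have f0: "f 0 = 0" by simp
  show ?thesis
    using assms(3)
  proof (induction I rule: infinite_finite_induct)
    case (insert i I)
    then show ?case
      using assms(1) cvs.subspace_sum[OF assms(2), of I y] by (simp add: linear_map_on_def)
  qed (simp_all add: f0)
qed

text \<open>The comparison map is naturally built out of the direct sum, while the theorem states
  isomorphisms into it. That \<open>A\<close> is a double complex keeps \<open>d1\<close> and
  \<open>d2\<close> inside \<open>gr A\<close>, where values of the inverse are recognised by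
  injectivity.\<close>

lemma dc_iso_sym:
  assumes A: "double_complex A" and iso: "A \<cong>\<^sub>d\<^sub>c B"
  shows "B \<cong>\<^sub>d\<^sub>c A"
proof -
  obtain f where lin: "\<And>p q. linear_map_on (gr A p q) (gr B p q) (f p q)"
    and bij: "\<And>p q. bij_betw (f p q) (gr A p q) (gr B p q)"
    and comm: "\<And>p q x. x \<in> gr A p q \<Longrightarrow> f (p + 1) q (d1 A p q x) = d1 B p q (f p q x) \<and>
        f p (q + 1) (d2 A p q x) = d2 B p q (f p q x)"
    using iso unfolding dc_iso_def by blast
  define g where "g p q = the_inv_into (gr A p q) (f p q)" for p q
  have gr: "g p q y \<in> gr A p q" and fg: "f p q (g p q y) = y" if "y \<in> gr B p q" for p q y
    using bij[of p q] that the_inv_into_into[of "f p q" "gr A p q" y "gr A p q"]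
    by (auto simp: g_def bij_betw_def f_the_inv_into_f)
  have eq: "g p q y = x" if "x \<in> gr A p q" "f p q x = y" for p q x y
    using bij[of p q] that by (auto simp: g_def bij_betw_def the_inv_into_f_f)
  have sub: "cvs.subspace (gr A p q)" for p q
    using A by (simp add: double_complex_def)
  have "linear_map_on (gr B p q) (gr A p q) (g p q)" for p q
    unfolding linear_map_on_def
  proof (intro conjI ballI allI)
    show "g p q ` gr B p q \<subseteq> gr A p q" using gr by auto
    fix x assume x: "x \<in> gr B p q"
    show "g p q (c *\<^sub>C x) = c *\<^sub>C g p q x" for c
      using lin[of p q] x gr fg sub by (intro eq) (auto simp: linear_map_on_def cvs.subspace_scale)
    fix y assume y: "y \<in> gr B p q"
    show "g p q (x + y) = g p q x + g p q y"
      using lin[of p q] x y gr fg sub by (intro eq) (auto simp: linear_map_on_def cvs.subspace_add)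
  qed
  moreover have "bij_betw (g p q) (gr B p q) (gr A p q)" for p q
    unfolding g_def using bij by (rule bij_betw_the_inv_into)
  moreover have "g (p + 1) q (d1 B p q y) = d1 A p q (g p q y) \<and>
      g p (q + 1) (d2 B p q y) = d2 A p q (g p q y)" if y: "y \<in> gr B p q" for p q y
  proof -
    have mem: "d1 A p q (g p q y) \<in> gr A (p + 1) q" "d2 A p q (g p q y) \<in> gr A p (q + 1)"
      using A gr[OF y] by (auto simp: double_complex_def linear_map_on_def image_subset_iff)
    show ?thesis
      using comm[OF gr[OF y]] fg[OF y] mem by (auto intro!: eq)
  qed
  ultimately show ?thesis
    unfolding dc_iso_def by blast
qed

text \<open>Each summand has dimension at most one in each bidegree, so the number of summands alive
  at \<open>(p, q)\<close> is the dimension of the sum there. Spanning makes the comparison map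
  surjective, and the bound on this number makes it injective.\<close>

lemma dc_iso_dc_sumI:
  fixes A :: "'a::complex_vector dcomplex"
  assumes A: "double_complex A"
    and hom: "\<And>C v. (C, v) \<in> set L \<Longrightarrow> double_complex C \<and> dc_hom C A v"
    and span: "\<And>p q. gr A p q \<subseteq> cvs.span ((\<lambda>(C, v). v p q) ` set L)"
    and card: "\<And>p q. length (filter (\<lambda>(C, v). gr C p q \<noteq> {0}) L) \<le> cvs.dim (gr A p q)"
  shows "A \<cong>\<^sub>d\<^sub>c dc_sum (map fst L)"
proof -
  let ?B = "dc_sum (map fst L)" and ?n = "length L"
  define C where "C i = fst (L ! i)" for i
  define v where "v i = snd (L ! i)" for i
  \<comment> \<open>The summands alive in bidegree \<open>(p, q)\<close>; only they contribute a
    coordinate and an image vector.\<close>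
  define I where "I p q = {i. i < ?n \<and> gr (C i) p q \<noteq> {0}}" for p q
  define g where "g p q x = (\<Sum>i<?n. x i *\<^sub>C v i p q)" for p q and x :: "nat \<Rightarrow> complex"
  have sub: "cvs.subspace (gr A p q)"
    and l1: "linear_map_on (gr A p q) (gr A (p + 1) q) (d1 A p q)"
    and l2: "linear_map_on (gr A p q) (gr A p (q + 1)) (d2 A p q)" for p q
    using A by (auto simp: double_complex_def)
  have dcC: "double_complex (C i)" and homC: "dc_hom (C i) A (v i)" if "i < ?n" for i
    using hom[of "C i" "v i"] that by (auto simp: C_def v_def)
  have vgr: "v i p q \<in> gr A p q" if "i < ?n" for i p q
    using homC[OF that] by (auto simp: dc_hom_def)
  have grC: "gr (C i) p q = UNIV" if "i \<in> I p q" for i p q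
    using homC[of i] that by (auto simp: dc_hom_def I_def)
  have UNIV_neq: "(UNIV :: complex set) \<noteq> {0}"
    using one_neq_zero by blast
  have v0: "v i p q = 0" if "i < ?n" "i \<notin> I p q" for i p q
  proof -
    have "gr (C i) p q = {0}"
      using that by (simp add: I_def)
    moreover have "gr (C i) p q = UNIV \<or> gr (C i) p q = {0} \<and> v i p q = 0"
      using homC[OF that(1)] unfolding dc_hom_def by blast
    ultimately show ?thesis
      using UNIV_neq by metis
  qed
  have grB: "gr ?B p q = {x. (\<forall>i<?n. x i \<in> gr (C i) p q) \<and> (\<forall>i\<ge>?n. x i = 0)}" for p q
    by (simp add: dc_sum_def C_def)
  have d1B: "d1 ?B p q x i = (if i < ?n then d1 (C i) p q (x i) else 0)"
    and d2B: "d2 ?B p q x i = (if i < ?n then d2 (C i) p q (x i) else 0)" for p q x i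
    by (simp_all add: dc_sum_def C_def)
  have finI: "finite (I p q)" for p q by (simp add: I_def)
  have gI: "g p q x = (\<Sum>i\<in>I p q. x i *\<^sub>C v i p q)" for p q x
    unfolding g_def by (rule sum.mono_neutral_right) (auto simp: I_def v0)
  have cardI: "card (I p q) \<le> cvs.dim (gr A p q)" for p q
    using card[of p q] by (simp add: length_filter_conv_card I_def C_def case_prod_unfold)
  have spanI: "gr A p q \<subseteq> cvs.span ((\<lambda>i. v i p q) ` I p q)" for p q
  proof -
    have "v i p q \<in> cvs.span ((\<lambda>i. v i p q) ` I p q)" if "i < ?n" for i
      using v0[OF that] by (cases "i \<in> I p q") (auto intro: cvs.span_base cvs.span_zero)
    moreover have "(\<lambda>(C, v). v p q) ` set L = (\<lambda>i. v i p q) ` {..<?n}"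
      unfolding v_def case_prod_unfold set_conv_nth by auto
    ultimately have "(\<lambda>(C, v). v p q) ` set L \<subseteq> cvs.span ((\<lambda>i. v i p q) ` I p q)"
      by auto
    then show ?thesis
      using span[of p q] cvs.span_minimal[OF _ cvs.subspace_span] by blast
  qed
  have xI: "x i = 0" if "x \<in> gr ?B p q" "i \<notin> I p q" for x p q i
    using that by (cases "i < ?n") (auto simp: grB I_def)
  have subB: "cvs.subspace (gr (C i) p q)" if "i < ?n" for i p q
    using dcC[OF that] by (auto simp: double_complex_def)
  have inj: "inj_on (g p q) (gr ?B p q)" for p q
  proof (rule inj_onI)
    fix x y assume xy: "x \<in> gr ?B p q" "y \<in> gr ?B p q" and eq: "g p q x = g p q y"
    have "(\<Sum>i\<in>I p q. (x i - y i) *\<^sub>C v i p q) = 0"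
      using eq by (simp add: gI cvs.scale_left_diff_distrib sum_subtractf)
    then have "x i - y i = 0" if "i \<in> I p q" for i
      using vanishing_combination[OF finI spanI cardI _ that, where x = "\<lambda>i. x i - y i"] by blast
    then show "x = y"
      using xI[OF xy(1)] xI[OF xy(2)] by (intro ext) (metis eq_iff_diff_eq_0)
  qed
  have surj: "g p q ` gr ?B p q = gr A p q" for p q
  proof
    show "g p q ` gr ?B p q \<subseteq> gr A p q"
      unfolding g_def using vgr sub by (auto intro!: cvs.subspace_sum cvs.subspace_scale)
    show "gr A p q \<subseteq> g p q ` gr ?B p q"
    proof
      fix a assume "a \<in> gr A p q"
      then have "a \<in> cvs.span ((\<lambda>i. v i p q) ` I p q)" using spanI by auto
      then have "\<exists>x. a = (\<Sum>i\<in>I p q. x i *\<^sub>C v i p q)"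
      proof (induction rule: cvs.span_induct_alt)
        case base
        show ?case by (rule exI[of _ "\<lambda>_. 0"]) simp
      next
        case (step c w a)
        then obtain j x where j: "j \<in> I p q" "w = v j p q"
          and x: "a = (\<Sum>i\<in>I p q. x i *\<^sub>C v i p q)" by auto
        have "(\<Sum>i\<in>I p q. ((if i = j then c else 0) + x i) *\<^sub>C v i p q) =
            (\<Sum>i\<in>I p q. if i = j then c *\<^sub>C v i p q else 0) + a"
          unfolding x sum.distrib[symmetric]
          by (rule sum.cong) (auto simp: scaleC_add_left)
        also have "\<dots> = c *\<^sub>C w + a"
          using j finI by simp
        finally show ?case by metis
      qed
      then obtain x where x: "a = (\<Sum>i\<in>I p q. x i *\<^sub>C v i p q)" by blast
      \<comment> \<open>Coordinates outside \<open>I p q\<close> are set to zero because those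
        components of the direct sum are trivial.\<close>
      let ?x = "\<lambda>i. if i \<in> I p q then x i else 0"
      have "?x i \<in> gr (C i) p q" if "i < ?n" for i
        using grC cvs.subspace_0[OF subB[OF that]] by simp
      then have "?x \<in> gr ?B p q"
        unfolding grB by (simp add: I_def)
      moreover have "g p q ?x = a" by (simp add: gI x)
      ultimately show "a \<in> g p q ` gr ?B p q" by blast
    qed
  qed
  have "linear_map_on (gr ?B p q) (gr A p q) (g p q)" for p q
    using surj[of p q] unfolding linear_map_on_def
    by (auto simp: g_def scaleC_add_left sum.distrib scaleC_fun_def scaleC_complex_def
        cvs.scale_sum_right)
  moreover have "bij_betw (g p q) (gr ?B p q) (gr A p q)" for p q
    using inj surj by (simp add: bij_betw_def)
  moreover have "g (p + 1) q (d1 ?B p q x) = d1 A p q (g p q x) \<and>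
      g p (q + 1) (d2 ?B p q x) = d2 A p q (g p q x)" if x: "x \<in> gr ?B p q" for p q x
  proof -
    have mem: "x i *\<^sub>C v i p q \<in> gr A p q" if "i < ?n" for i
      using vgr[OF that] sub by (auto intro: cvs.subspace_scale)
    have "d1 A p q (x i *\<^sub>C v i p q) = d1 (C i) p q (x i) *\<^sub>C v i (p + 1) q \<and>
        d2 A p q (x i *\<^sub>C v i p q) = d2 (C i) p q (x i) *\<^sub>C v i p (q + 1)" if "i < ?n" for i
      using homC[OF that] x that by (auto simp: dc_hom_def grB)
    then show ?thesis
      unfolding g_def
      by (subst linear_map_on_sum[OF l1 sub], use mem in simp,
          subst linear_map_on_sum[OF l2 sub], use mem in simp) (simp add: d1B d2B)
  qed
  ultimately have "?B \<cong>\<^sub>d\<^sub>c A"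
    unfolding dc_iso_def by blast
  moreover have "double_complex ?B"
  proof -
    have lin: "linear_map_on (gr (C i) p q) (gr (C i) (p + 1) q) (d1 (C i) p q)"
      "linear_map_on (gr (C i) p q) (gr (C i) p (q + 1)) (d2 (C i) p q)" if "i < ?n" for i p q
      using dcC[OF that] by (auto simp: double_complex_def)
    show ?thesis
      unfolding double_complex_def
    proof (intro allI conjI ballI)
      fix p q
      show "module.subspace scaleC (gr ?B p q)"
        using subB[THEN cvs.subspace_add] subB[THEN cvs.subspace_0] subB[THEN cvs.subspace_scale]
        by (intro cvs.subspaceI) (auto simp: grB scaleC_fun_def)
      show "linear_map_on (gr ?B p q) (gr ?B (p + 1) q) (d1 ?B p q)"
        "linear_map_on (gr ?B p q) (gr ?B p (q + 1)) (d2 ?B p q)"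
        using lin unfolding linear_map_on_def
        by (auto simp: grB d1B d2B fun_eq_iff scaleC_fun_def image_subset_iff)
      fix x assume x: "x \<in> gr ?B p q"
      then have xi: "x i \<in> gr (C i) p q" if "i < ?n" for i using that by (simp add: grB)
      show "d1 ?B (p + 1) q (d1 ?B p q x) = 0" "d2 ?B p (q + 1) (d2 ?B p q x) = 0"
        "d1 ?B p (q + 1) (d2 ?B p q x) + d2 ?B (p + 1) q (d1 ?B p q x) = 0"
        using dcC xi by (auto simp: d1B d2B fun_eq_iff double_complex_def)
    qed
  qed
  ultimately show ?thesis
    by (rule dc_iso_sym[rotated])
qed

section \<open>Wedge products with one-forms\<close>

lemma wedge_infinite: "infinite K \<Longrightarrow> (\<alpha> \<and>\<^sub>f \<beta>) z K = 0"
  by (simp add: wedge_def finite_Pow_iff)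

text \<open>For infinite \<open>K\<close> the sum over \<open>Pow K\<close> is 0 by convention, so
  only finite index sets matter. A factor may thus be replaced by one known to agree with it on
  finite sets, which is what \<open>interior_coframe\<close> provides.\<close>

lemma wedge_cong:
  assumes "\<And>z K. finite K \<Longrightarrow> \<beta> z K = \<gamma> z K"
  shows "\<alpha> \<and>\<^sub>f \<beta> = \<alpha> \<and>\<^sub>f \<gamma>"
proof (intro ext)
  fix z K
  show "(\<alpha> \<and>\<^sub>f \<beta>) z K = (\<alpha> \<and>\<^sub>f \<gamma>) z K"
    using assms by (cases "finite K") (auto simp: wedge_infinite wedge_def intro!: sum.cong)
qed

lemma wedge_add_right: "\<alpha> \<and>\<^sub>f (\<beta> + \<gamma>) = \<alpha> \<and>\<^sub>f \<beta> + \<alpha> \<and>\<^sub>f \<gamma>"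
  by (simp add: wedge_def fun_eq_iff algebra_simps sum.distrib)

lemma wedge_diff_right: "\<alpha> \<and>\<^sub>f (\<beta> - \<gamma>) = \<alpha> \<and>\<^sub>f \<beta> - \<alpha> \<and>\<^sub>f \<gamma>"
  by (simp add: wedge_def fun_eq_iff algebra_simps sum_subtractf)

lemma wedge_minus_right: "\<alpha> \<and>\<^sub>f (- \<beta>) = - (\<alpha> \<and>\<^sub>f \<beta>)"
  by (simp add: wedge_def fun_eq_iff sum_negf)

lemma wedge_zero_right: "\<alpha> \<and>\<^sub>f 0 = 0"
  by (simp add: wedge_def fun_eq_iff)

lemma wedge_add_left: "(\<alpha> + \<beta>) \<and>\<^sub>f \<gamma> = \<alpha> \<and>\<^sub>f \<gamma> + \<beta> \<and>\<^sub>f \<gamma>"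
  by (simp add: wedge_def fun_eq_iff algebra_simps sum.distrib)

lemma wedge_diff_left: "(\<alpha> - \<beta>) \<and>\<^sub>f \<gamma> = \<alpha> \<and>\<^sub>f \<gamma> - \<beta> \<and>\<^sub>f \<gamma>"
  by (simp add: wedge_def fun_eq_iff algebra_simps sum_subtractf)

lemma wedge_zero_left: "0 \<and>\<^sub>f \<alpha> = 0"
  by (simp add: wedge_def fun_eq_iff)

lemma wedge_fmult_right: "\<alpha> \<and>\<^sub>f fmult f \<beta> = fmult f (\<alpha> \<and>\<^sub>f \<beta>)"
  by (simp add: wedge_def fmult_def fun_eq_iff sum_distrib_left mult_ac)

lemma wedge_fmult_left: "fmult f \<alpha> \<and>\<^sub>f \<beta> = fmult f (\<alpha> \<and>\<^sub>f \<beta>)"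
  by (simp add: wedge_def fmult_def fun_eq_iff sum_distrib_left mult_ac)

lemma scaleC_eq_fmult: "c *\<^sub>C \<alpha> = fmult (\<lambda>_. c) \<alpha>"
  by (simp add: fmult_def scaleC_fun_def scaleC_complex_def)

lemma wedge_scaleC_right: "\<alpha> \<and>\<^sub>f (c *\<^sub>C \<beta>) = c *\<^sub>C (\<alpha> \<and>\<^sub>f \<beta>)"
  by (simp only: scaleC_eq_fmult wedge_fmult_right)

lemma wedge_scaleC_left: "(c *\<^sub>C \<alpha>) \<and>\<^sub>f \<beta> = c *\<^sub>C (\<alpha> \<and>\<^sub>f \<beta>)"
  by (simp only: scaleC_eq_fmult wedge_fmult_left)

lemma wedge_sum_left: "(\<Sum>k\<in>S. \<alpha> k) \<and>\<^sub>f \<beta> = (\<Sum>k\<in>S. \<alpha> k \<and>\<^sub>f \<beta>)"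
 proof (induction S rule: infinite_finite_induct)
  case (infinite S)
  then show ?case by (simp only: sum.infinite wedge_zero_left simp_thms)
next
  case empty
  show ?case by (simp only: sum.empty wedge_zero_left)
next
  case (insert k S)
  then show ?case by (simp only: sum.insert[OF insert.hyps] wedge_add_left)
qed

lemma wedge_sum_right: "\<beta> \<and>\<^sub>f (\<Sum>k\<in>S. \<alpha> k) = (\<Sum>k\<in>S. \<beta> \<and>\<^sub>f \<alpha> k)"
 proof (induction S rule: infinite_finite_induct)
  case (infinite S)
  then show ?case by (simp only: sum.infinite wedge_zero_right simp_thms)
next
  case empty
  show ?case by (simp only: sum.empty wedge_zero_right)
next
  case (insert k S)
  then show ?case by (simp only: sum.insert[OF insert.hyps] wedge_add_right)
qed

lemma fmult_distrib:
  "fmult f (\<alpha> + \<beta>) = fmult f \<alpha> + fmult f \<beta>"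
  "fmult f (\<alpha> - \<beta>) = fmult f \<alpha> - fmult f \<beta>"
  "fmult f (- \<alpha>) = - fmult f \<alpha>"
  "fmult f 0 = 0"
  by (simp_all add: fmult_def fun_eq_iff algebra_simps)

lemma fmult_sum: "fmult f (\<Sum>k\<in>S. \<alpha> k) = (\<Sum>k\<in>S. fmult f (\<alpha> k))"
 proof (induction S rule: infinite_finite_induct)
  case (infinite S)
  then show ?case by (simp only: sum.infinite fmult_distrib simp_thms)
next
  case empty
  show ?case by (simp only: sum.empty fmult_distrib)
next
  case (insert k S)
  then show ?case by (simp only: sum.insert[OF insert.hyps] fmult_distrib)
qed

lemma fmult_fmult: "fmult f (fmult g \<alpha>) = fmult (\<lambda>z. f z * g z) \<alpha>"
  by (simp add: fmult_def mult_ac)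

text \<open>For \<open>k\<close> in \<open>K\<close>, the sign of moving the factor with index
  \<open>k\<close> to the front of the monomial indexed by \<open>K\<close>.\<close>

definition rank_sign :: "nat \<Rightarrow> nat set \<Rightarrow> complex" where
  "rank_sign k K = (-1) ^ card {j\<in>K. j < k}"

lemma wedge_coframe:
  "(coframe k \<and>\<^sub>f \<alpha>) z K =
     (if finite K \<and> k \<in> K then rank_sign k K * \<alpha> z (K - {k}) else 0)"
proof (cases "finite K")
  case True
  have eq: "shuffle_sign A (K - A) * coframe k z A * \<alpha> z (K - A) =
      (if A = {k} then shuffle_sign {k} (K - {k}) * \<alpha> z (K - {k}) else 0)" for A
    by (simp add: coframe_def)
  have "{(a, b). a \<in> {k} \<and> b \<in> K - {k} \<and> b < a} = Pair k ` {j\<in>K. j < k}"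
    by auto
  then have "shuffle_sign {k} (K - {k}) = rank_sign k K"
    by (simp add: shuffle_sign_def rank_sign_def card_image inj_on_def)
  then show ?thesis
    using True unfolding wedge_def eq by (simp add: sum.delta)
qed (simp add: wedge_infinite)

text \<open>Deleting the smaller of two indices lowers the rank of the larger by one, while deleting
  the larger leaves the rank of the smaller unchanged.\<close>

lemma rank_sign_swap:
  assumes "finite K" "i \<in> K" "j \<in> K" "i \<noteq> j"
  shows "rank_sign i K * rank_sign j (K - {i}) = - (rank_sign j K * rank_sign i (K - {j}))"
proof -
  have *: "rank_sign i K * rank_sign j (K - {i}) = - (rank_sign j K * rank_sign i (K - {j}))"
    if "i < j" "i \<in> K" for i j
  proof -
    have "{l \<in> K. l < j} = insert i {l \<in> K - {i}. l < j}" "i \<notin> {l \<in> K - {i}. l < j}"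
      using that by auto
    then have "rank_sign j K = - rank_sign j (K - {i})"
      using \<open>finite K\<close> by (simp add: rank_sign_def)
    moreover have "{l \<in> K - {j}. l < i} = {l \<in> K. l < i}"
      using that by auto
    ultimately show ?thesis
      by (simp add: rank_sign_def)
  qed
  show ?thesis
    using *[of i j] *[of j i] assms by (cases "i < j") auto
qed

lemma wedge_coframe_anticomm:
  "coframe i \<and>\<^sub>f coframe j \<and>\<^sub>f \<alpha> = - (coframe j \<and>\<^sub>f coframe i \<and>\<^sub>f \<alpha>)"
proof (intro ext)
  fix z K
  show "(coframe i \<and>\<^sub>f coframe j \<and>\<^sub>f \<alpha>) z K = (- (coframe j \<and>\<^sub>f coframe i \<and>\<^sub>f \<alpha>)) z K"
  proof (cases "finite K \<and> i \<in> K \<and> j \<in> K \<and> i \<noteq> j")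
    case True
    then have "K - {i} - {j} = K - {j} - {i}" by auto
    then show ?thesis
      using True rank_sign_swap[of K i j]
      by (simp add: wedge_coframe mult.assoc[symmetric])
  qed (auto simp: wedge_coframe)
qed

text \<open>Coefficients are functions, so that the invariant coframe and the components of
  \<open>beltrami t\<close> are covered. Anticommutation reduces by bilinearity to the coordinate
  coframe.\<close>

definition one_form :: "form \<Rightarrow> bool" where
  "one_form \<psi> \<longleftrightarrow> (\<exists>c. \<psi> = (\<Sum>k\<in>{1..6}. fmult (c k) (coframe k)))"

lemma one_form_coframe: "k \<in> {1..6} \<Longrightarrow> one_form (coframe k)"
  unfolding one_form_def
proof
  assume k: "k \<in> {1..6}"
  have *: "fmult (\<lambda>_. if j = k then 1 else 0) (coframe j) = (if j = k then coframe k else 0)" for j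
    by (simp add: fmult_def fun_eq_iff)
  show "coframe k = (\<Sum>j\<in>{1..6}. fmult (\<lambda>_. if j = k then 1 else 0) (coframe j))"
    unfolding * using k by simp
qed

lemma one_form_add: "one_form \<psi> \<Longrightarrow> one_form \<omega> \<Longrightarrow> one_form (\<psi> + \<omega>)"
proof -
  assume "one_form \<psi>" "one_form \<omega>"
  then obtain c d where "\<psi> = (\<Sum>k\<in>{1..6}. fmult (c k) (coframe k))"
    "\<omega> = (\<Sum>k\<in>{1..6}. fmult (d k) (coframe k))"
    unfolding one_form_def by blast
  then have "\<psi> + \<omega> = (\<Sum>k\<in>{1..6}. fmult (\<lambda>z. c k z + d k z) (coframe k))"
    by (simp only: sum.distrib[symmetric]) (simp add: fmult_def fun_eq_iff sum_fun_apply algebra_simps)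
  then show ?thesis
    unfolding one_form_def by (intro exI[of _ "\<lambda>k z. c k z + d k z"])
qed

lemma one_form_fmult: "one_form \<psi> \<Longrightarrow> one_form (fmult f \<psi>)"
proof -
  assume "one_form \<psi>"
  then obtain c where "\<psi> = (\<Sum>k\<in>{1..6}. fmult (c k) (coframe k))"
    unfolding one_form_def by blast
  then have "fmult f \<psi> = (\<Sum>k\<in>{1..6}. fmult (\<lambda>z. f z * c k z) (coframe k))"
    by (simp only: fmult_sum fmult_fmult)
  then show ?thesis
    unfolding one_form_def by (intro exI[of _ "\<lambda>k z. f z * c k z"])
qed

lemma one_form_0: "one_form 0"
  unfolding one_form_def by (rule exI[of _ "\<lambda>_ _. 0"]) (simp add: fmult_def fun_eq_iff sum_fun_apply)

lemma one_form_sum: "(\<And>k. k \<in> S \<Longrightarrow> one_form (\<psi> k)) \<Longrightarrow> one_form (\<Sum>k\<in>S. \<psi> k)"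
proof (induction S rule: infinite_finite_induct)
  case (insert k S)
  then show ?case
    unfolding sum.insert[OF insert.hyps] by (intro one_form_add) simp_all
qed (simp_all only: sum.infinite sum.empty one_form_0 simp_thms)

lemma one_form_scaleC: "one_form \<psi> \<Longrightarrow> one_form (c *\<^sub>C \<psi>)"
  by (simp add: scaleC_eq_fmult one_form_fmult)

lemma one_form_diff: "one_form \<psi> \<Longrightarrow> one_form \<omega> \<Longrightarrow> one_form (\<psi> - \<omega>)"
proof -
  assume "one_form \<psi>" "one_form \<omega>"
  then have "one_form (\<psi> + fmult (\<lambda>_. -1) \<omega>)"
    by (intro one_form_add one_form_fmult)
  moreover have "\<psi> + fmult (\<lambda>_. -1) \<omega> = \<psi> - \<omega>"
    by (simp add: fmult_def fun_eq_iff)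
  ultimately show ?thesis by simp
qed

lemma wedge_one_form_anticomm:
  assumes "one_form \<psi>" "one_form \<omega>"
  shows "\<psi> \<and>\<^sub>f \<omega> \<and>\<^sub>f \<alpha> = - (\<omega> \<and>\<^sub>f \<psi> \<and>\<^sub>f \<alpha>)"
proof -
  obtain c d where \<psi>: "\<psi> = (\<Sum>k\<in>{1..6}. fmult (c k) (coframe k))"
    and \<omega>: "\<omega> = (\<Sum>k\<in>{1..6}. fmult (d k) (coframe k))"
    using assms unfolding one_form_def by blast
  let ?S = "\<lambda>f. \<Sum>l\<in>{1..6}. \<Sum>k\<in>{1..6}. f k l"
  have "\<psi> \<and>\<^sub>f \<omega> \<and>\<^sub>f \<alpha> = ?S (\<lambda>k l. fmult (\<lambda>z. d l z * c k z) (coframe k \<and>\<^sub>f coframe l \<and>\<^sub>f \<alpha>))"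
    unfolding \<psi> \<omega> wedge_sum_left wedge_fmult_left wedge_sum_right wedge_fmult_right fmult_sum fmult_fmult ..
  also have "\<dots> = ?S (\<lambda>k l. - fmult (\<lambda>z. c k z * d l z) (coframe l \<and>\<^sub>f coframe k \<and>\<^sub>f \<alpha>))"
    by (intro sum.cong refl, subst wedge_coframe_anticomm) (simp only: fmult_distrib mult.commute)
  also have "\<dots> = - (\<Sum>k\<in>{1..6}. \<Sum>l\<in>{1..6}. fmult (\<lambda>z. c k z * d l z) (coframe l \<and>\<^sub>f coframe k \<and>\<^sub>f \<alpha>))"
    by (subst sum.swap) (simp only: sum_negf)
  also have "\<dots> = - (\<omega> \<and>\<^sub>f \<psi> \<and>\<^sub>f \<alpha>)"
    unfolding \<psi> \<omega> wedge_sum_left wedge_fmult_left wedge_sum_right wedge_fmult_right fmult_sum fmult_fmult ..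
  finally show ?thesis .
qed

lemma wedge_one_form_self:
  assumes "one_form \<psi>"
  shows "\<psi> \<and>\<^sub>f \<psi> \<and>\<^sub>f \<alpha> = 0"
proof (intro ext)
  fix z K
  show "(\<psi> \<and>\<^sub>f \<psi> \<and>\<^sub>f \<alpha>) z K = 0 z K"
    using wedge_one_form_anticomm[OF assms assms, of \<alpha>] by (simp add: fun_eq_iff)
qed


section \<open>Contraction as a derivation\<close>

lemma rank_sign_simps:
  "rank_sign k (insert k K) = rank_sign k K"
  "rank_sign k (K - {k}) = rank_sign k K"
  "rank_sign k K * (rank_sign k K * x) = x"
proof -
  have "{l \<in> insert k K. l < k} = {l \<in> K. l < k}" "{l \<in> K - {k}. l < k} = {l \<in> K. l < k}"
    by auto
  then show "rank_sign k (insert k K) = rank_sign k K" "rank_sign k (K - {k}) = rank_sign k K"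
    by (simp_all only: rank_sign_def)
  show "rank_sign k K * (rank_sign k K * x) = x"
    by (simp add: rank_sign_def mult.assoc[symmetric] power_mult_distrib[symmetric])
qed

lemma interior_coord_eq:
  "interior_coord k \<alpha> z K = (if k \<in> K then 0 else rank_sign k K * \<alpha> z (insert k K))"
  by (simp add: interior_coord_def rank_sign_def)

text \<open>Contraction with a coordinate vector field is an antiderivation. On infinite
  \<open>K\<close> the left side would be 0 by the convention for sums, whereas
  \<open>\<alpha>\<close> may take any value there.\<close>

lemma interior_coframe:
  assumes "finite K"
  shows "interior_coord k (coframe j \<and>\<^sub>f \<alpha>) z K =
    ((if j = k then \<alpha> else 0) - coframe j \<and>\<^sub>f interior_coord k \<alpha>) z K"
proof (cases "k \<notin> K \<and> j \<in> K")
  case True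
  then have jk: "j \<noteq> k" and sets: "insert k K - {j} = insert k (K - {j})" "insert k K - {k} = K"
    by auto
  have "rank_sign k K * rank_sign j K = - (rank_sign j (insert k K) * rank_sign k (K - {j}))"
    using rank_sign_swap[of "insert k K" k j] True jk assms
    by (simp add: sets rank_sign_simps)
  \<comment> \<open>Multiplication by two signs, each squaring to 1, moves them to the sides where
    they occur as coefficients.\<close>
  then have "rank_sign j (insert k K) * (rank_sign k K * rank_sign j K) * rank_sign j K =
      rank_sign j (insert k K) * - (rank_sign j (insert k K) * rank_sign k (K - {j})) * rank_sign j K"
    by simp
  then have "rank_sign k K * rank_sign j (insert k K) = - (rank_sign j K * rank_sign k (K - {j}))"
    by (simp add: mult.assoc rank_sign_simps rank_sign_simps(3)[of j _ 1, simplified])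
      (simp add: mult.commute)
  then have "rank_sign k K * (rank_sign j (insert k K) * x) = - (rank_sign j K * (rank_sign k (K - {j}) * x))" for x
    by (metis (no_types) mult.assoc mult_minus_left)
  then show ?thesis
    using True assms jk by (simp add: interior_coord_eq wedge_coframe sets)
next
  case False
  then show ?thesis
    using assms
    by (auto simp: interior_coord_eq wedge_coframe rank_sign_simps insert_absorb)
qed

lemma contr_add_right: "contr \<phi> (\<alpha> + \<beta>) = contr \<phi> \<alpha> + contr \<phi> \<beta>"
proof -
  have "interior_coord k (\<alpha> + \<beta>) = interior_coord k \<alpha> + interior_coord k \<beta>" for k
    by (simp add: interior_coord_def fun_eq_iff algebra_simps)
  then show ?thesis by (simp add: contr_def wedge_add_right sum.distrib)
qed

lemma contr_fmult_right: "contr \<phi> (fmult f \<alpha>) = fmult f (contr \<phi> \<alpha>)"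
proof -
  have "interior_coord k (fmult f \<alpha>) = fmult f (interior_coord k \<alpha>)" for k
    by (simp add: interior_coord_def fmult_def fun_eq_iff)
  then show ?thesis by (simp add: contr_def wedge_fmult_right fmult_sum)
qed

lemma contr_scaleC_right: "contr \<phi> (c *\<^sub>C \<alpha>) = c *\<^sub>C contr \<phi> \<alpha>"
  by (simp add: scaleC_eq_fmult contr_fmult_right)

lemma contr_minus_right: "contr \<phi> (- \<alpha>) = - contr \<phi> \<alpha>"
  using contr_scaleC_right[of \<phi> "-1" \<alpha>] by simp

lemma contr_diff_right: "contr \<phi> (\<alpha> - \<beta>) = contr \<phi> \<alpha> - contr \<phi> \<beta>"
  using contr_add_right[of \<phi> \<alpha> "- \<beta>"] by (simp add: contr_minus_right)

text \<open>A coframe element changes sign when it passes the interior product and again when it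
  passes \<open>\<phi> k\<close>, so \<open>contr \<phi>\<close> is an even derivation. It replaces
  dz^j by \<open>\<phi> j\<close> and annihilates the conjugate coframe.\<close>

lemma contr_coframe:
  assumes "\<And>k. one_form (\<phi> k)" "j \<in> {1..6}"
  shows "contr \<phi> (coframe j \<and>\<^sub>f \<alpha>) =
    (if j \<le> 3 then \<phi> j \<and>\<^sub>f \<alpha> else 0) + coframe j \<and>\<^sub>f contr \<phi> \<alpha>"
proof -
  have "\<phi> k \<and>\<^sub>f interior_coord k (coframe j \<and>\<^sub>f \<alpha>) =
      (if k = j then \<phi> j \<and>\<^sub>f \<alpha> else 0) + coframe j \<and>\<^sub>f \<phi> k \<and>\<^sub>f interior_coord k \<alpha>" for k
  proof -
    have "\<phi> k \<and>\<^sub>f interior_coord k (coframe j \<and>\<^sub>f \<alpha>) =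
        \<phi> k \<and>\<^sub>f ((if j = k then \<alpha> else 0) - coframe j \<and>\<^sub>f interior_coord k \<alpha>)"
      by (rule wedge_cong) (rule interior_coframe)
    then show ?thesis
      using wedge_one_form_anticomm[OF assms(1) one_form_coframe[OF assms(2)]]
      by (simp add: wedge_diff_right wedge_zero_right)
  qed
  then show ?thesis
    using assms(2) unfolding contr_def wedge_sum_right by (simp add: sum.distrib)
qed

section \<open>Wirtinger derivatives\<close>

text \<open>Real differentiability: without it \<open>frechet_derivative\<close> is an unspecified
  choice, and the sum and product rules need not hold.\<close>

definition diff_everywhere :: "(point \<Rightarrow> complex) \<Rightarrow> bool" where
  "diff_everywhere f \<longleftrightarrow> (\<forall>z. f differentiable at z)"

lemma diff_everywhere_intros:
  "diff_everywhere (\<lambda>_. c)" "diff_everywhere f \<Longrightarrow> diff_everywhere g \<Longrightarrow> diff_everywhere (\<lambda>z. f z + g z)"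
  "diff_everywhere f \<Longrightarrow> diff_everywhere g \<Longrightarrow> diff_everywhere (\<lambda>z. f z * g z)" "diff_everywhere (\<lambda>z. z $ 1)" "diff_everywhere (\<lambda>z. cnj (z $ 1))"
  unfolding diff_everywhere_def
  by (auto intro: bounded_linear_imp_differentiable bounded_linear_vec_nth
      bounded_linear_compose[OF bounded_linear_cnj bounded_linear_vec_nth])

text \<open>Common ground for \<open>del\<close> and \<open>delbar\<close>: \<open>W\<close> is
  \<open>wirt\<close> or \<open>wirt_bar\<close>, and the shift \<open>s\<close>, which is 0 or 3,
  selects dz^k or its conjugate.\<close>

locale coordinate_differential =
  fixes W :: "nat \<Rightarrow> (point \<Rightarrow> complex) \<Rightarrow> point \<Rightarrow> complex" and s :: nat
  assumes W_add: "diff_everywhere f \<Longrightarrow> diff_everywhere g \<Longrightarrow> W k (\<lambda>z. f z + g z) z = W k f z + W k g z"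
    and W_mult: "diff_everywhere f \<Longrightarrow> diff_everywhere g \<Longrightarrow> W k (\<lambda>z. f z * g z) z = W k f z * g z + f z * W k g z"
    and W_const: "W k (\<lambda>_. c) z = 0"

lemma wirt_differential: "coordinate_differential wirt"
  and wirt_bar_differential: "coordinate_differential wirt_bar"
proof -
  have 1: "frechet_derivative (\<lambda>z. f z + g z) (at z) =
      (\<lambda>h. frechet_derivative f (at z) h + frechet_derivative g (at z) h)"
    and 2: "frechet_derivative (\<lambda>z. f z * g z) (at z) =
      (\<lambda>h. f z * frechet_derivative g (at z) h + frechet_derivative f (at z) h * g z)"
    if "diff_everywhere f" "diff_everywhere g" for f g :: "point \<Rightarrow> complex" and z
    using that unfolding diff_everywhere_def
    by (auto intro!: frechet_derivative_at[symmetric] derivative_eq_intros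
        simp: frechet_derivative_works[symmetric])
  have 3: "frechet_derivative (\<lambda>_. c) (at z) = (\<lambda>h. 0)" for c :: complex and z :: point
    by (intro frechet_derivative_at[symmetric] derivative_intros)
  show "coordinate_differential wirt" "coordinate_differential wirt_bar"
    by (unfold_locales; simp add: wirt_def wirt_bar_def 1 2 3 field_simps)+
qed

lemma wirt_coordinate:
  assumes "k \<in> {1..3}"
  shows "wirt k (\<lambda>z. z $ 1) z = (if k = 1 then 1 else 0)" "wirt k (\<lambda>z. cnj (z $ 1)) z = 0"
    "wirt_bar k (\<lambda>z. z $ 1) z = 0" "wirt_bar k (\<lambda>z. cnj (z $ 1)) z = (if k = 1 then 1 else 0)"
proof -
  have f: "frechet_derivative (\<lambda>z :: point. z $ 1) (at z) = (\<lambda>h. h $ 1)"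
    "frechet_derivative (\<lambda>z :: point. cnj (z $ 1)) (at z) = (\<lambda>h. cnj (h $ 1))"
    by (auto intro!: frechet_derivative_at[symmetric] bounded_linear_imp_has_derivative
        bounded_linear_vec_nth bounded_linear_compose[OF bounded_linear_cnj bounded_linear_vec_nth])
  have "k = 1 \<or> k = 2 \<or> k = 3" using assms by auto
  \<comment> \<open>Indices in the numeral type \<open>3\<close> are taken modulo 3, and 1, 2, 3
    remain distinct there.\<close>
  then have k: "(of_nat k = (1 :: 3)) = (k = 1)" by auto
  show "wirt k (\<lambda>z. z $ 1) z = (if k = 1 then 1 else 0)" "wirt k (\<lambda>z. cnj (z $ 1)) z = 0"
    "wirt_bar k (\<lambda>z. z $ 1) z = 0" "wirt_bar k (\<lambda>z. cnj (z $ 1)) z = (if k = 1 then 1 else 0)"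
    using k by (auto simp: wirt_def wirt_bar_def f axis_def)
qed

definition differentiable_form :: "form \<Rightarrow> bool" where
  "differentiable_form \<alpha> \<longleftrightarrow> (\<forall>K. diff_everywhere (\<lambda>z. \<alpha> z K))"

lemma differentiable_form_add: "differentiable_form \<alpha> \<Longrightarrow> differentiable_form \<beta> \<Longrightarrow> differentiable_form (\<alpha> + \<beta>)"
  by (simp add: differentiable_form_def diff_everywhere_intros)

lemma differentiable_form_fmult: "diff_everywhere f \<Longrightarrow> differentiable_form \<alpha> \<Longrightarrow> differentiable_form (fmult f \<alpha>)"
  by (simp add: differentiable_form_def fmult_def diff_everywhere_intros)

lemma differentiable_form_scaleC: "differentiable_form \<alpha> \<Longrightarrow> differentiable_form (c *\<^sub>C \<alpha>)"
  by (simp add: scaleC_eq_fmult differentiable_form_fmult diff_everywhere_intros)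

lemma differentiable_form_diff: "differentiable_form \<alpha> \<Longrightarrow> differentiable_form \<beta> \<Longrightarrow> differentiable_form (\<alpha> - \<beta>)"
  using differentiable_form_add[of \<alpha> "(- 1) *\<^sub>C \<beta>"] differentiable_form_scaleC[of \<beta> "- 1"] by simp

lemma differentiable_form_coframe: "differentiable_form \<alpha> \<Longrightarrow> differentiable_form (coframe k \<and>\<^sub>f \<alpha>)"
  unfolding differentiable_form_def wedge_coframe
proof
  fix K
  assume "\<forall>K. diff_everywhere (\<lambda>z. \<alpha> z K)"
  then show "diff_everywhere (\<lambda>z. if finite K \<and> k \<in> K then rank_sign k K * \<alpha> z (K - {k}) else 0)"
    by (cases "finite K \<and> k \<in> K") (simp_all only: if_True if_False diff_everywhere_intros simp_thms)
qed

lemma differentiable_form_one: "differentiable_form one_form0"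
  by (simp add: differentiable_form_def one_form0_def diff_everywhere_intros)

context coordinate_differential
begin

definition coeff_deriv :: "nat \<Rightarrow> form \<Rightarrow> form" where
  "coeff_deriv k \<alpha> = (\<lambda>z K. W k (\<lambda>w. \<alpha> w K) z)"

definition differential :: "form \<Rightarrow> form" where
  "differential \<alpha> = (\<Sum>k\<in>{1..3}. coframe (k + s) \<and>\<^sub>f coeff_deriv k \<alpha>)"

lemma differential_add:
  assumes "differentiable_form \<alpha>" "differentiable_form \<beta>"
  shows "differential (\<alpha> + \<beta>) = differential \<alpha> + differential \<beta>"
proof -
  have "coeff_deriv k (\<alpha> + \<beta>) = coeff_deriv k \<alpha> + coeff_deriv k \<beta>" for k
    using assms by (simp add: coeff_deriv_def fun_eq_iff differentiable_form_def W_add)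
  then show ?thesis
    by (simp only: differential_def wedge_add_right sum.distrib)
qed

lemma differential_fmult:
  assumes "diff_everywhere f" "differentiable_form \<alpha>"
  shows "differential (fmult f \<alpha>) =
    (\<Sum>k\<in>{1..3}. fmult (W k f) (coframe (k + s) \<and>\<^sub>f \<alpha>)) + fmult f (differential \<alpha>)"
proof -
  have "coeff_deriv k (fmult f \<alpha>) = fmult (W k f) \<alpha> + fmult f (coeff_deriv k \<alpha>)" for k
    using assms by (simp add: coeff_deriv_def fun_eq_iff differentiable_form_def W_mult fmult_def)
  then show ?thesis
    by (simp only: differential_def wedge_add_right wedge_fmult_right sum.distrib fmult_sum)
qed

lemma differential_scaleC:
  assumes "differentiable_form \<alpha>"
  shows "differential (c *\<^sub>C \<alpha>) = c *\<^sub>C differential \<alpha>"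
proof -
  have "fmult (W k (\<lambda>_. c)) \<beta> = 0" for k \<beta>
    by (simp add: fun_eq_iff fmult_def W_const)
  then show ?thesis
    unfolding scaleC_eq_fmult differential_fmult[OF diff_everywhere_intros(1) assms] by simp
qed

text \<open>The coordinate coframe has constant coefficients, so only \<open>\<alpha>\<close> is
  differentiated; the sign comes from exchanging two coframe elements.\<close>

lemma differential_coframe:
  assumes "differentiable_form \<alpha>" "j \<in> {1..6}" "s \<le> 3"
  shows "differential (coframe j \<and>\<^sub>f \<alpha>) = - (coframe j \<and>\<^sub>f differential \<alpha>)"
proof -
  have W_cmult: "W k (\<lambda>z. c * \<alpha> z K) z = c * W k (\<lambda>z. \<alpha> z K) z" for k c K z
    using W_mult[of "\<lambda>_. c" "\<lambda>z. \<alpha> z K" k z] assms(1)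
    by (simp add: differentiable_form_def diff_everywhere_intros W_const)
  have "coeff_deriv k (coframe j \<and>\<^sub>f \<alpha>) = coframe j \<and>\<^sub>f coeff_deriv k \<alpha>" for k
    by (auto simp: coeff_deriv_def fun_eq_iff wedge_coframe W_const W_cmult)
  moreover have "coframe (k + s) \<and>\<^sub>f coframe j \<and>\<^sub>f \<beta> = - (coframe j \<and>\<^sub>f coframe (k + s) \<and>\<^sub>f \<beta>)" for k \<beta>
    by (rule wedge_coframe_anticomm)
  ultimately show ?thesis
    by (simp only: differential_def wedge_sum_right sum_negf)
qed

lemma differential_one: "differential one_form0 = 0"
proof -
  have "coeff_deriv k one_form0 = 0" for k
    by (simp add: coeff_deriv_def one_form0_def fun_eq_iff W_const)
  then show ?thesis by (simp only: differential_def wedge_zero_right sum.neutral_const)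
qed

end

interpretation del: coordinate_differential wirt 0
  rewrites "del.differential = del"
proof -
  show i: "coordinate_differential wirt" by (rule wirt_differential)
  show "coordinate_differential.differential wirt 0 = del"
    by (simp add: fun_eq_iff coordinate_differential.differential_def[OF i]
        coordinate_differential.coeff_deriv_def[OF i] del_def dz_def)
qed

interpretation delbar: coordinate_differential wirt_bar 3
  rewrites "delbar.differential = delbar"
proof -
  show i: "coordinate_differential wirt_bar" by (rule wirt_bar_differential)
  show "coordinate_differential.differential wirt_bar 3 = delbar"
    by (simp add: fun_eq_iff coordinate_differential.differential_def[OF i]
        coordinate_differential.coeff_deriv_def[OF i] delbar_def dzbar_def)
qed

section \<open>Algebras generated by anticommuting operators\<close>

text \<open>A closure under operators instead of a span of sorted monomials: it is easily seen to be
  unaffected by a linear change of generators, and its induction principle reduces statements about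
  the differentials to the generators.\<close>

inductive bigraded :: "(nat \<Rightarrow> 'v \<Rightarrow> 'v) \<Rightarrow> 'v \<Rightarrow> int \<Rightarrow> int \<Rightarrow> 'v::complex_vector \<Rightarrow> bool"
  for e :: "nat \<Rightarrow> 'v \<Rightarrow> 'v" and u :: 'v where
  unit: "bigraded e u 0 0 u"
| hol: "bigraded e u p q x \<Longrightarrow> k \<in> {1..3} \<Longrightarrow> bigraded e u (p + 1) q (e k x)"
| anti: "bigraded e u p q x \<Longrightarrow> k \<in> {4..6} \<Longrightarrow> bigraded e u p (q + 1) (e k x)"
| add: "bigraded e u p q x \<Longrightarrow> bigraded e u p q y \<Longrightarrow> bigraded e u p q (x + y)"
| scale: "bigraded e u p q x \<Longrightarrow> bigraded e u p q (c *\<^sub>C x)"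
| zero: "bigraded e u p q 0"

text \<open>The same closure without bidegrees. It serves as the domain on which the differentials
  are linear and obey the Leibniz rules.\<close>

inductive_set generated :: "(nat \<Rightarrow> 'v \<Rightarrow> 'v) \<Rightarrow> 'v \<Rightarrow> 'v::complex_vector set"
  for e :: "nat \<Rightarrow> 'v \<Rightarrow> 'v" and u :: 'v where
  unit: "u \<in> generated e u"
| gen: "x \<in> generated e u \<Longrightarrow> k \<in> {1..6} \<Longrightarrow> e k x \<in> generated e u"
| add: "x \<in> generated e u \<Longrightarrow> y \<in> generated e u \<Longrightarrow> x + y \<in> generated e u"
| scale: "x \<in> generated e u \<Longrightarrow> c *\<^sub>C x \<in> generated e u"

lemma generated_zero: "0 \<in> generated e u"
  using generated.scale[OF generated.unit, of 0] by simp

lemma generated_minus: "x \<in> generated e u \<Longrightarrow> - x \<in> generated e u"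
  using generated.scale[of x e u "- 1"] by simp

lemma generated_diff: "x \<in> generated e u \<Longrightarrow> y \<in> generated e u \<Longrightarrow> x - y \<in> generated e u"
  using generated.add[of x e u "- y"] generated_minus[of y e u] by simp


section \<open>The operators on left invariant forms\<close>

definition frame :: "nat \<Rightarrow> form" where
  "frame k = (if k \<le> 3 then phi_form k else phibar_form (k - 3))"

definition lmul :: "nat \<Rightarrow> form \<Rightarrow> form" where
  "lmul k \<alpha> = frame k \<and>\<^sub>f \<alpha>"

lemma frame_eq:
  "frame 1 = coframe 1" "frame 2 = coframe 2"
  "frame 3 = coframe 3 - fmult (\<lambda>z. z $ 1) (coframe 2)"
  "frame 4 = coframe 4" "frame 5 = coframe 5"
  "frame 6 = coframe 6 - fmult (\<lambda>z. cnj (z $ 1)) (coframe 5)"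
  by (simp_all add: frame_def phi_form_def phibar_form_def dz_def dzbar_def)

lemma in_1_to_6: "k \<in> {1..6} \<longleftrightarrow> k = 1 \<or> k = 2 \<or> k = 3 \<or> k = 4 \<or> k = 5 \<or> k = (6::nat)"
  by auto

lemma one_form_frame: "k \<in> {1..6} \<Longrightarrow> one_form (frame k)"
  unfolding in_1_to_6
  by (elim disjE; hypsubst) (simp_all only: frame_eq, (intro one_form_diff one_form_fmult one_form_coframe; simp)+)

lemma lmul_anticomm: "i \<in> {1..6} \<Longrightarrow> j \<in> {1..6} \<Longrightarrow> lmul i (lmul j \<alpha>) = - lmul j (lmul i \<alpha>)"
  unfolding lmul_def by (intro wedge_one_form_anticomm one_form_frame)

lemma lmul_self: "i \<in> {1..6} \<Longrightarrow> lmul i (lmul i \<alpha>) = 0"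
  unfolding lmul_def by (intro wedge_one_form_self one_form_frame)

lemma lmul_add: "lmul k (\<alpha> + \<beta>) = lmul k \<alpha> + lmul k \<beta>"
  and lmul_scaleC: "lmul k (c *\<^sub>C \<alpha>) = c *\<^sub>C lmul k \<alpha>"
  by (simp_all only: lmul_def wedge_add_right wedge_scaleC_right)

lemma lmul_eq:
  "lmul 1 \<alpha> = coframe 1 \<and>\<^sub>f \<alpha>" "lmul 2 \<alpha> = coframe 2 \<and>\<^sub>f \<alpha>"
  "lmul 3 \<alpha> = coframe 3 \<and>\<^sub>f \<alpha> - fmult (\<lambda>z. z $ 1) (coframe 2 \<and>\<^sub>f \<alpha>)"
  "lmul 4 \<alpha> = coframe 4 \<and>\<^sub>f \<alpha>" "lmul 5 \<alpha> = coframe 5 \<and>\<^sub>f \<alpha>"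
  "lmul 6 \<alpha> = coframe 6 \<and>\<^sub>f \<alpha> - fmult (\<lambda>z. cnj (z $ 1)) (coframe 5 \<and>\<^sub>f \<alpha>)"
  by (simp_all only: lmul_def frame_eq wedge_diff_left wedge_fmult_left)

abbreviation inv_space :: "form set" where
  "inv_space \<equiv> generated lmul one_form0"

lemma inv_space_differentiable: "\<alpha> \<in> inv_space \<Longrightarrow> differentiable_form \<alpha>"
proof (induction rule: generated.induct)
  case (gen \<alpha> k)
  from gen.hyps(2) gen.IH show ?case
    unfolding in_1_to_6
    by (elim disjE; hypsubst; unfold lmul_eq;
        intro differentiable_form_diff differentiable_form_fmult differentiable_form_coframe diff_everywhere_intros)
next
  case (add \<alpha> \<beta>)
  then show ?case by (intro differentiable_form_add)
qed (intro differentiable_form_one differentiable_form_scaleC; assumption)+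

lemma sum_1_to_3: "(\<Sum>k\<in>{1..3}. f k) = f 1 + f 2 + f (3::nat)"
  by (simp add: numeral_3_eq_3 numeral_2_eq_2 add.assoc)

lemma fmult_0_1: "fmult (\<lambda>z. 0) \<alpha> = 0" "fmult (\<lambda>z. 1) \<alpha> = \<alpha>"
  by (simp_all add: fmult_def fun_eq_iff)

lemma del_fmult_coordinate:
  assumes "differentiable_form \<alpha>"
  shows "del (fmult (\<lambda>z. z $ 1) \<alpha>) = coframe 1 \<and>\<^sub>f \<alpha> + fmult (\<lambda>z. z $ 1) (del \<alpha>)"
    "del (fmult (\<lambda>z. cnj (z $ 1)) \<alpha>) = fmult (\<lambda>z. cnj (z $ 1)) (del \<alpha>)"
    "delbar (fmult (\<lambda>z. z $ 1) \<alpha>) = fmult (\<lambda>z. z $ 1) (delbar \<alpha>)"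
    "delbar (fmult (\<lambda>z. cnj (z $ 1)) \<alpha>) = coframe 4 \<and>\<^sub>f \<alpha> + fmult (\<lambda>z. cnj (z $ 1)) (delbar \<alpha>)"
proof -
  have "wirt 1 (\<lambda>z. z $ 1) = (\<lambda>z. 1)" "wirt_bar 1 (\<lambda>z. cnj (z $ 1)) = (\<lambda>z. 1)"
    "wirt 1 (\<lambda>z. cnj (z $ 1)) = (\<lambda>z. 0)" "wirt_bar 1 (\<lambda>z. z $ 1) = (\<lambda>z. 0)"
    by (simp_all add: fun_eq_iff wirt_coordinate)
  moreover have "wirt k (\<lambda>z. z $ 1) = (\<lambda>z. 0)" "wirt k (\<lambda>z. cnj (z $ 1)) = (\<lambda>z. 0)"
    "wirt_bar k (\<lambda>z. z $ 1) = (\<lambda>z. 0)" "wirt_bar k (\<lambda>z. cnj (z $ 1)) = (\<lambda>z. 0)"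
    if "k \<in> {2, 3}" for k
    using that by (auto simp add: fun_eq_iff wirt_coordinate)
  ultimately show "del (fmult (\<lambda>z. z $ 1) \<alpha>) = coframe 1 \<and>\<^sub>f \<alpha> + fmult (\<lambda>z. z $ 1) (del \<alpha>)"
    "del (fmult (\<lambda>z. cnj (z $ 1)) \<alpha>) = fmult (\<lambda>z. cnj (z $ 1)) (del \<alpha>)"
    "delbar (fmult (\<lambda>z. z $ 1) \<alpha>) = fmult (\<lambda>z. z $ 1) (delbar \<alpha>)"
    "delbar (fmult (\<lambda>z. cnj (z $ 1)) \<alpha>) = coframe 4 \<and>\<^sub>f \<alpha> + fmult (\<lambda>z. cnj (z $ 1)) (delbar \<alpha>)"
    by (simp_all add: del.differential_fmult[OF diff_everywhere_intros(4) assms]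
        del.differential_fmult[OF diff_everywhere_intros(5) assms]
        delbar.differential_fmult[OF diff_everywhere_intros(4) assms]
        delbar.differential_fmult[OF diff_everywhere_intros(5) assms]
        sum_1_to_3 fmult_0_1 del: One_nat_def)
qed

text \<open>The coefficient -z^1 of dz^2 in \<phi>^3 contributes -dz^1 \<and> dz^2, which is the
  structure equation. The coefficient in the conjugate of \<phi>^3 is antiholomorphic, hence
  annihilated by \<partial>.\<close>

lemma del_lmul_differentiable:
  assumes "differentiable_form \<alpha>"
  shows "k \<in> {1, 2, 4, 5, 6} \<Longrightarrow> del (lmul k \<alpha>) = - lmul k (del \<alpha>)"
    "del (lmul 3 \<alpha>) = - lmul 1 (lmul 2 \<alpha>) - lmul 3 (del \<alpha>)"
proof -
  have c: "del (coframe j \<and>\<^sub>f \<alpha>) = - (coframe j \<and>\<^sub>f del \<alpha>)" if "j \<in> {1..6}" for j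
    using assms that by (intro del.differential_coframe) simp_all
  have d: "del (\<alpha> - \<beta>) = del \<alpha> - del \<beta>" if "differentiable_form \<alpha>" "differentiable_form \<beta>" for \<alpha> \<beta>
    using del.differential_add[OF that(1) differentiable_form_scaleC[OF that(2)], of "- 1"]
      del.differential_scaleC[OF that(2), of "- 1"] by simp
  note s = differentiable_form_coframe[OF assms] differentiable_form_fmult[OF diff_everywhere_intros(4)]
    differentiable_form_fmult[OF diff_everywhere_intros(5)]
  show "k \<in> {1, 2, 4, 5, 6} \<Longrightarrow> del (lmul k \<alpha>) = - lmul k (del \<alpha>)"
    by (auto simp del: One_nat_def simp: lmul_eq c d s del_fmult_coordinate fmult_distrib)
  show "del (lmul 3 \<alpha>) = - lmul 1 (lmul 2 \<alpha>) - lmul 3 (del \<alpha>)"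
    by (simp add: lmul_eq c d s del_fmult_coordinate fmult_distrib del: One_nat_def)
qed

lemma delbar_lmul_differentiable:
  assumes "differentiable_form \<alpha>"
  shows "k \<in> {1, 2, 3, 4, 5} \<Longrightarrow> delbar (lmul k \<alpha>) = - lmul k (delbar \<alpha>)"
    "delbar (lmul 6 \<alpha>) = - lmul 4 (lmul 5 \<alpha>) - lmul 6 (delbar \<alpha>)"
proof -
  have c: "delbar (coframe j \<and>\<^sub>f \<alpha>) = - (coframe j \<and>\<^sub>f delbar \<alpha>)" if "j \<in> {1..6}" for j
    using assms that by (intro delbar.differential_coframe) simp_all
  have d: "delbar (\<alpha> - \<beta>) = delbar \<alpha> - delbar \<beta>" if "differentiable_form \<alpha>" "differentiable_form \<beta>" for \<alpha> \<beta>
    using delbar.differential_add[OF that(1) differentiable_form_scaleC[OF that(2)], of "- 1"]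
      delbar.differential_scaleC[OF that(2), of "- 1"] by simp
  note s = differentiable_form_coframe[OF assms] differentiable_form_fmult[OF diff_everywhere_intros(4)]
    differentiable_form_fmult[OF diff_everywhere_intros(5)]
  show "k \<in> {1, 2, 3, 4, 5} \<Longrightarrow> delbar (lmul k \<alpha>) = - lmul k (delbar \<alpha>)"
    by (auto simp del: One_nat_def simp: lmul_eq c d s del_fmult_coordinate fmult_distrib)
  show "delbar (lmul 6 \<alpha>) = - lmul 4 (lmul 5 \<alpha>) - lmul 6 (delbar \<alpha>)"
    by (simp add: lmul_eq c d s del_fmult_coordinate fmult_distrib del: One_nat_def)
qed

section \<open>Contraction with the Beltrami differential in the invariant frame\<close>

lemma beltrami_eq:
  "beltrami t k =
    (\<Sum>i\<in>{1..3}. \<Sum>l\<in>{1..2}. (t $ of_nat i $ of_nat l) *\<^sub>C fmult (\<lambda>z. theta i z k) (phibar_form l))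
     - D_par t *\<^sub>C fmult (\<lambda>z. theta 3 z k) (phibar_form 3)"
  by (simp add: beltrami_def sum_fun_apply tensor_def scaleC_fun_def)

lemma one_form_beltrami: "one_form (beltrami t k)"
proof -
  have "one_form (phibar_form l)" if "l \<in> {1..3}" for l
    using one_form_frame[of "l + 3"] that by (simp add: frame_def)
  then show ?thesis
    unfolding beltrami_eq
    by (intro one_form_diff one_form_sum one_form_scaleC one_form_fmult) simp_all
qed

text \<open>The vector field \<theta>^2 contributes z^1 to the coefficient of
  \<partial>/\<partial>z^3, and pairing with \<phi>^3 = dz^3 - z^1 dz^2 removes this contribution.
  The left sides are thus the contractions of \<phi>^1, \<phi>^2, \<phi>^3, wedged with
  \<open>\<alpha>\<close>.\<close>

lemma beltrami_wedge:
  "beltrami t 1 \<and>\<^sub>f \<alpha> = t $ 1 $ 1 *\<^sub>C lmul 4 \<alpha> + t $ 1 $ 2 *\<^sub>C lmul 5 \<alpha>"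
  "beltrami t 2 \<and>\<^sub>f \<alpha> = t $ 2 $ 1 *\<^sub>C lmul 4 \<alpha> + t $ 2 $ 2 *\<^sub>C lmul 5 \<alpha>"
  "beltrami t 3 \<and>\<^sub>f \<alpha> - fmult (\<lambda>z. z $ 1) (beltrami t 2 \<and>\<^sub>f \<alpha>) =
    t $ 3 $ 1 *\<^sub>C lmul 4 \<alpha> + t $ 3 $ 2 *\<^sub>C lmul 5 \<alpha> - D_par t *\<^sub>C lmul 6 \<alpha>"
proof -
  have sum2: "(\<Sum>k\<in>{1..2}. f k) = f 1 + f (2::nat)" for f :: "nat \<Rightarrow> form"
    by (simp add: numeral_2_eq_2)
  have l: "phibar_form 1 \<and>\<^sub>f \<alpha> = lmul 4 \<alpha>" "phibar_form 2 \<and>\<^sub>f \<alpha> = lmul 5 \<alpha>"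
    "phibar_form 3 \<and>\<^sub>f \<alpha> = lmul 6 \<alpha>"
    by (simp_all add: lmul_def frame_def)
  have th: "(\<lambda>z. theta 1 z 1) = (\<lambda>z. 1)" "(\<lambda>z. theta 2 z 1) = (\<lambda>z. 0)" "(\<lambda>z. theta 3 z 1) = (\<lambda>z. 0)"
    "(\<lambda>z. theta 1 z 2) = (\<lambda>z. 0)" "(\<lambda>z. theta 2 z 2) = (\<lambda>z. 1)" "(\<lambda>z. theta 3 z 2) = (\<lambda>z. 0)"
    "(\<lambda>z. theta 1 z 3) = (\<lambda>z. 0)" "(\<lambda>z. theta 2 z 3) = (\<lambda>z. z $ 1)" "(\<lambda>z. theta 3 z 3) = (\<lambda>z. 1)"
    by (simp_all add: theta_def)
  have sc: "fmult f (c *\<^sub>C \<beta>) = c *\<^sub>C fmult f \<beta>" for f c \<beta>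
    by (simp add: scaleC_eq_fmult fmult_def mult_ac)
  note simps = beltrami_eq sum_1_to_3 sum2 wedge_add_left wedge_diff_left wedge_scaleC_left wedge_fmult_left
    l th fmult_0_1 fmult_distrib sc cvs.scale_zero_right add_0_left add_0_right diff_0_right
    of_nat_1 of_nat_numeral
  show "beltrami t 1 \<and>\<^sub>f \<alpha> = t $ 1 $ 1 *\<^sub>C lmul 4 \<alpha> + t $ 1 $ 2 *\<^sub>C lmul 5 \<alpha>"
    "beltrami t 2 \<and>\<^sub>f \<alpha> = t $ 2 $ 1 *\<^sub>C lmul 4 \<alpha> + t $ 2 $ 2 *\<^sub>C lmul 5 \<alpha>"
    by (simp_all only: simps)
  show "beltrami t 3 \<and>\<^sub>f \<alpha> - fmult (\<lambda>z. z $ 1) (beltrami t 2 \<and>\<^sub>f \<alpha>) =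
    t $ 3 $ 1 *\<^sub>C lmul 4 \<alpha> + t $ 3 $ 2 *\<^sub>C lmul 5 \<alpha> - D_par t *\<^sub>C lmul 6 \<alpha>"
    by (simp only: simps) (simp add: algebra_simps)
qed

lemma contr_lmul:
  fixes t
  defines "\<iota> \<equiv> contr (beltrami t)"
  shows "\<iota> (lmul 1 \<alpha>) = t $ 1 $ 1 *\<^sub>C lmul 4 \<alpha> + t $ 1 $ 2 *\<^sub>C lmul 5 \<alpha> + lmul 1 (\<iota> \<alpha>)"
    "\<iota> (lmul 2 \<alpha>) = t $ 2 $ 1 *\<^sub>C lmul 4 \<alpha> + t $ 2 $ 2 *\<^sub>C lmul 5 \<alpha> + lmul 2 (\<iota> \<alpha>)"
    "\<iota> (lmul 3 \<alpha>) = t $ 3 $ 1 *\<^sub>C lmul 4 \<alpha> + t $ 3 $ 2 *\<^sub>C lmul 5 \<alpha> - D_par t *\<^sub>C lmul 6 \<alpha>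
      + lmul 3 (\<iota> \<alpha>)"
    "k \<in> {4, 5, 6} \<Longrightarrow> \<iota> (lmul k \<alpha>) = lmul k (\<iota> \<alpha>)"
proof -
  have c: "\<iota> (coframe j \<and>\<^sub>f \<alpha>) = (if j \<le> 3 then beltrami t j \<and>\<^sub>f \<alpha> else 0) + coframe j \<and>\<^sub>f \<iota> \<alpha>"
    if "j \<in> {1..6}" for j
    unfolding \<iota>_def using that by (intro contr_coframe one_form_beltrami)
  note simps = lmul_eq c contr_diff_right[of "beltrami t", folded \<iota>_def]
    contr_fmult_right[of "beltrami t", folded \<iota>_def] fmult_distrib
  show "\<iota> (lmul 1 \<alpha>) = t $ 1 $ 1 *\<^sub>C lmul 4 \<alpha> + t $ 1 $ 2 *\<^sub>C lmul 5 \<alpha> + lmul 1 (\<iota> \<alpha>)"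
    "\<iota> (lmul 2 \<alpha>) = t $ 2 $ 1 *\<^sub>C lmul 4 \<alpha> + t $ 2 $ 2 *\<^sub>C lmul 5 \<alpha> + lmul 2 (\<iota> \<alpha>)"
    unfolding beltrami_wedge[symmetric] by (simp_all add: simps del: One_nat_def)
  show "\<iota> (lmul 3 \<alpha>) = t $ 3 $ 1 *\<^sub>C lmul 4 \<alpha> + t $ 3 $ 2 *\<^sub>C lmul 5 \<alpha> - D_par t *\<^sub>C lmul 6 \<alpha>
      + lmul 3 (\<iota> \<alpha>)"
    unfolding beltrami_wedge[symmetric] by (simp add: simps del: One_nat_def)
  show "k \<in> {4, 5, 6} \<Longrightarrow> \<iota> (lmul k \<alpha>) = lmul k (\<iota> \<alpha>)"
    by (auto simp: simps)
qed

lemma lmul_inv: "\<alpha> \<in> inv_space \<Longrightarrow> k \<in> {1..6} \<Longrightarrow> lmul k \<alpha> \<in> inv_space"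
  by (rule generated.gen)

lemmas inv_space_intros = generated.unit generated.add generated.scale generated_zero
  generated_minus generated_diff lmul_inv

lemma del_linear:
  assumes "\<alpha> \<in> inv_space" "\<beta> \<in> inv_space"
  shows "del (\<alpha> + \<beta>) = del \<alpha> + del \<beta>" "del (c *\<^sub>C \<alpha>) = c *\<^sub>C del \<alpha>"
  using assms by (auto intro: del.differential_add del.differential_scaleC inv_space_differentiable)

lemma delbar_linear:
  assumes "\<alpha> \<in> inv_space" "\<beta> \<in> inv_space"
  shows "delbar (\<alpha> + \<beta>) = delbar \<alpha> + delbar \<beta>" "delbar (c *\<^sub>C \<alpha>) = c *\<^sub>C delbar \<alpha>"
  using assms by (auto intro: delbar.differential_add delbar.differential_scaleC inv_space_differentiable)

lemmas del_lmul = del_lmul_differentiable[OF inv_space_differentiable]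

lemma del_inv: "\<alpha> \<in> inv_space \<Longrightarrow> del \<alpha> \<in> inv_space"
proof (induction rule: generated.induct)
  case unit
  show ?case by (simp only: del.differential_one generated_zero)
next
  case (gen \<alpha> k)
  from gen.hyps(2) gen.hyps(1) gen.IH show ?case
    unfolding in_1_to_6
    by (elim disjE; hypsubst; subst del_lmul; (intro inv_space_intros)?; simp)
next
  case (add \<alpha> \<beta>)
  then show ?case by (simp only: del_linear inv_space_intros)
next
  case (scale \<alpha> c)
  then show ?case by (simp only: del_linear inv_space_intros)
qed

text \<open>The operator \<open>lie10\<close> differentiates a contracted form, so linearity and the
  Leibniz rules for \<open>del\<close> must be available at
  \<open>contr (beltrami t) \<alpha>\<close> too.\<close>

lemma contr_inv: "\<alpha> \<in> inv_space \<Longrightarrow> contr (beltrami t) \<alpha> \<in> inv_space"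
proof (induction rule: generated.induct)
  case unit
  have "interior_coord k one_form0 = 0" for k
    by (simp add: fun_eq_iff interior_coord_def one_form0_def)
  then have "contr (beltrami t) one_form0 = 0"
    by (simp only: contr_def wedge_zero_right sum.neutral_const)
  then show ?case by (simp only: generated_zero)
next
  case (gen \<alpha> k)
  from gen.hyps(2) gen.hyps(1) gen.IH show ?case
    unfolding in_1_to_6
    by (elim disjE; hypsubst; subst contr_lmul; (intro inv_space_intros)?; simp)
next
  case (add \<alpha> \<beta>)
  then show ?case by (simp only: contr_add_right inv_space_intros)
next
  case (scale \<alpha> c)
  then show ?case by (simp only: contr_scaleC_right inv_space_intros)
qed

lemma delbar_phi_one: "delbar_phi (beltrami t) one_form0 = 0"
proof -
  have "interior_coord k one_form0 = 0" for k
    by (simp add: fun_eq_iff interior_coord_def one_form0_def)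
  then have "contr (beltrami t) one_form0 = 0"
    by (simp only: contr_def wedge_zero_right sum.neutral_const)
  moreover have "contr (beltrami t) 0 = 0" "del 0 = 0"
    using contr_scaleC_right[of "beltrami t" 0 0] del_linear(2)[OF generated.unit generated.unit, of 0]
    by (simp_all add: del.differential_one)
  ultimately show ?thesis
    by (simp add: delbar_phi_def lie10_def del.differential_one delbar.differential_one)
qed

lemma delbar_phi_linear:
  assumes "\<alpha> \<in> inv_space" "\<beta> \<in> inv_space"
  shows "delbar_phi (beltrami t) (\<alpha> + \<beta>) = delbar_phi (beltrami t) \<alpha> + delbar_phi (beltrami t) \<beta>"
    "delbar_phi (beltrami t) (c *\<^sub>C \<alpha>) = c *\<^sub>C delbar_phi (beltrami t) \<alpha>"
  using assms
  by (simp_all add: delbar_phi_def lie10_def delbar_linear del_linear contr_inv contr_add_right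
      contr_scaleC_right cvs.scale_right_diff_distrib)

text \<open>The commutator of the even derivation \<open>contr (beltrami t)\<close> with the odd
  derivation \<open>del\<close> is an odd derivation. It vanishes on generators that are
  \<open>del\<close>-closed, since their contractions are \<open>del\<close>-closed as well; on
  \<phi>^3, with the sign in \<open>delbar_phi\<close>, it leaves the contraction of \<phi>^1 \<and>
  \<phi>^2.\<close>

lemma delbar_phi_lmul:
  fixes t \<alpha>
  assumes V: "\<alpha> \<in> inv_space"
  defines "\<delta> \<equiv> delbar_phi (beltrami t)"
  shows "k \<in> {1, 2, 4, 5} \<Longrightarrow> \<delta> (lmul k \<alpha>) = - lmul k (\<delta> \<alpha>)"
    "\<delta> (lmul 3 \<alpha>) = t $ 2 $ 1 *\<^sub>C lmul 1 (lmul 4 \<alpha>) + t $ 2 $ 2 *\<^sub>C lmul 1 (lmul 5 \<alpha>)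
      - t $ 1 $ 1 *\<^sub>C lmul 2 (lmul 4 \<alpha>) - t $ 1 $ 2 *\<^sub>C lmul 2 (lmul 5 \<alpha>) - lmul 3 (\<delta> \<alpha>)"
    "\<delta> (lmul 6 \<alpha>) = - lmul 4 (lmul 5 \<alpha>) - lmul 6 (\<delta> \<alpha>)"
proof -
  let ?i = "contr (beltrami t)"
  have V': "del \<alpha> \<in> inv_space" "?i \<alpha> \<in> inv_space" "?i (del \<alpha>) \<in> inv_space" "del (?i \<alpha>) \<in> inv_space"
    using V by (simp_all only: del_inv contr_inv)
  have minus: "lmul k (- \<beta>) = - lmul k \<beta>" "lmul k (\<beta> - \<gamma>) = lmul k \<beta> - lmul k \<gamma>" for k \<beta> \<gamma>
    by (simp_all only: lmul_def wedge_minus_right wedge_diff_right)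
  have del_diff: "del (\<beta> - \<gamma>) = del \<beta> - del \<gamma>" if "\<beta> \<in> inv_space" "\<gamma> \<in> inv_space" for \<beta> \<gamma>
    using that del_linear(1)[of \<beta> "- 1 *\<^sub>C \<gamma>"] del_linear(2)[of \<gamma> \<gamma> "- 1"]
      generated.scale[of \<gamma> lmul one_form0 "- 1"] by simp
  note simps = \<delta>_def delbar_phi_def lie10_def delbar_lmul_differentiable[OF inv_space_differentiable[OF V]]
    del_lmul contr_lmul del_linear(1) del_linear(2)[OF _ V] del_diff V V' minus lmul_add inv_space_intros
    contr_minus_right contr_diff_right
  show "k \<in> {1, 2, 4, 5} \<Longrightarrow> \<delta> (lmul k \<alpha>) = - lmul k (\<delta> \<alpha>)"
    by (auto simp: simps cvs.scale_minus_right simp del: One_nat_def)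
  show "\<delta> (lmul 6 \<alpha>) = - lmul 4 (lmul 5 \<alpha>) - lmul 6 (\<delta> \<alpha>)"
    by (simp add: simps)
  \<comment> \<open>Contracting \<phi>^1 in \<phi>^1 \<and> \<phi>^2 leaves a conjugate form in
    front of \<phi>^2; reordering produces the minus signs at t_11 and t_12.\<close>
  have swap: "lmul 4 (lmul 2 \<alpha>) = - lmul 2 (lmul 4 \<alpha>)" "lmul 5 (lmul 2 \<alpha>) = - lmul 2 (lmul 5 \<alpha>)"
    by (intro lmul_anticomm; simp)+
  show "\<delta> (lmul 3 \<alpha>) = t $ 2 $ 1 *\<^sub>C lmul 1 (lmul 4 \<alpha>) + t $ 2 $ 2 *\<^sub>C lmul 1 (lmul 5 \<alpha>)
      - t $ 1 $ 1 *\<^sub>C lmul 2 (lmul 4 \<alpha>) - t $ 1 $ 2 *\<^sub>C lmul 2 (lmul 5 \<alpha>) - lmul 3 (\<delta> \<alpha>)"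
    by (simp add: simps swap lmul_scaleC cvs.scale_minus_right del: One_nat_def)
qed

section \<open>Monomials in anticommuting operators\<close>

text \<open>The index set is a parameter because the sorting arguments are applied to all six
  operators, to the holomorphic three, and to the conjugate three renumbered by 1, 2, 3.\<close>

locale anticommuting =
  fixes e :: "nat \<Rightarrow> 'v \<Rightarrow> 'v::complex_vector" and N :: "nat set"
  assumes e_add: "e k (x + y) = e k x + e k y"
    and e_scale: "e k (c *\<^sub>C x) = c *\<^sub>C e k x"
    and e_swap: "i \<in> N \<Longrightarrow> j \<in> N \<Longrightarrow> e i (e j x) = - e j (e i x)"
    and e_self: "i \<in> N \<Longrightarrow> e i (e i x) = 0"
begin

lemma e_minus: "e k (- x) = - e k x"
  using e_scale[of k "- 1" x] by simp

lemma e_zero: "e k 0 = 0"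
  using e_scale[of k 0 0] by simp

lemma e_diff: "e k (x - y) = e k x - e k y"
  using e_add[of k x "- y"] by (simp add: e_minus)

lemma e_foldr_repeated:
  "k \<in> set ws \<Longrightarrow> set ws \<subseteq> N \<Longrightarrow> e k (foldr e ws x) = 0"
proof (induction ws)
  case (Cons a ws)
  show ?case
  proof (cases "a = k")
    case True
    then show ?thesis using Cons.prems by (simp add: e_self)
  next
    case False
    then have "e k (foldr e (a # ws) x) = - e a (e k (foldr e ws x))"
      using Cons.prems by (auto simp: e_swap[of k a])
    then show ?thesis using Cons False by (simp add: e_zero)
  qed
qed simp

text \<open>The operator moves past the smaller ones, changing sign each time. The scalar is left
  unspecified because only spans matter.\<close>

lemma e_foldr_insort:
  "k \<in> N \<Longrightarrow> set ws \<subseteq> N \<Longrightarrow> \<exists>c. e k (foldr e ws x) = c *\<^sub>C foldr e (insort k ws) x"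
proof (induction ws)
  case Nil
  show ?case by (rule exI[of _ 1]) (simp add: scaleC_one)
next
  case (Cons a ws)
  show ?case
  proof (cases "k \<le> a")
    case True
    then show ?thesis by (intro exI[of _ 1]) (simp add: scaleC_one)
  next
    case False
    obtain c where "e k (foldr e ws x) = c *\<^sub>C foldr e (insort k ws) x"
      using Cons by auto
    then have "e k (foldr e (a # ws) x) = (- c) *\<^sub>C foldr e (insort k (a # ws)) x"
      using Cons.prems False by (simp add: e_swap[of k a] e_scale)
    then show ?thesis by blast
  qed
qed

lemma e_foldr_move:
  "k \<in> N \<Longrightarrow> set ws \<subseteq> N \<Longrightarrow> \<exists>c. e k (foldr e ws x) = c *\<^sub>C foldr e ws (e k x)"
proof (induction ws)
  case Nil
  show ?case by (rule exI[of _ 1]) (simp add: scaleC_one)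
next
  case (Cons a ws)
  then obtain c where "e k (foldr e ws x) = c *\<^sub>C foldr e ws (e k x)" by auto
  then have "e k (foldr e (a # ws) x) = (- c) *\<^sub>C foldr e (a # ws) (e k x)"
    using Cons.prems by (simp add: e_swap[of k a] e_scale)
  then show ?case by blast
qed

lemma foldr_scale: "foldr e ws (c *\<^sub>C x) = c *\<^sub>C foldr e ws x"
  by (induction ws) (simp_all add: e_scale)

lemma e_foldr_set:
  assumes "k \<in> N" "I \<subseteq> N" "finite I"
  shows "k \<in> I \<and> e k (foldr e (sorted_list_of_set I) x) = 0 \<or>
    (\<exists>c. k \<notin> I \<and> e k (foldr e (sorted_list_of_set I) x) =
      c *\<^sub>C foldr e (sorted_list_of_set (insert k I)) x)"
proof (cases "k \<in> I")
  case True
  then show ?thesis using assms by (simp add: e_foldr_repeated)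
next
  case False
  then show ?thesis
    using assms e_foldr_insort[of k "sorted_list_of_set I" x]
    by (simp add: sorted_list_of_set_insert)
qed

end

definition monomial :: "(nat \<Rightarrow> 'v \<Rightarrow> 'v) \<Rightarrow> 'v \<Rightarrow> nat set \<Rightarrow> nat set \<Rightarrow> 'v" where
  "monomial e u I J = foldr e (sorted_list_of_set I) (foldr (\<lambda>j. e (j + 3)) (sorted_list_of_set J) u)"

definition monomials :: "(nat \<Rightarrow> 'v \<Rightarrow> 'v) \<Rightarrow> 'v \<Rightarrow> int \<Rightarrow> int \<Rightarrow> 'v set" where
  "monomials e u p q =
    {monomial e u I J | I J. I \<subseteq> {1..3} \<and> J \<subseteq> {1..3} \<and> int (card I) = p \<and> int (card J) = q}"

lemma bigraded_subspace: "cvs.subspace (Collect (bigraded e u p q))"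
  by (intro cvs.subspaceI) (auto intro: bigraded.intros)

lemma bigraded_foldr:
  assumes "bigraded e u p q x"
  shows "set ws \<subseteq> {1..3} \<Longrightarrow> bigraded e u (p + int (length ws)) q (foldr e ws x)"
    "set ws \<subseteq> {1..3} \<Longrightarrow> bigraded e u p (q + int (length ws)) (foldr (\<lambda>j. e (j + 3)) ws x)"
proof (induction ws)
  case (Cons a ws)
  {
    case 1
    then show ?case using Cons.IH(1) bigraded.hol[of e u "p + int (length ws)" q _ a]
      by (simp add: algebra_simps)
  next
    case 2
    then show ?case using Cons.IH(2) bigraded.anti[of e u p "q + int (length ws)" _ "a + 3"]
      by (simp add: algebra_simps)
  }
qed (use assms in simp_all)

lemma finite_subset_1_3: "I \<subseteq> {1..3::nat} \<Longrightarrow> finite I"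
  by (rule finite_subset) auto

lemma bigraded_monomial:
  assumes "I \<subseteq> {1..3}" "J \<subseteq> {1..3}"
  shows "bigraded e u (int (card I)) (int (card J)) (monomial e u I J)"
proof -
  have "finite I" "finite J" using assms finite_subset_1_3 by auto
  then show ?thesis
    using bigraded_foldr(1)[OF bigraded_foldr(2)[OF bigraded.unit], of "sorted_list_of_set J" "sorted_list_of_set I" e u]
      assms by (simp add: monomial_def)
qed

locale exterior_operators = anticommuting e "{1..6}" for e :: "nat \<Rightarrow> 'v \<Rightarrow> 'v::complex_vector" +
  fixes u :: 'v
begin

lemma e_hol_monomial:
  assumes "k \<in> {1..3}" and m: "m \<in> monomials e u p q"
  shows "e k m \<in> cvs.span (monomials e u (p + 1) q)"
proof -
  interpret h: anticommuting e "{1..3}"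
    by unfold_locales (auto simp: e_add e_scale e_self intro: e_swap)
  obtain I J where IJ: "I \<subseteq> {1..3}" "J \<subseteq> {1..3}" "int (card I) = p" "int (card J) = q"
    and m: "m = monomial e u I J" using m unfolding monomials_def by blast
  have fin: "finite I" using IJ finite_subset_1_3 by auto
  consider "e k m = 0" | c where "k \<notin> I" "e k m = c *\<^sub>C monomial e u (insert k I) J"
    using h.e_foldr_set[OF assms(1) IJ(1) fin] unfolding m monomial_def by blast
  then show ?thesis
  proof cases
    case 2
    then have "monomial e u (insert k I) J \<in> monomials e u (p + 1) q"
      using IJ assms(1) fin unfolding monomials_def
      by (intro CollectI exI[of _ "insert k I"] exI[of _ J]) auto
    then show ?thesis unfolding 2 by (intro cvs.span_scale cvs.span_base)
  qed (simp add: cvs.span_zero)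
qed

lemma e_anti_monomial:
  assumes "k \<in> {4..6}" and m: "m \<in> monomials e u p q"
  shows "e k m \<in> cvs.span (monomials e u p (q + 1))"
proof -
  interpret a: anticommuting "\<lambda>j. e (j + 3)" "{1..3}"
    by unfold_locales (auto simp: e_add e_scale e_self intro: e_swap)
  obtain I J where IJ: "I \<subseteq> {1..3}" "J \<subseteq> {1..3}" "int (card I) = p" "int (card J) = q"
    and m: "m = monomial e u I J" using m unfolding monomials_def by blast
  have fin: "finite I" "finite J" using IJ finite_subset_1_3 by auto
  let ?y = "foldr (\<lambda>j. e (j + 3)) (sorted_list_of_set J) u"
  have "k \<in> {1..6}" "set (sorted_list_of_set I) \<subseteq> {1..6}" using assms(1) IJ(1) fin by auto
  \<comment> \<open>The holomorphic block is passed as a whole, so that sorting happens only among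
    the conjugate operators.\<close>
  then obtain c where c: "e k m = c *\<^sub>C foldr e (sorted_list_of_set I) (e k ?y)"
    using e_foldr_move unfolding m monomial_def by blast
  have k: "k - 3 \<in> {1..3}" "k = k - 3 + 3" using assms(1) by auto
  consider "e k ?y = 0" | d where "k - 3 \<notin> J"
    "e k ?y = d *\<^sub>C foldr (\<lambda>j. e (j + 3)) (sorted_list_of_set (insert (k - 3) J)) u"
    using a.e_foldr_set[OF k(1) IJ(2) fin(2), of u] k(2) by auto
  then show ?thesis
  proof cases
    case 1
    have "foldr e (sorted_list_of_set I) 0 = 0" using foldr_scale[of _ 0 0] by simp
    then show ?thesis using c 1 by (simp add: cvs.span_zero)
  next
    case 2
    have "monomial e u I (insert (k - 3) J) \<in> monomials e u p (q + 1)"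
      using IJ k fin 2(1) unfolding monomials_def
      by (intro CollectI exI[of _ I] exI[of _ "insert (k - 3) J"]) auto
    then show ?thesis
      unfolding c 2(2) foldr_scale by (intro cvs.span_scale cvs.span_base) (simp add: monomial_def)
  qed
qed

text \<open>A generator applied to a sorted monomial gives 0 or a multiple of a sorted monomial of
  the next bidegree, so the spans of monomials satisfy all the closure rules of
  \<open>bigraded\<close>.\<close>

lemma bigraded_eq_span: "Collect (bigraded e u p q) = cvs.span (monomials e u p q)"
proof
  have lin: "e k x \<in> cvs.span T"
    if "\<And>m. m \<in> S \<Longrightarrow> e k m \<in> cvs.span T" "x \<in> cvs.span S" for S T k x
    using that(2)
  proof (induction rule: cvs.span_induct_alt)
    case base
    show ?case by (simp add: e_zero cvs.span_zero)
  next
    case (step c x y)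
    then show ?case using that(1) by (simp add: e_add e_scale cvs.span_add cvs.span_scale)
  qed
  have "x \<in> cvs.span (monomials e u p q)" if "bigraded e u p q x" for x
    using that
  proof induction
    case unit
    have "monomial e u {} {} \<in> monomials e u 0 0"
      unfolding monomials_def by (intro CollectI exI[of _ "{}"]) simp
    then show ?case by (intro cvs.span_base) (simp add: monomial_def)
  next
    case (hol p q x k)
    then show ?case using lin e_hol_monomial by blast
  next
    case (anti p q x k)
    then show ?case using lin e_anti_monomial by blast
  qed (auto intro: cvs.span_add cvs.span_scale cvs.span_zero)
  then show "Collect (bigraded e u p q) \<subseteq> cvs.span (monomials e u p q)" by auto
  show "cvs.span (monomials e u p q) \<subseteq> Collect (bigraded e u p q)"
    by (rule cvs.span_minimal[OF _ bigraded_subspace]) (auto simp: monomials_def simp del: One_nat_def intro!: bigraded_monomial)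
qed

end

section \<open>Dimensions of the spaces of left invariant forms\<close>

lemma exterior_lmul: "exterior_operators lmul"
  by unfold_locales (simp_all only: lmul_add lmul_scaleC lmul_self, rule lmul_anticomm)

lemma monomials_lmul: "inv_forms p q = cvs.span (monomials lmul one_form0 p q)"
proof -
  have "inv_monomial I J = monomial lmul one_form0 I J" if "I \<subseteq> {1..3}" "J \<subseteq> {1..3}" for I J
  proof -
    have h: "foldr (\<and>\<^sub>f) (map phi_form ws) \<alpha> = foldr lmul ws \<alpha>" if "set ws \<subseteq> {1..3}" for ws \<alpha>
      using that by (induction ws) (auto simp: lmul_def frame_def)
    have a: "foldr (\<and>\<^sub>f) (map phibar_form ws) \<alpha> = foldr (\<lambda>j. lmul (j + 3)) ws \<alpha>"
      if "set ws \<subseteq> {1..3}" for ws \<alpha>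
      using that by (induction ws) (auto simp: lmul_def frame_def)
    show ?thesis
      using that finite_subset_1_3[of I] finite_subset_1_3[of J]
      by (simp add: inv_monomial_def monomial_def h a)
  qed
  then show ?thesis
    unfolding inv_forms_def monomials_def
    by (intro arg_cong[where f = cvs.span] Collect_cong ex_cong1) auto
qed

text \<open>At the identity of the group z^1 = 0, so the invariant coframe coincides there with the
  coordinate coframe. This one point is enough to detect linear independence.\<close>

lemma lmul_at_0: "k \<in> {1..6} \<Longrightarrow> lmul k \<alpha> 0 K = (coframe k \<and>\<^sub>f \<alpha>) 0 K"
  unfolding in_1_to_6
  by (elim disjE; hypsubst) (simp_all only: lmul_eq, simp_all add: fmult_def)

lemma foldr_lmul_at_0:
  assumes "distinct ws" "set ws \<subseteq> {1..6}"
  shows "foldr lmul ws one_form0 0 K \<noteq> 0 \<longleftrightarrow> K = set ws"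
  using assms
proof (induction ws arbitrary: K)
  case Nil
  show ?case by (simp add: one_form0_def)
next
  case (Cons k ws)
  then have "foldr lmul (k # ws) one_form0 0 K =
      (if finite K \<and> k \<in> K then rank_sign k K * foldr lmul ws one_form0 0 (K - {k}) else 0)"
    by (simp add: lmul_at_0 wedge_coframe)
  moreover have "rank_sign k K \<noteq> 0" by (simp add: rank_sign_def)
  moreover have "finite K \<and> k \<in> K \<and> K - {k} = set ws \<longleftrightarrow> K = set (k # ws)"
    using Cons.prems by auto
  ultimately show ?case using Cons by auto
qed

lemma monomial_lmul_at_0:
  assumes "I \<subseteq> {1..3}" "J \<subseteq> {1..3}"
  shows "monomial lmul one_form0 I J 0 K \<noteq> 0 \<longleftrightarrow> K = I \<union> (+) 3 ` J"
proof -
  have fin: "finite I" "finite J" using assms finite_subset_1_3 by auto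
  let ?ws = "sorted_list_of_set I @ map ((+) 3) (sorted_list_of_set J)"
  have "foldr (\<lambda>j. lmul (j + 3)) js \<alpha> = foldr lmul (map ((+) 3) js) \<alpha>" for js \<alpha>
    by (induction js) (simp_all add: add.commute)
  then have "monomial lmul one_form0 I J = foldr lmul ?ws one_form0"
    by (simp add: monomial_def)
  moreover have "I \<inter> (+) 3 ` J = {}" using assms by force
  then have "distinct ?ws" "set ?ws = I \<union> (+) 3 ` J" "set ?ws \<subseteq> {1..6}"
    using assms fin by (auto simp: distinct_map)
  ultimately show ?thesis
    using foldr_lmul_at_0[of ?ws K] by simp
qed

text \<open>At the identity each sorted monomial has exactly one nonzero coefficient, at an index
  set that determines the pair of subsets. Reading off that coefficient in a vanishing combination
  isolates one scalar.\<close>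

lemma dim_bigraded_lmul:
  "cvs.dim (Collect (bigraded lmul one_form0 (int p) (int q))) = (3 choose p) * (3 choose q)"
proof -
  interpret exterior_operators lmul one_form0 by (rule exterior_lmul)
  let ?P = "\<lambda>p. {I. I \<subseteq> {1..3::nat} \<and> card I = p}"
  define S where "S = ?P p \<times> ?P q"
  define m where "m = (\<lambda>(I, J). monomial lmul one_form0 I J)"
  define supp where "supp = (\<lambda>(I, J). I \<union> (+) 3 ` J :: nat set)"
  have eq: "monomials lmul one_form0 (int p) (int q) = m ` S"
    unfolding monomials_def m_def S_def by auto
  have fin: "finite S" by (simp add: S_def)
  have supp_inj: "x = y" if "x \<in> S" "y \<in> S" "supp x = supp y" for x y
  proof -
    have "fst z = supp z \<inter> {1..3}" "snd z = {j. j + 3 \<in> supp z \<and> j \<in> {1..3}}"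
      if "z \<in> S" for z
      using that by (force simp: supp_def S_def)+
    then show ?thesis using that by (simp add: prod_eq_iff)
  qed
  have nz: "m x 0 (supp y) \<noteq> 0 \<longleftrightarrow> x = y" if "x \<in> S" "y \<in> S" for x y
  proof -
    obtain I J where x: "x = (I, J)" by (cases x)
    have "m x 0 (supp y) \<noteq> 0 \<longleftrightarrow> supp y = supp x"
      using monomial_lmul_at_0[of I J "supp y"] that(1) unfolding x supp_def m_def S_def by simp
    then show ?thesis using supp_inj[OF that] by metis
  qed
  have inj: "inj_on m S"
  proof (rule inj_onI)
    fix x y
    assume xy: "x \<in> S" "y \<in> S" and eq: "m x = m y"
    show "x = y" using nz[OF xy] nz[OF xy(2) xy(2)] by (simp add: eq)
  qed
  have "cvs.independent (m ` S)"
    unfolding cvs.dependent_finite[OF finite_imageI[OF fin]]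
  proof (intro notI, elim exE conjE bexE)
    fix c v
    assume sum: "(\<Sum>v\<in>m ` S. c v *\<^sub>C v) = 0" and v: "v \<in> m ` S" "c v \<noteq> 0"
    then obtain y where y: "y \<in> S" "v = m y" by blast
    have "(\<Sum>x\<in>S. c (m x) *\<^sub>C m x) = 0"
      using sum by (simp only: sum.reindex[OF inj] comp_def)
    then have "(\<Sum>x\<in>S. c (m x) *\<^sub>C m x) 0 (supp y) = 0"
      by (simp only: zero_fun_apply)
    then have "(\<Sum>x\<in>S. c (m x) * m x 0 (supp y)) = 0"
      by (simp only: sum_fun_apply scaleC_fun_def scaleC_complex_def)
    moreover have "(\<Sum>x\<in>S - {y}. c (m x) * m x 0 (supp y)) = 0"
      using nz[OF _ y(1)] by (intro sum.neutral) auto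
    ultimately have "c (m y) * m y 0 (supp y) = 0"
      using sum.remove[OF fin y(1), of "\<lambda>x. c (m x) * m x 0 (supp y)"] by simp
    then show False
      using nz[OF y(1) y(1)] v(2) y(2) by simp
  qed
  then have "cvs.dim (Collect (bigraded lmul one_form0 (int p) (int q))) = card (m ` S)"
    unfolding bigraded_eq_span eq by (rule cvs.dim_span_eq_card_independent)
  also have "\<dots> = (3 choose p) * (3 choose q)"
    unfolding card_image[OF inj] by (simp add: S_def card_cartesian_product n_subsets)
  finally show ?thesis .
qed

text \<open>Keeps the index \<open>1\<close> from turning into \<open>Suc 0\<close>, so that the
  rules for \<open>e 1\<close> and for explicit index sets match.\<close>

declare One_nat_def [simp del]

section \<open>Morphisms from zigzags\<close>

text \<open>The sign of the vertical arrows of \<open>zigzag\<close> in column \<open>p\<close>,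
  which the image vectors have to absorb.\<close>

definition vsign :: "int \<Rightarrow> 'v \<Rightarrow> 'v::complex_vector" where
  "vsign p x = (if even p then x else - x)"

lemma dc_hom_zigzag:
  assumes A: "double_complex A"
    and gr: "\<And>i j. v i j \<in> gr A i j"
    and S: "\<And>i j. (i, j) \<notin> S \<Longrightarrow> v i j = 0" "E1 \<subseteq> S" "E2 \<subseteq> S"
    and d1: "\<And>i j. (i, j) \<in> S \<Longrightarrow> d1 A i j (v i j) = (if (i, j) \<in> E1 then v (i + 1) j else 0)"
    and d2: "\<And>i j. (i, j) \<in> S \<Longrightarrow> d2 A i j (v i j) = (if (i, j) \<in> E2 then vsign i (v i (j + 1)) else 0)"
  shows "dc_hom (zigzag S E1 E2) A v"
  unfolding dc_hom_def
proof (intro allI conjI ballI)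
  fix i j x
  show "gr (zigzag S E1 E2) i j = UNIV \<or> gr (zigzag S E1 E2) i j = {0} \<and> v i j = 0"
    using S(1) by (simp add: zigzag_def)
  have lin: "d1 A i j (x *\<^sub>C v i j) = x *\<^sub>C d1 A i j (v i j)" "d2 A i j (x *\<^sub>C v i j) = x *\<^sub>C d2 A i j (v i j)"
    using A gr[of i j] unfolding double_complex_def linear_map_on_def by blast+
  assume x: "x \<in> gr (zigzag S E1 E2) i j"
  show "d1 A i j (x *\<^sub>C v i j) = d1 (zigzag S E1 E2) i j x *\<^sub>C v (i + 1) j"
    unfolding lin using d1[of i j] x S(2) by (cases "(i, j) \<in> S") (auto simp: zigzag_def)
  show "d2 A i j (x *\<^sub>C v i j) = d2 (zigzag S E1 E2) i j x *\<^sub>C v i (j + 1)"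
    unfolding lin using d2[of i j] x S(3) by (cases "(i, j) \<in> S") (auto simp: zigzag_def vsign_def)
qed (rule gr)

text \<open>The two paths around a square use vertical arrows in adjacent columns, whose signs are
  opposite. By the third condition the paths occur together, so their sum cancels.\<close>

lemma double_complex_zigzag:
  assumes "\<And>i j. (i, j) \<in> E1 \<Longrightarrow> (i, j) \<in> S \<and> (i + 1, j) \<in> S \<and> (i + 1, j) \<notin> E1"
    "\<And>i j. (i, j) \<in> E2 \<Longrightarrow> (i, j) \<in> S \<and> (i, j + 1) \<in> S \<and> (i, j + 1) \<notin> E2"
    "\<And>i j. (i, j) \<in> E1 \<and> (i + 1, j) \<in> E2 \<longleftrightarrow> (i, j) \<in> E2 \<and> (i, j + 1) \<in> E1"
  shows "double_complex (zigzag S E1 E2)"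
  unfolding double_complex_def linear_map_on_def
proof (intro allI conjI)
  fix p q
  show "module.subspace scaleC (gr (zigzag S E1 E2) p q)"
    by (intro cvs.subspaceI) (auto simp: zigzag_def)
  have "\<not> ((p, q) \<in> E1 \<and> (p + 1, q) \<in> E1)" "\<not> ((p, q) \<in> E2 \<and> (p, q + 1) \<in> E2)"
    using assms by blast+
  then show "\<forall>x\<in>gr (zigzag S E1 E2) p q.
      d1 (zigzag S E1 E2) (p + 1) q (d1 (zigzag S E1 E2) p q x) = 0 \<and>
      d2 (zigzag S E1 E2) p (q + 1) (d2 (zigzag S E1 E2) p q x) = 0 \<and>
      d1 (zigzag S E1 E2) p (q + 1) (d2 (zigzag S E1 E2) p q x) +
      d2 (zigzag S E1 E2) (p + 1) q (d1 (zigzag S E1 E2) p q x) = 0"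
    using assms(3)[of p q] by (auto simp: zigzag_def)
qed (use assms(1,2) in \<open>auto simp: zigzag_def scaleC_complex_def\<close>)

lemma double_complex_indecomposables:
  "double_complex (Dot p q)" "double_complex (Hor p q)" "double_complex (Ver p q)"
  "double_complex (Lzz p q)" "double_complex (Rzz p q)" "double_complex (Sq p q)"
  unfolding Dot_def Hor_def Ver_def Lzz_def Rzz_def Sq_def
  by (rule double_complex_zigzag; auto)+

section \<open>Images of the unit vectors for each type of indecomposable\<close>

context
  fixes d \<delta> :: "'v \<Rightarrow> 'v::complex_vector"
begin

definition dot_map :: "int \<Rightarrow> int \<Rightarrow> 'v \<Rightarrow> int \<Rightarrow> int \<Rightarrow> 'v" where
  "dot_map p q x = (\<lambda>i j. if i = p \<and> j = q then x else 0)"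

definition hor_map :: "int \<Rightarrow> int \<Rightarrow> 'v \<Rightarrow> int \<Rightarrow> int \<Rightarrow> 'v" where
  "hor_map p q x = (\<lambda>i j. if i = p \<and> j = q then x else if i = p + 1 \<and> j = q then d x else 0)"

definition ver_map :: "int \<Rightarrow> int \<Rightarrow> 'v \<Rightarrow> int \<Rightarrow> int \<Rightarrow> 'v" where
  "ver_map p q x =
    (\<lambda>i j. if i = p \<and> j = q then x else if i = p \<and> j = q + 1 then vsign p (\<delta> x) else 0)"

definition L_map :: "int \<Rightarrow> int \<Rightarrow> 'v \<Rightarrow> int \<Rightarrow> int \<Rightarrow> 'v" where
  "L_map p q x = (\<lambda>i j. if i = p \<and> j = q then x else if i = p + 1 \<and> j = q then d x
     else if i = p \<and> j = q + 1 then vsign p (\<delta> x) else 0)"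

text \<open>This type has two sources, hence two given vectors. They will be required to satisfy
  \<open>d x = vsign p (\<delta> y)\<close>, so the common target may be entered as
  \<open>d x\<close>.\<close>

definition R_map :: "int \<Rightarrow> int \<Rightarrow> 'v \<Rightarrow> 'v \<Rightarrow> int \<Rightarrow> int \<Rightarrow> 'v" where
  "R_map p q x y = (\<lambda>i j. if i = p \<and> j = q then d x else if i = p - 1 \<and> j = q then x
     else if i = p \<and> j = q - 1 then y else 0)"

text \<open>The last corner carries the sign of column \<open>p\<close>: the minus sign in
  \<open>\<delta> (d x) = - d (\<delta> x)\<close> is matched by the opposite vertical sign in
  column \<open>p + 1\<close>.\<close>

definition sq_map :: "int \<Rightarrow> int \<Rightarrow> 'v \<Rightarrow> int \<Rightarrow> int \<Rightarrow> 'v" where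
  "sq_map p q x = (\<lambda>i j. if i = p \<and> j = q then x else if i = p + 1 \<and> j = q then d x
     else if i = p \<and> j = q + 1 then vsign p (\<delta> x)
     else if i = p + 1 \<and> j = q + 1 then vsign p (d (\<delta> x)) else 0)"

end

locale uniform_dcomplex =
  fixes A :: "'v::complex_vector dcomplex" and d \<delta> :: "'v \<Rightarrow> 'v"
  assumes A: "double_complex A" and d1: "d1 A = (\<lambda>p q. d)" and d2: "d2 A = (\<lambda>p q. \<delta>)"
begin

lemma sub: "cvs.subspace (gr A p q)"
  using A by (simp add: double_complex_def)

lemma gr_closed:
  "0 \<in> gr A p q" "x \<in> gr A p q \<Longrightarrow> - x \<in> gr A p q"
  "x \<in> gr A p q \<Longrightarrow> d x \<in> gr A (p + 1) q" "x \<in> gr A p q \<Longrightarrow> \<delta> x \<in> gr A p (q + 1)"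
  "x \<in> gr A p q \<Longrightarrow> vsign i x \<in> gr A p q"
  using A d1 d2 cvs.subspace_0[OF sub] cvs.subspace_neg[OF sub]
  unfolding double_complex_def linear_map_on_def vsign_def by (auto simp: image_subset_iff)

lemma d_scale:
  "x \<in> gr A p q \<Longrightarrow> d (c *\<^sub>C x) = c *\<^sub>C d x" "x \<in> gr A p q \<Longrightarrow> \<delta> (c *\<^sub>C x) = c *\<^sub>C \<delta> x"
  using A d1 d2 unfolding double_complex_def linear_map_on_def by auto

lemma minus: "x \<in> gr A p q \<Longrightarrow> d (- x) = - d x" "x \<in> gr A p q \<Longrightarrow> \<delta> (- x) = - \<delta> x"
  using d_scale[of x p q "- 1"] by simp_all

lemma zero: "d 0 = 0" "\<delta> 0 = 0"
  using d_scale[OF gr_closed(1), of 0] by simp_all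

lemma d_squares:
  assumes "x \<in> gr A p q"
  shows "d (d x) = 0" "\<delta> (\<delta> x) = 0" "\<delta> (d x) = - d (\<delta> x)"
proof -
  have "d (d x) = 0 \<and> \<delta> (\<delta> x) = 0 \<and> d (\<delta> x) + \<delta> (d x) = 0"
    using A d1 d2 assms unfolding double_complex_def by auto
  then show "d (d x) = 0" "\<delta> (\<delta> x) = 0" "\<delta> (d x) = - d (\<delta> x)"
    by (simp_all add: eq_neg_iff_add_eq_0 add.commute)
qed

lemma d_vsign: "x \<in> gr A p q \<Longrightarrow> d (vsign i x) = vsign i (d x)"
  "x \<in> gr A p q \<Longrightarrow> \<delta> (vsign i x) = vsign i (\<delta> x)"
  by (simp_all add: vsign_def minus)

lemma vsign_simps: "vsign i (vsign i (x :: 'v)) = x" "vsign (i + 1) (x :: 'v) = - vsign i x"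
  "vsign i (0 :: 'v) = 0" "vsign i (- x :: 'v) = - vsign i x"
  by (auto simp: vsign_def)

lemma dc_hom_Dot:
  assumes "x \<in> gr A p q" "d x = 0" "\<delta> x = 0"
  shows "dc_hom (Dot p q) A (dot_map p q x)"
  unfolding Dot_def by (rule dc_hom_zigzag[OF A])
    (use assms in \<open>auto simp: dot_map_def d1 d2 gr_closed\<close>)

lemma dc_hom_Hor:
  assumes "x \<in> gr A p q" "\<delta> x = 0"
  shows "dc_hom (Hor p q) A (hor_map d p q x)"
  unfolding Hor_def by (rule dc_hom_zigzag[OF A])
    (use assms in \<open>auto simp: hor_map_def d1 d2 gr_closed d_squares zero\<close>)

lemma dc_hom_Ver:
  assumes "x \<in> gr A p q" "d x = 0"
  shows "dc_hom (Ver p q) A (ver_map \<delta> p q x)"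
proof -
  have "d (\<delta> x) = 0" using d_squares(3)[OF assms(1)] by (simp add: assms(2) zero)
  then show ?thesis
    unfolding Ver_def by (intro dc_hom_zigzag[OF A])
      (use assms gr_closed(4)[OF assms(1)] in \<open>auto simp: ver_map_def d1 d2 gr_closed d_squares zero vsign_simps
        d_vsign[OF gr_closed(4)[OF assms(1)]]\<close>)
qed

text \<open>By anticommutation \<open>d (\<delta> x) = 0\<close> also yields
  \<open>\<delta> (d x) = 0\<close>, so both ends are annihilated by both differentials.\<close>

lemma dc_hom_Lzz:
  assumes "x \<in> gr A p q" "d (\<delta> x) = 0"
  shows "dc_hom (Lzz p q) A (L_map d \<delta> p q x)"
  unfolding Lzz_def by (rule dc_hom_zigzag[OF A])
    (use assms gr_closed(4)[OF assms(1)] in \<open>auto simp: L_map_def d1 d2 gr_closed d_squares zero vsign_simps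
        d_vsign[OF gr_closed(4)[OF assms(1)]]\<close>)

lemma dc_hom_Rzz:
  assumes "x \<in> gr A (p - 1) q" "y \<in> gr A p (q - 1)" "\<delta> x = 0" "d y = 0" "d x = vsign p (\<delta> y)"
  shows "dc_hom (Rzz p q) A (R_map d p q x y)"
proof -
  have "\<delta> y = vsign p (d x)" by (simp add: assms(5) vsign_simps)
  moreover have "d x \<in> gr A p q" using gr_closed(3)[OF assms(1)] by simp
  ultimately show ?thesis
    unfolding Rzz_def by (intro dc_hom_zigzag[OF A])
      (use assms(1-4) in \<open>auto simp: R_map_def d1 d2 gr_closed d_squares zero\<close>)
qed

text \<open>A square is the free double complex on one generator, so every vector of bidegree
  \<open>(p, q)\<close> defines a morphism.\<close>

lemma dc_hom_Sq:
  assumes "x \<in> gr A p q"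
  shows "dc_hom (Sq p q) A (sq_map d \<delta> p q x)"
proof -
  have "\<delta> x \<in> gr A p (q + 1)" "d (\<delta> x) \<in> gr A (p + 1) (q + 1)" "\<delta> (d (\<delta> x)) = 0" "d (d (\<delta> x)) = 0"
    using gr_closed assms d_squares(1)[OF gr_closed(4)[OF assms]] d_squares(3)[OF gr_closed(4)[OF assms]]
    by (simp_all add: d_squares[OF assms] zero)
  then show ?thesis
    unfolding Sq_def by (intro dc_hom_zigzag[OF A])
      (use assms in \<open>auto simp: sq_map_def d1 d2 gr_closed d_squares zero vsign_simps
        d_vsign[OF gr_closed(4)[OF assms]]
        d_vsign[OF gr_closed(3)[OF gr_closed(4)[OF assms]]]\<close>)
qed

end

section \<open>The abstract Iwasawa double complex\<close>

text \<open>\<open>e 1, \<dots>, e 6\<close> stand for the left multiplications by \<open>\<phi>\<^sup>1, \<phi>\<^sup>2, \<phi>\<^sup>3\<close> and their conjugates, \<open>u\<close> for the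
  constant form \<open>1\<close>, and \<open>(a, b; c, f)\<close> is the coefficient matrix of the second differential of \<open>\<phi>\<^sup>3\<close>.\<close>

locale iwasawa = exterior_operators e u for e :: "nat \<Rightarrow> 'v \<Rightarrow> 'v::complex_vector" and u +
  fixes V :: "'v set" and d \<delta> :: "'v \<Rightarrow> 'v" and a b c f :: complex
  assumes V_u: "u \<in> V" and V_add: "x \<in> V \<Longrightarrow> y \<in> V \<Longrightarrow> x + y \<in> V"
    and V_scale: "x \<in> V \<Longrightarrow> k *\<^sub>C x \<in> V" and V_e: "x \<in> V \<Longrightarrow> j \<in> {1..6} \<Longrightarrow> e j x \<in> V"
    and d_u: "d u = 0" and d_add: "x \<in> V \<Longrightarrow> y \<in> V \<Longrightarrow> d (x + y) = d x + d y"
    and d_scale: "x \<in> V \<Longrightarrow> d (k *\<^sub>C x) = k *\<^sub>C d x"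
    and \<delta>_u: "\<delta> u = 0" and \<delta>_add: "x \<in> V \<Longrightarrow> y \<in> V \<Longrightarrow> \<delta> (x + y) = \<delta> x + \<delta> y"
    and \<delta>_scale: "x \<in> V \<Longrightarrow> \<delta> (k *\<^sub>C x) = k *\<^sub>C \<delta> x"
    and d_e: "x \<in> V \<Longrightarrow> j \<in> {1, 2, 4, 5, 6} \<Longrightarrow> d (e j x) = - e j (d x)"
    and d_e3: "x \<in> V \<Longrightarrow> d (e 3 x) = - e 1 (e 2 x) - e 3 (d x)"
    and \<delta>_e: "x \<in> V \<Longrightarrow> j \<in> {1, 2, 4, 5} \<Longrightarrow> \<delta> (e j x) = - e j (\<delta> x)"
    and \<delta>_e3: "x \<in> V \<Longrightarrow> \<delta> (e 3 x) = a *\<^sub>C e 1 (e 4 x) + b *\<^sub>C e 1 (e 5 x)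
      + c *\<^sub>C e 2 (e 4 x) + f *\<^sub>C e 2 (e 5 x) - e 3 (\<delta> x)"
    and \<delta>_e6: "x \<in> V \<Longrightarrow> \<delta> (e 6 x) = - e 4 (e 5 x) - e 6 (\<delta> x)"
    and dim: "cvs.dim (Collect (bigraded e u (int p) (int q))) = (3 choose p) * (3 choose q)"
begin

lemma V_zero: "0 \<in> V"
  using V_scale[OF V_u, of 0] by simp

lemma V_minus: "x \<in> V \<Longrightarrow> - x \<in> V"
  using V_scale[of x "- 1"] by simp

lemma V_diff: "x \<in> V \<Longrightarrow> y \<in> V \<Longrightarrow> x - y \<in> V"
  using V_add[of x "- y"] V_minus by simp

lemma d_minus: "x \<in> V \<Longrightarrow> d (- x) = - d x" and \<delta>_minus: "x \<in> V \<Longrightarrow> \<delta> (- x) = - \<delta> x"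
  using d_scale[of x "- 1"] \<delta>_scale[of x "- 1"] by simp_all

lemma d_zero: "d 0 = 0" and \<delta>_zero: "\<delta> 0 = 0"
  using d_scale[OF V_u, of 0] \<delta>_scale[OF V_u, of 0] by simp_all

lemma d_diff: "x \<in> V \<Longrightarrow> y \<in> V \<Longrightarrow> d (x - y) = d x - d y"
  and \<delta>_diff: "x \<in> V \<Longrightarrow> y \<in> V \<Longrightarrow> \<delta> (x - y) = \<delta> x - \<delta> y"
  using d_add[of x "- y"] \<delta>_add[of x "- y"] by (simp_all add: V_minus d_minus \<delta>_minus)

lemma e_sort: "j < i \<Longrightarrow> i \<in> {1..6} \<Longrightarrow> j \<in> {1..6} \<Longrightarrow> e i (e j x) = - e j (e i x)"
  by (rule e_swap)

lemmas V_simps = V_u V_add V_scale V_e V_zero V_minus V_diff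
lemmas e_simps = e_add e_scale e_minus e_zero e_diff e_self e_sort
lemmas d_simps = d_u d_add d_scale d_minus d_zero d_diff d_e d_e3
  \<delta>_u \<delta>_add \<delta>_scale \<delta>_minus \<delta>_zero \<delta>_diff \<delta>_e \<delta>_e3 \<delta>_e6

definition G :: "int \<Rightarrow> int \<Rightarrow> 'v set" where
  "G p q = Collect (bigraded e u p q)"

lemma G_add: "x \<in> G p q \<Longrightarrow> y \<in> G p q \<Longrightarrow> x + y \<in> G p q"
  and G_scale: "x \<in> G p q \<Longrightarrow> k *\<^sub>C x \<in> G p q"
  and G_zero: "0 \<in> G p q"
  by (auto simp: G_def intro: bigraded.intros)

lemma G_minus: "x \<in> G p q \<Longrightarrow> - x \<in> G p q"
  using G_scale[of x p q "- 1"] by simp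

lemma G_diff: "x \<in> G p q \<Longrightarrow> y \<in> G p q \<Longrightarrow> x - y \<in> G p q"
  using G_add[of x p q "- y"] G_minus[of y p q] by simp

lemma G_hol: "j \<in> {1..3} \<Longrightarrow> x \<in> G (p - 1) q \<Longrightarrow> e j x \<in> G p q"
  and G_anti: "j \<in> {4..6} \<Longrightarrow> x \<in> G p (q - 1) \<Longrightarrow> e j x \<in> G p q"
  using bigraded.hol[of e u "p - 1" q x j] bigraded.anti[of e u p "q - 1" x j]
  by (auto simp: G_def)

lemmas G_simps = G_add G_scale G_zero G_minus G_diff G_hol G_anti

lemma G_u: "u \<in> G 0 0"
  by (simp add: G_def bigraded.unit)

lemma G_V: "x \<in> G p q \<Longrightarrow> x \<in> V"
proof -
  have "bigraded e u p q x \<Longrightarrow> x \<in> V"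
    by (induction rule: bigraded.induct) (auto simp: V_simps)
  then show "x \<in> G p q \<Longrightarrow> x \<in> V" by (simp add: G_def)
qed

lemma in_1_to_3: "j \<in> {1..3} \<longleftrightarrow> j = 1 \<or> j = 2 \<or> j = (3::nat)"
  and in_4_to_6: "j \<in> {4..6} \<longleftrightarrow> j = 4 \<or> j = 5 \<or> j = (6::nat)"
  by auto

text \<open>Both differentials are antiderivations, so their squares and their anticommutator vanish
  on \<open>e j x\<close> as soon as they vanish on \<open>x\<close> and on the generator. On
  generators they vanish because every nonzero differential is a combination of products of the
  closed generators 1, 2, 4, 5.\<close>

lemma G_differentials:
  assumes "x \<in> G p q"
  shows "d x \<in> G (p + 1) q \<and> \<delta> x \<in> G p (q + 1) \<and> d (d x) = 0 \<and> \<delta> (\<delta> x) = 0 \<and> d (\<delta> x) + \<delta> (d x) = 0"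
proof -
  have "bigraded e u p q x" using assms by (simp add: G_def)
  then show ?thesis
  proof induction
    case unit
    then show ?case by (simp add: d_simps G_zero)
  next
    case (hol p q x j)
    have x: "x \<in> G p q" "d x \<in> G (p + 1) q" "\<delta> x \<in> G p (q + 1)" "d x \<in> G (1 + p) q" "\<delta> x \<in> G p (1 + q)"
      using hol by (auto simp: G_def add.commute)
    have V: "x \<in> V" "d x \<in> V" "\<delta> x \<in> V" using x G_V by blast+
    have "d (e j x) \<in> G (p + 1 + 1) q" "\<delta> (e j x) \<in> G (p + 1) (q + 1)"
      using \<open>j \<in> {1..3}\<close> x unfolding in_1_to_3
      by (auto simp: d_simps V G_simps)
    moreover have "d (d (e j x)) = 0" "\<delta> (\<delta> (e j x)) = 0" "d (\<delta> (e j x)) + \<delta> (d (e j x)) = 0"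
      using \<open>j \<in> {1..3}\<close> hol.IH unfolding in_1_to_3
      by (auto simp: d_simps e_simps V V_simps eq_neg_iff_add_eq_0[symmetric] add_eq_0_iff2 cvs.scale_minus_right)
    ultimately show ?case by simp
  next
    case (anti p q x j)
    have x: "x \<in> G p q" "d x \<in> G (p + 1) q" "\<delta> x \<in> G p (q + 1)" "d x \<in> G (1 + p) q" "\<delta> x \<in> G p (1 + q)"
      using anti by (auto simp: G_def add.commute)
    have V: "x \<in> V" "d x \<in> V" "\<delta> x \<in> V" using x G_V by blast+
    have "d (e j x) \<in> G (p + 1) (q + 1)" "\<delta> (e j x) \<in> G p (q + 1 + 1)"
      using \<open>j \<in> {4..6}\<close> x unfolding in_4_to_6
      by (auto simp: d_simps V G_simps)
    moreover have "d (d (e j x)) = 0" "\<delta> (\<delta> (e j x)) = 0" "d (\<delta> (e j x)) + \<delta> (d (e j x)) = 0"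
      using \<open>j \<in> {4..6}\<close> anti.IH unfolding in_4_to_6
      by (auto simp: d_simps e_simps V V_simps eq_neg_iff_add_eq_0[symmetric] add_eq_0_iff2)
    ultimately show ?case by simp
  next
    case (add p q x y)
    then have G: "x \<in> G p q" "y \<in> G p q" by (simp_all add: G_def)
    then have V: "x \<in> V" "d x \<in> V" "\<delta> x \<in> V" "y \<in> V" "d y \<in> V" "\<delta> y \<in> V"
      using add.IH by (auto intro: G_V)
    have "d (\<delta> (x + y)) + \<delta> (d (x + y)) = (d (\<delta> x) + \<delta> (d x)) + (d (\<delta> y) + \<delta> (d y))"
      by (simp add: d_simps V)
    then show ?case using add by (simp add: d_simps V G_add)
  next
    case (scale p q x k)
    then have G: "x \<in> G p q" by (simp add: G_def)
    then have V: "x \<in> V" "d x \<in> V" "\<delta> x \<in> V"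
      using scale.IH by (auto intro: G_V)
    have "d (\<delta> (k *\<^sub>C x)) + \<delta> (d (k *\<^sub>C x)) = k *\<^sub>C (d (\<delta> x) + \<delta> (d x))"
      by (simp add: d_simps V scaleC_add_right)
    then show ?case using scale by (simp add: d_simps V G_scale)
  next
    case (zero p q)
    then show ?case by (simp add: d_simps G_zero)
  qed
qed

definition complex_of :: "'v dcomplex" where
  "complex_of = \<lparr>gr = G, d1 = (\<lambda>p q. d), d2 = (\<lambda>p q. \<delta>)\<rparr>"

lemma double_complex_complex_of: "double_complex complex_of"
  unfolding double_complex_def linear_map_on_def complex_of_def
  using bigraded_subspace[of e u, folded G_def] G_differentials G_V d_add \<delta>_add d_scale \<delta>_scale
  by auto

sublocale uniform_dcomplex complex_of d \<delta>
  by unfold_locales (rule double_complex_complex_of, simp_all add: complex_of_def)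

lemma G_outside:
  assumes "(p, q) \<notin> {0..3} \<times> {0..3}"
  shows "G p q = {0}"
proof -
  have "card I \<le> 3" if "I \<subseteq> {1..3::nat}" for I
    using card_mono[OF _ that] by simp
  then have "monomials e u p q = {}"
    using assms unfolding monomials_def by (force simp: not_le)
  then show ?thesis unfolding G_def bigraded_eq_span by simp
qed

lemma bounded_complex_of: "bounded_dcomplex complex_of"
proof -
  have "{(p, q). gr complex_of p q \<noteq> {0}} \<subseteq> {0..3} \<times> {0..3}"
  proof (intro subsetI, elim CollectE case_prodE)
    fix x p q
    assume "x = (p, q)" "gr complex_of p q \<noteq> {0}"
    then show "x \<in> {0..3} \<times> {0..3}"
      using G_outside[of p q] by (auto simp: complex_of_def)
  qed
  then show ?thesis
    unfolding bounded_dcomplex_def by (rule finite_subset) simp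
qed

end

section \<open>Explicit decompositions in normal form\<close>

text \<open>Explicit lists let the spanning and counting conditions unfold into finitely many
  concrete claims.\<close>

definition words :: "int \<Rightarrow> nat list list" where
  "words p = (if p = 0 then [[]] else if p = 1 then [[1], [2], [3]]
     else if p = 2 then [[1, 2], [1, 3], [2, 3]] else if p = 3 then [[1, 2, 3]] else [])"

lemma sorted_list_in_words:
  assumes "I \<subseteq> {1..3}"
  shows "sorted_list_of_set I \<in> set (words (int (card I)))"
proof -
  have "{1..3} = {1, 2, 3::nat}" by auto
  then have "I \<in> Pow {1, 2, 3}" using assms by simp
  then have "I \<in> {{}, {1}, {2}, {3}, {1, 2}, {1, 3}, {2, 3}, {1, 2, 3}}"
    by (simp only: Pow_insert Pow_empty) auto
  then show ?thesis
    unfolding insert_iff empty_iff by (elim disjE; simp add: words_def)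
qed

lemma monomials_words:
  assumes "x \<in> monomials e u p q"
  shows "\<exists>xs\<in>set (words p). \<exists>ys\<in>set (words q). x = foldr e xs (foldr (\<lambda>j. e (j + 3)) ys u)"
  using assms sorted_list_in_words unfolding monomials_def monomial_def by blast

context iwasawa
begin

text \<open>Everything vanishes outside sixteen bidegrees, which can be evaluated one by one; the
  lengths of the word lists are the binomial coefficients in the dimension formula. An arbitrary
  subspace \<open>X\<close> stands in for the span of the table vectors, so that spanning becomes
  rewriting of membership in \<open>X\<close>.\<close>

lemma complex_of_isoI:
  assumes hom: "list_all (\<lambda>(C, v). double_complex C \<and> dc_hom C complex_of v) L"
    and supp: "list_all (\<lambda>(C, v). \<forall>p q. gr C p q \<noteq> {0} \<longrightarrow> p \<in> {0, 1, 2, 3} \<and> q \<in> {0, 1, 2, 3}) L"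
    and count: "\<And>p q. p \<in> {0, 1, 2, 3} \<Longrightarrow> q \<in> {0, 1, 2, 3} \<Longrightarrow>
      length (filter (\<lambda>(C, v). gr C p q \<noteq> {0}) L) \<le> length (words p) * length (words q)"
    and span: "\<And>p q X. p \<in> {0, 1, 2, 3} \<Longrightarrow> q \<in> {0, 1, 2, 3} \<Longrightarrow> cvs.subspace X \<Longrightarrow>
      list_all (\<lambda>(C, v). v p q \<in> X) L \<Longrightarrow>
      list_all (\<lambda>xs. list_all (\<lambda>ys. foldr e xs (foldr (\<lambda>j. e (j + 3)) ys u) \<in> X) (words q)) (words p)"
  shows "complex_of \<cong>\<^sub>d\<^sub>c dc_sum (map fst L)"
proof (rule dc_iso_dc_sumI[OF double_complex_complex_of])
  show "double_complex C \<and> dc_hom C complex_of v" if "(C, v) \<in> set L" for C v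
    using hom that by (auto simp: list_all_iff)
  fix p q :: int
  have gr: "gr complex_of = G" by (simp add: complex_of_def)
  have out: "p \<in> {0, 1, 2, 3} \<and> q \<in> {0, 1, 2, 3} \<or> (p, q) \<notin> {0..3} \<times> {0..3}"
    by auto
  show "gr complex_of p q \<subseteq> cvs.span ((\<lambda>(C, v). v p q) ` set L)" (is "_ \<subseteq> ?X")
    using out
  proof (elim conjE disjE)
    assume "p \<in> {0, 1, 2, 3}" "q \<in> {0, 1, 2, 3}"
    moreover have "list_all (\<lambda>(C, v). v p q \<in> ?X) L"
      unfolding list_all_iff by (auto intro!: cvs.span_base)
    ultimately have "monomials e u p q \<subseteq> ?X"
      using span[OF _ _ cvs.subspace_span] monomials_words[of _ e u p q]
      unfolding list_all_iff by blast
    then show ?thesis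
      unfolding gr G_def bigraded_eq_span by (rule cvs.span_minimal[OF _ cvs.subspace_span])
  next
    assume "(p, q) \<notin> {0..3} \<times> {0..3}"
    then show ?thesis
      unfolding gr by (subst G_outside) (simp_all add: cvs.span_zero)
  qed
  show "length (filter (\<lambda>(C, v). gr C p q \<noteq> {0}) L) \<le> cvs.dim (gr complex_of p q)"
    using out
  proof (elim conjE disjE)
    assume pq: "p \<in> {0, 1, 2, 3}" "q \<in> {0, 1, 2, 3}"
    have "length (words p) = 3 choose nat p" if "p \<in> {0, 1, 2, 3}" for p
      using that by (auto simp: words_def numeral_3_eq_3 numeral_2_eq_2 One_nat_def)
    moreover have "cvs.dim (G p q) = (3 choose nat p) * (3 choose nat q)"
      using dim[of "nat p" "nat q"] pq by (auto simp: G_def)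
    ultimately show ?thesis
      unfolding gr using count[OF pq] pq by simp
  next
    assume "(p, q) \<notin> {0..3} \<times> {0..3}"
    then have "\<not> (p \<in> {0, 1, 2, 3} \<and> q \<in> {0, 1, 2, 3})" by auto
    then have "filter (\<lambda>(C, v). gr C p q \<noteq> {0}) L = []"
      using supp unfolding filter_empty_conv list_all_iff by blast
    then show ?thesis by simp
  qed
qed

end

lemma gr_zigzag_neq: "gr (zigzag S E1 E2) p q \<noteq> {0} \<longleftrightarrow> (p, q) \<in> S"
  using one_neq_zero by (auto simp: zigzag_def)

lemmas gr_simps = Dot_def Hor_def Ver_def Lzz_def Rzz_def Sq_def gr_zigzag_neq

lemmas map_defs = dot_map_def hor_map_def ver_map_def L_map_def R_map_def sq_map_def vsign_def

text \<open>The vectors of the tables below are triangular with respect to the monomials, so these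
  rewrite rules suffice to see that they span.\<close>

lemma subspace_simps:
  assumes "cvs.subspace X"
  shows "x \<in> X \<Longrightarrow> x + y \<in> X \<longleftrightarrow> y \<in> X" "y \<in> X \<Longrightarrow> x + y \<in> X \<longleftrightarrow> x \<in> X"
    "x \<in> X \<Longrightarrow> x - y \<in> X \<longleftrightarrow> y \<in> X" "y \<in> X \<Longrightarrow> x - y \<in> X \<longleftrightarrow> x \<in> X"
    "- x \<in> X \<longleftrightarrow> x \<in> X" "k \<noteq> 0 \<Longrightarrow> k *\<^sub>C x \<in> X \<longleftrightarrow> x \<in> X" "x \<in> X \<Longrightarrow> k *\<^sub>C x \<in> X"
    "0 \<in> X"
proof -
  note sub = cvs.subspace_add[OF assms] cvs.subspace_scale[OF assms] cvs.subspace_neg[OF assms]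
    cvs.subspace_diff[OF assms] cvs.subspace_0[OF assms]
  show "x \<in> X \<Longrightarrow> x + y \<in> X \<longleftrightarrow> y \<in> X"
    using sub(1)[of x y] sub(4)[of "x + y" x] by auto
  show "y \<in> X \<Longrightarrow> x + y \<in> X \<longleftrightarrow> x \<in> X"
    using sub(1)[of x y] sub(4)[of "x + y" y] by auto
  show "y \<in> X \<Longrightarrow> x - y \<in> X \<longleftrightarrow> x \<in> X"
    using sub(1)[of "x - y" y] sub(4)[of x y] by auto
  show "x \<in> X \<Longrightarrow> x - y \<in> X \<longleftrightarrow> y \<in> X"
    using sub(4)[of x "x - y"] sub(4)[of x y] by auto
  show "- x \<in> X \<longleftrightarrow> x \<in> X"
    using sub(3)[of x] sub(3)[of "- x"] by auto
  show "x \<in> X \<Longrightarrow> k *\<^sub>C x \<in> X" by (rule sub(2))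
  show "k *\<^sub>C x \<in> X \<longleftrightarrow> x \<in> X" if "k \<noteq> 0"
    using sub(2)[of x k] sub(2)[of "k *\<^sub>C x" "inverse k"] that by (auto simp: scaleC_one)
  show "0 \<in> X" by (rule sub(5))
qed

lemma length_filter_Cons:
  "length (filter P (x # xs)) = (if P x then 1 else 0) + length (filter P xs)"
  by simp

locale diagonal_iwasawa = iwasawa e u V d \<delta> a 0 0 f
  for e :: "nat \<Rightarrow> 'v \<Rightarrow> 'v::complex_vector" and u V d \<delta> a f
begin

abbreviation m :: "nat list \<Rightarrow> 'v" where
  "m ws \<equiv> foldr e ws u"

lemma gr_complex: "gr complex_of = G"
  by (simp add: complex_of_def)

lemmas hom_simps = double_complex_indecomposables dc_hom_Dot dc_hom_Hor dc_hom_Ver dc_hom_Lzz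
  dc_hom_Rzz dc_hom_Sq gr_complex G_simps G_u V_simps d_simps e_simps vsign_def
  scaleC_scaleC scaleC_add_right cvs.scale_right_diff_distrib

text \<open>With n = 0, up to sign \<open>d\<close> replaces 3 by 1, 2 and \<open>\<delta>\<close>
  replaces 6 by 4, 5. The complex is the tensor product of the holomorphic and the conjugate
  exterior algebras, each a sum of one arrow and six dots: arrow times arrow gives the square, arrow
  times dot the zigzags of length 2, dot times dot the dots.\<close>

definition rank0_table :: "(complex dcomplex \<times> (int \<Rightarrow> int \<Rightarrow> 'v)) list" where
  "rank0_table =
    [(Sq 1 1, sq_map d \<delta> 1 1 (m [3, 6])), (Hor 1 0, hor_map d 1 0 (m [3])),
     (Hor 1 1, hor_map d 1 1 (m [3, 4])), (Hor 1 1, hor_map d 1 1 (m [3, 5])),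
     (Hor 1 2, hor_map d 1 2 (m [3, 4, 6])), (Hor 1 2, hor_map d 1 2 (m [3, 5, 6])),
     (Hor 1 3, hor_map d 1 3 (m [3, 4, 5, 6])), (Ver 0 1, ver_map \<delta> 0 1 (m [6])),
     (Ver 1 1, ver_map \<delta> 1 1 (m [1, 6])), (Ver 1 1, ver_map \<delta> 1 1 (m [2, 6])),
     (Ver 2 1, ver_map \<delta> 2 1 (m [1, 3, 6])),
     (Ver 2 1, ver_map \<delta> 2 1 (m [2, 3, 6])),
     (Ver 3 1, ver_map \<delta> 3 1 (m [1, 2, 3, 6])), (Dot 0 0, dot_map 0 0 (m [])),
     (Dot 1 0, dot_map 1 0 (m [1])), (Dot 1 0, dot_map 1 0 (m [2])),
     (Dot 2 0, dot_map 2 0 (m [1, 3])), (Dot 2 0, dot_map 2 0 (m [2, 3])),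
     (Dot 3 0, dot_map 3 0 (m [1, 2, 3])), (Dot 0 1, dot_map 0 1 (m [4])),
     (Dot 0 1, dot_map 0 1 (m [5])), (Dot 1 1, dot_map 1 1 (m [1, 4])),
     (Dot 1 1, dot_map 1 1 (m [1, 5])), (Dot 1 1, dot_map 1 1 (m [2, 4])),
     (Dot 1 1, dot_map 1 1 (m [2, 5])), (Dot 2 1, dot_map 2 1 (m [1, 3, 4])),
     (Dot 2 1, dot_map 2 1 (m [1, 3, 5])), (Dot 2 1, dot_map 2 1 (m [2, 3, 4])),
     (Dot 2 1, dot_map 2 1 (m [2, 3, 5])), (Dot 3 1, dot_map 3 1 (m [1, 2, 3, 4])),
     (Dot 3 1, dot_map 3 1 (m [1, 2, 3, 5])), (Dot 0 2, dot_map 0 2 (m [4, 6])),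
     (Dot 0 2, dot_map 0 2 (m [5, 6])), (Dot 1 2, dot_map 1 2 (m [1, 4, 6])),
     (Dot 1 2, dot_map 1 2 (m [1, 5, 6])), (Dot 1 2, dot_map 1 2 (m [2, 4, 6])),
     (Dot 1 2, dot_map 1 2 (m [2, 5, 6])), (Dot 2 2, dot_map 2 2 (m [1, 3, 4, 6])),
     (Dot 2 2, dot_map 2 2 (m [1, 3, 5, 6])), (Dot 2 2, dot_map 2 2 (m [2, 3, 4, 6])),
     (Dot 2 2, dot_map 2 2 (m [2, 3, 5, 6])), (Dot 3 2, dot_map 3 2 (m [1, 2, 3, 4, 6])),
     (Dot 3 2, dot_map 3 2 (m [1, 2, 3, 5, 6])), (Dot 0 3, dot_map 0 3 (m [4, 5, 6])),
     (Dot 1 3, dot_map 1 3 (m [1, 4, 5, 6])), (Dot 1 3, dot_map 1 3 (m [2, 4, 5, 6])),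
     (Dot 2 3, dot_map 2 3 (m [1, 3, 4, 5, 6])), (Dot 2 3, dot_map 2 3 (m [2, 3, 4, 5, 6])),
     (Dot 3 3, dot_map 3 3 (m [1, 2, 3, 4, 5, 6]))]"

lemma rank0_hom:
  assumes "a = 0" "f = 0"
  shows "list_all (\<lambda>(C, v). double_complex C \<and> dc_hom C complex_of v) rank0_table"
  unfolding rank0_table_def by (simp add: hom_simps assms)

lemma rank0_support:
  "list_all (\<lambda>(C, v). \<forall>p q. gr C p q \<noteq> {0} \<longrightarrow> p \<in> {0, 1, 2, 3} \<and> q \<in> {0, 1, 2, 3}) rank0_table"
  unfolding rank0_table_def by (auto simp: gr_simps)

lemma rank0_count:
  "p \<in> {0, 1, 2, 3} \<Longrightarrow> q \<in> {0, 1, 2, 3} \<Longrightarrow>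
    length (filter (\<lambda>(C, v). gr C p q \<noteq> {0}) rank0_table) \<le> length (words p) * length (words q)"
  unfolding rank0_table_def length_filter_Cons prod.case gr_simps insert_iff empty_iff
  by (elim disjE FalseE; simp add: words_def)

lemma rank0_span:
  assumes "a = 0" "f = 0" "p \<in> {0, 1, 2, 3}" "q \<in> {0, 1, 2, 3}" and X: "cvs.subspace X"
    and "list_all (\<lambda>(C, v). v p q \<in> X) rank0_table"
  shows "list_all (\<lambda>xs. list_all (\<lambda>ys. foldr e xs (foldr (\<lambda>j. e (j + 3)) ys u) \<in> X) (words q)) (words p)"
  using assms(3,4,6) unfolding rank0_table_def insert_iff empty_iff
  by (elim disjE FalseE; hypsubst;
      simp add: map_defs words_def subspace_simps[OF X] assms(1,2) V_simps d_simps e_simps;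
      (elim conjE)?; simp add: subspace_simps[OF X] assms(1,2))

lemma rank0_iso:
  assumes "a = 0" "f = 0"
  shows "complex_of \<cong>\<^sub>d\<^sub>c dc_sum_mult
       [(1, Sq 1 1),
        (1, Hor 1 0), (2, Hor 1 1), (2, Hor 1 2), (1, Hor 1 3),
        (1, Ver 0 1), (2, Ver 1 1), (2, Ver 2 1), (1, Ver 3 1),
        (1, Dot 0 0), (2, Dot 1 0), (2, Dot 2 0), (1, Dot 3 0),
        (2, Dot 0 1), (4, Dot 1 1), (4, Dot 2 1), (2, Dot 3 1),
        (2, Dot 0 2), (4, Dot 1 2), (4, Dot 2 2), (2, Dot 3 2),
        (1, Dot 0 3), (2, Dot 1 3), (2, Dot 2 3), (1, Dot 3 3)]"
proof -
  have "complex_of \<cong>\<^sub>d\<^sub>c dc_sum (map fst rank0_table)"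
    by (rule complex_of_isoI[OF rank0_hom[OF assms] rank0_support rank0_count rank0_span[OF assms]])
  then show ?thesis
    by (simp add: dc_sum_mult_def rank0_table_def eval_nat_numeral One_nat_def)
qed

text \<open>Compared with n = 0, \<open>\<delta>\<close> now maps 3 to \<open>a\<close> times 1, 4.
  This joins four horizontal zigzags to dots: those of 3 and of 3, 5, 6 acquire a second target and
  become L, while those of 3, 4 and of 3, 4, 5, 6 share their target with a former dot and become R.
  The factor \<open>- a\<close> equates the two arrows into that target. The terms containing 6 in
  the vectors of 3, 5 and 2, 3, 5 cancel \<open>\<delta>\<close>, since \<open>\<delta>\<close> maps
  6 to minus 4, 5.\<close>

definition rank1_table :: "(complex dcomplex \<times> (int \<Rightarrow> int \<Rightarrow> 'v)) list" where
  "rank1_table =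
    [(Sq 1 1, sq_map d \<delta> 1 1 (m [3, 6])),
     (Hor 1 1, hor_map d 1 1 (m [3, 5] - a *\<^sub>C m [1, 6])),
     (Hor 1 2, hor_map d 1 2 (m [3, 4, 6])), (Ver 0 1, ver_map \<delta> 0 1 (m [6])),
     (Ver 1 1, ver_map \<delta> 1 1 (m [1, 6])), (Ver 1 1, ver_map \<delta> 1 1 (m [2, 6])),
     (Ver 2 1, ver_map \<delta> 2 1 (m [1, 3, 6])),
     (Ver 2 1, ver_map \<delta> 2 1 (m [2, 3, 6])),
     (Ver 3 1, ver_map \<delta> 3 1 (m [1, 2, 3, 6])), (Lzz 1 0, L_map d \<delta> 1 0 (m [3])),
     (Lzz 1 2, L_map d \<delta> 1 2 (m [3, 5, 6])),
     (Rzz 2 1, R_map d 2 1 (- a *\<^sub>C m [3, 4]) (m [2, 3])),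
     (Rzz 2 3, R_map d 2 3 (- a *\<^sub>C m [3, 4, 5, 6]) (m [2, 3, 5, 6])),
     (Dot 0 0, dot_map 0 0 (m [])), (Dot 1 0, dot_map 1 0 (m [1])),
     (Dot 1 0, dot_map 1 0 (m [2])), (Dot 2 0, dot_map 2 0 (m [1, 3])),
     (Dot 3 0, dot_map 3 0 (m [1, 2, 3])), (Dot 0 1, dot_map 0 1 (m [4])),
     (Dot 0 1, dot_map 0 1 (m [5])), (Dot 1 1, dot_map 1 1 (m [1, 5])),
     (Dot 1 1, dot_map 1 1 (m [2, 4])), (Dot 1 1, dot_map 1 1 (m [2, 5])),
     (Dot 2 1, dot_map 2 1 (m [1, 3, 4])), (Dot 2 1, dot_map 2 1 (m [1, 3, 5])),
     (Dot 2 1, dot_map 2 1 (m [2, 3, 4])),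
     (Dot 2 1, dot_map 2 1 (m [2, 3, 5] + a *\<^sub>C m [1, 2, 6])),
     (Dot 3 1, dot_map 3 1 (m [1, 2, 3, 4])), (Dot 3 1, dot_map 3 1 (m [1, 2, 3, 5])),
     (Dot 0 2, dot_map 0 2 (m [4, 6])), (Dot 0 2, dot_map 0 2 (m [5, 6])),
     (Dot 1 2, dot_map 1 2 (m [1, 4, 6])), (Dot 1 2, dot_map 1 2 (m [1, 5, 6])),
     (Dot 1 2, dot_map 1 2 (m [2, 4, 6])), (Dot 1 2, dot_map 1 2 (m [2, 5, 6])),
     (Dot 2 2, dot_map 2 2 (m [1, 3, 4, 6])), (Dot 2 2, dot_map 2 2 (m [1, 3, 5, 6])),
     (Dot 2 2, dot_map 2 2 (m [2, 3, 4, 6])), (Dot 3 2, dot_map 3 2 (m [1, 2, 3, 4, 6])),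
     (Dot 3 2, dot_map 3 2 (m [1, 2, 3, 5, 6])), (Dot 0 3, dot_map 0 3 (m [4, 5, 6])),
     (Dot 1 3, dot_map 1 3 (m [2, 4, 5, 6])), (Dot 2 3, dot_map 2 3 (m [1, 3, 4, 5, 6])),
     (Dot 2 3, dot_map 2 3 (m [2, 3, 4, 5, 6])), (Dot 3 3, dot_map 3 3 (m [1, 2, 3, 4, 5, 6]))]"

lemma rank1_hom:
  assumes "f = 0" "a \<noteq> 0"
  shows "list_all (\<lambda>(C, v). double_complex C \<and> dc_hom C complex_of v) rank1_table"
  unfolding rank1_table_def by (simp add: hom_simps assms)

lemma rank1_support:
  "list_all (\<lambda>(C, v). \<forall>p q. gr C p q \<noteq> {0} \<longrightarrow> p \<in> {0, 1, 2, 3} \<and> q \<in> {0, 1, 2, 3}) rank1_table"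
  unfolding rank1_table_def by (auto simp: gr_simps)

lemma rank1_count:
  "p \<in> {0, 1, 2, 3} \<Longrightarrow> q \<in> {0, 1, 2, 3} \<Longrightarrow>
    length (filter (\<lambda>(C, v). gr C p q \<noteq> {0}) rank1_table) \<le> length (words p) * length (words q)"
  unfolding rank1_table_def length_filter_Cons prod.case gr_simps insert_iff empty_iff
  by (elim disjE FalseE; simp add: words_def)

lemma rank1_span:
  assumes "f = 0" "a \<noteq> 0" "p \<in> {0, 1, 2, 3}" "q \<in> {0, 1, 2, 3}" and X: "cvs.subspace X"
    and "list_all (\<lambda>(C, v). v p q \<in> X) rank1_table"
  shows "list_all (\<lambda>xs. list_all (\<lambda>ys. foldr e xs (foldr (\<lambda>j. e (j + 3)) ys u) \<in> X) (words q)) (words p)"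
  using assms(3,4,6) unfolding rank1_table_def insert_iff empty_iff
  by (elim disjE FalseE; hypsubst;
      simp add: map_defs words_def subspace_simps[OF X] assms(1,2) V_simps d_simps e_simps;
      (elim conjE)?; simp add: subspace_simps[OF X] assms(1,2))

lemma rank1_iso:
  assumes "f = 0" "a \<noteq> 0"
  shows "complex_of \<cong>\<^sub>d\<^sub>c dc_sum_mult
       [(1, Sq 1 1),
        (1, Hor 1 1), (1, Hor 1 2),
        (1, Ver 0 1), (2, Ver 1 1), (2, Ver 2 1), (1, Ver 3 1),
        (1, Lzz 1 0), (1, Lzz 1 2), (1, Rzz 2 1), (1, Rzz 2 3),
        (1, Dot 0 0), (2, Dot 1 0), (1, Dot 2 0), (1, Dot 3 0),
        (2, Dot 0 1), (3, Dot 1 1), (4, Dot 2 1), (2, Dot 3 1),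
        (2, Dot 0 2), (4, Dot 1 2), (3, Dot 2 2), (2, Dot 3 2),
        (1, Dot 0 3), (1, Dot 1 3), (2, Dot 2 3), (1, Dot 3 3)]"
proof -
  have "complex_of \<cong>\<^sub>d\<^sub>c dc_sum (map fst rank1_table)"
    by (rule complex_of_isoI[OF rank1_hom[OF assms] rank1_support rank1_count rank1_span[OF assms]])
  then show ?thesis
    by (simp add: dc_sum_mult_def rank1_table_def eval_nat_numeral One_nat_def)
qed

text \<open>The second diagonal entry \<open>f\<close> turns the remaining two horizontal zigzags
  into another L and another R. Corrections by monomials containing 6 again cancel
  \<open>\<delta>\<close>. The combination of 1, 3, 4, 6 and 2, 3, 5, 6 is the one on which the
  contributions of \<open>a\<close> and \<open>f\<close> to \<open>\<delta>\<close> cancel; since 2,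
  3, 5, 6 is already a source of the last R, it still contributes a new direction.\<close>

definition rank2_table :: "(complex dcomplex \<times> (int \<Rightarrow> int \<Rightarrow> 'v)) list" where
  "rank2_table =
    [(Sq 1 1, sq_map d \<delta> 1 1 (m [3, 6])), (Ver 0 1, ver_map \<delta> 0 1 (m [6])),
     (Ver 1 1, ver_map \<delta> 1 1 (m [1, 6])), (Ver 1 1, ver_map \<delta> 1 1 (m [2, 6])),
     (Ver 2 1, ver_map \<delta> 2 1 (m [1, 3, 6])),
     (Ver 2 1, ver_map \<delta> 2 1 (m [2, 3, 6])),
     (Ver 3 1, ver_map \<delta> 3 1 (m [1, 2, 3, 6])), (Lzz 1 0, L_map d \<delta> 1 0 (m [3])),
     (Lzz 1 2, L_map d \<delta> 1 2 (m [3, 4, 6])),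
     (Lzz 1 2, L_map d \<delta> 1 2 (m [3, 5, 6])),
     (Rzz 2 1, R_map d 2 1 (- a *\<^sub>C (m [3, 4] + f *\<^sub>C m [2, 6])) (m [2, 3])),
     (Rzz 2 1, R_map d 2 1 (f *\<^sub>C (m [3, 5] - a *\<^sub>C m [1, 6])) (m [1, 3])),
     (Rzz 2 3, R_map d 2 3 (- a *\<^sub>C m [3, 4, 5, 6]) (m [2, 3, 5, 6])),
     (Dot 0 0, dot_map 0 0 (m [])), (Dot 1 0, dot_map 1 0 (m [1])),
     (Dot 1 0, dot_map 1 0 (m [2])), (Dot 3 0, dot_map 3 0 (m [1, 2, 3])),
     (Dot 0 1, dot_map 0 1 (m [4])), (Dot 0 1, dot_map 0 1 (m [5])),
     (Dot 1 1, dot_map 1 1 (m [1, 4])), (Dot 1 1, dot_map 1 1 (m [1, 5])),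
     (Dot 1 1, dot_map 1 1 (m [2, 4])),
     (Dot 2 1, dot_map 2 1 (m [1, 3, 4] + f *\<^sub>C m [1, 2, 6])),
     (Dot 2 1, dot_map 2 1 (m [1, 3, 5])), (Dot 2 1, dot_map 2 1 (m [2, 3, 4])),
     (Dot 2 1, dot_map 2 1 (m [2, 3, 5] + a *\<^sub>C m [1, 2, 6])),
     (Dot 3 1, dot_map 3 1 (m [1, 2, 3, 4])), (Dot 3 1, dot_map 3 1 (m [1, 2, 3, 5])),
     (Dot 0 2, dot_map 0 2 (m [4, 6])), (Dot 0 2, dot_map 0 2 (m [5, 6])),
     (Dot 1 2, dot_map 1 2 (m [1, 4, 6])), (Dot 1 2, dot_map 1 2 (m [1, 5, 6])),
     (Dot 1 2, dot_map 1 2 (m [2, 4, 6])), (Dot 1 2, dot_map 1 2 (m [2, 5, 6])),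
     (Dot 2 2, dot_map 2 2 (m [1, 3, 5, 6])), (Dot 2 2, dot_map 2 2 (m [2, 3, 4, 6])),
     (Dot 2 2, dot_map 2 2 (a *\<^sub>C m [1, 3, 4, 6] - f *\<^sub>C m [2, 3, 5, 6])),
     (Dot 3 2, dot_map 3 2 (m [1, 2, 3, 4, 6])), (Dot 3 2, dot_map 3 2 (m [1, 2, 3, 5, 6])),
     (Dot 0 3, dot_map 0 3 (m [4, 5, 6])), (Dot 2 3, dot_map 2 3 (m [1, 3, 4, 5, 6])),
     (Dot 2 3, dot_map 2 3 (m [2, 3, 4, 5, 6])), (Dot 3 3, dot_map 3 3 (m [1, 2, 3, 4, 5, 6]))]"

lemma rank2_hom:
  assumes "f \<noteq> 0" "a \<noteq> 0"
  shows "list_all (\<lambda>(C, v). double_complex C \<and> dc_hom C complex_of v) rank2_table"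
  unfolding rank2_table_def by (simp add: hom_simps assms)

lemma rank2_support:
  "list_all (\<lambda>(C, v). \<forall>p q. gr C p q \<noteq> {0} \<longrightarrow> p \<in> {0, 1, 2, 3} \<and> q \<in> {0, 1, 2, 3}) rank2_table"
  unfolding rank2_table_def by (auto simp: gr_simps)

lemma rank2_count:
  "p \<in> {0, 1, 2, 3} \<Longrightarrow> q \<in> {0, 1, 2, 3} \<Longrightarrow>
    length (filter (\<lambda>(C, v). gr C p q \<noteq> {0}) rank2_table) \<le> length (words p) * length (words q)"
  unfolding rank2_table_def length_filter_Cons prod.case gr_simps insert_iff empty_iff
  by (elim disjE FalseE; simp add: words_def)

lemma rank2_span:
  assumes "f \<noteq> 0" "a \<noteq> 0" "p \<in> {0, 1, 2, 3}" "q \<in> {0, 1, 2, 3}" and X: "cvs.subspace X"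
    and "list_all (\<lambda>(C, v). v p q \<in> X) rank2_table"
  shows "list_all (\<lambda>xs. list_all (\<lambda>ys. foldr e xs (foldr (\<lambda>j. e (j + 3)) ys u) \<in> X) (words q)) (words p)"
  using assms(3,4,6) unfolding rank2_table_def insert_iff empty_iff
  by (elim disjE FalseE; hypsubst;
      simp add: map_defs words_def subspace_simps[OF X] assms(1,2) V_simps d_simps e_simps;
      (elim conjE)?; simp add: subspace_simps[OF X] assms(1,2))

lemma rank2_iso:
  assumes "f \<noteq> 0" "a \<noteq> 0"
  shows "complex_of \<cong>\<^sub>d\<^sub>c dc_sum_mult
       [(1, Sq 1 1),
        (1, Ver 0 1), (2, Ver 1 1), (2, Ver 2 1), (1, Ver 3 1),
        (1, Lzz 1 0), (2, Lzz 1 2), (2, Rzz 2 1), (1, Rzz 2 3),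
        (1, Dot 0 0), (2, Dot 1 0), (1, Dot 3 0),
        (2, Dot 0 1), (3, Dot 1 1), (4, Dot 2 1), (2, Dot 3 1),
        (2, Dot 0 2), (4, Dot 1 2), (3, Dot 2 2), (2, Dot 3 2),
        (1, Dot 0 3), (2, Dot 2 3), (1, Dot 3 3)]"
proof -
  have "complex_of \<cong>\<^sub>d\<^sub>c dc_sum (map fst rank2_table)"
    by (rule complex_of_isoI[OF rank2_hom[OF assms] rank2_support rank2_count rank2_span[OF assms]])
  then show ?thesis
    by (simp add: dc_sum_mult_def rank2_table_def eval_nat_numeral One_nat_def)
qed

end

section \<open>Reduction to normal form\<close>

lemma bigraded_mono:
  assumes "\<And>k p q x. k \<in> {1..3} \<Longrightarrow> bigraded e' u p q x \<Longrightarrow> bigraded e' u (p + 1) q (e k x)"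
    and "\<And>k p q x. k \<in> {4..6} \<Longrightarrow> bigraded e' u p q x \<Longrightarrow> bigraded e' u p (q + 1) (e k x)"
    and "bigraded e u p q x"
  shows "bigraded e' u p q x"
  using assms(3) by induction (auto intro: assms(1,2) bigraded.intros)

text \<open>The matrix with rows \<open>pa pb\<close> and \<open>pc pd\<close> acts on \<phi>^1,
  \<phi>^2, the one with rows \<open>qa qb\<close> and \<open>qc qd\<close> on their conjugates; the
  generators 3 and 6 are kept.\<close>

definition change_generators ::
    "complex \<Rightarrow> complex \<Rightarrow> complex \<Rightarrow> complex \<Rightarrow> complex \<Rightarrow> complex \<Rightarrow> complex \<Rightarrow> complex \<Rightarrow>
      (nat \<Rightarrow> 'v \<Rightarrow> 'v::complex_vector) \<Rightarrow> nat \<Rightarrow> 'v \<Rightarrow> 'v" where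
  "change_generators pa pb pc pd qa qb qc qd e k x =
    (if k = 1 then pa *\<^sub>C e 1 x + pb *\<^sub>C e 2 x else if k = 2 then pc *\<^sub>C e 1 x + pd *\<^sub>C e 2 x
     else if k = 4 then qa *\<^sub>C e 4 x + qb *\<^sub>C e 5 x else if k = 5 then qc *\<^sub>C e 4 x + qd *\<^sub>C e 5 x
     else e k x)"

context iwasawa
begin

text \<open>The four equations say that n is the transpose of the first matrix times the diagonal
  matrix of \<open>\<alpha>, \<beta>\<close> times the second matrix. This is how a bilinear
  expression in the new generators expands in the old ones.\<close>

lemma iwasawa_change_generators:
  assumes det: "pa * pd - pb * pc = 1" "qa * qd - qb * qc = 1"
    and a: "a = \<alpha> * pa * qa + \<beta> * pc * qc" and b: "b = \<alpha> * pa * qb + \<beta> * pc * qd"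
    and c: "c = \<alpha> * pb * qa + \<beta> * pd * qc" and f: "f = \<alpha> * pb * qb + \<beta> * pd * qd"
  defines "e' \<equiv> change_generators pa pb pc pd qa qb qc qd e"
  shows "diagonal_iwasawa e' u V d \<delta> \<alpha> \<beta>" "bigraded e' u = bigraded e u"
proof -
  have e': "e' 1 x = pa *\<^sub>C e 1 x + pb *\<^sub>C e 2 x" "e' 2 x = pc *\<^sub>C e 1 x + pd *\<^sub>C e 2 x" "e' 3 x = e 3 x"
    "e' 4 x = qa *\<^sub>C e 4 x + qb *\<^sub>C e 5 x" "e' 5 x = qc *\<^sub>C e 4 x + qd *\<^sub>C e 5 x" "e' 6 x = e 6 x" for x
    by (simp_all add: e'_def change_generators_def)
  \<comment> \<open>For determinant one the inverse matrix is the adjugate.\<close>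
  have inv: "e 1 x = pd *\<^sub>C e' 1 x - pb *\<^sub>C e' 2 x" "e 2 x = pa *\<^sub>C e' 2 x - pc *\<^sub>C e' 1 x"
    "e 4 x = qd *\<^sub>C e' 4 x - qb *\<^sub>C e' 5 x" "e 5 x = qa *\<^sub>C e' 5 x - qc *\<^sub>C e' 4 x" for x
  proof -
    have "pd *\<^sub>C e' 1 x - pb *\<^sub>C e' 2 x = (pa * pd - pb * pc) *\<^sub>C e 1 x"
      "pa *\<^sub>C e' 2 x - pc *\<^sub>C e' 1 x = (pa * pd - pb * pc) *\<^sub>C e 2 x"
      "qd *\<^sub>C e' 4 x - qb *\<^sub>C e' 5 x = (qa * qd - qb * qc) *\<^sub>C e 4 x"
      "qa *\<^sub>C e' 5 x - qc *\<^sub>C e' 4 x = (qa * qd - qb * qc) *\<^sub>C e 5 x"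
      by (simp_all add: e' scaleC_add_right scaleC_scaleC cvs.scale_left_diff_distrib mult.commute)
    then show "e 1 x = pd *\<^sub>C e' 1 x - pb *\<^sub>C e' 2 x" "e 2 x = pa *\<^sub>C e' 2 x - pc *\<^sub>C e' 1 x"
      "e 4 x = qd *\<^sub>C e' 4 x - qb *\<^sub>C e' 5 x" "e 5 x = qa *\<^sub>C e' 5 x - qc *\<^sub>C e' 4 x"
      by (simp_all add: det scaleC_one)
  qed
  have G'_closed: "bigraded e' u p q (k *\<^sub>C x - l *\<^sub>C y)"
    if "bigraded e' u p q x" "bigraded e' u p q y" for p q k l x y
    using bigraded.add[OF bigraded.scale[OF that(1), of k] bigraded.scale[OF that(2), of "- l"]] by simp
  have sub: "bigraded e u p q x \<Longrightarrow> bigraded e' u p q x" for p q x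
  proof (rule bigraded_mono)
    fix k p q x
    assume x: "bigraded e' u p q x"
    show "bigraded e' u (p + 1) q (e k x)" if "k \<in> {1..3}"
      using that bigraded.hol[OF x] unfolding in_1_to_3
      by (elim disjE; hypsubst) (simp_all add: inv(1,2) e'(3)[symmetric] G'_closed)
    show "bigraded e' u p (q + 1) (e k x)" if "k \<in> {4..6}"
      using that bigraded.anti[OF x] unfolding in_4_to_6
      by (elim disjE; hypsubst) (simp_all add: inv(3,4) e'(6)[symmetric] G'_closed)
  qed
  have sub': "bigraded e' u p q x \<Longrightarrow> bigraded e u p q x" for p q x
  proof (rule bigraded_mono)
    fix k p q x
    assume x: "bigraded e u p q x"
    show "bigraded e u (p + 1) q (e' k x)" if "k \<in> {1..3}"
      using that bigraded.hol[OF x] unfolding in_1_to_3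
      by (elim disjE; hypsubst) (simp_all add: e' bigraded.add bigraded.scale)
    show "bigraded e u p (q + 1) (e' k x)" if "k \<in> {4..6}"
      using that bigraded.anti[OF x] unfolding in_4_to_6
      by (elim disjE; hypsubst) (simp_all add: e' bigraded.add bigraded.scale)
  qed
  show eq: "bigraded e' u = bigraded e u"
    using sub sub' by (intro ext) blast
  \<comment> \<open>The top product of two generators is multiplied by the determinant, here 1, so
    the equations for the generators 3 and 6 keep their form.\<close>
  have e12: "e' 1 (e' 2 x) = e 1 (e 2 x)" "e' 4 (e' 5 x) = e 4 (e 5 x)" for x
  proof -
    have "e' 1 (e' 2 x) = (pa * pd - pb * pc) *\<^sub>C e 1 (e 2 x)"
      "e' 4 (e' 5 x) = (qa * qd - qb * qc) *\<^sub>C e 4 (e 5 x)"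
      by (simp_all add: e' e_simps scaleC_add_right scaleC_scaleC cvs.scale_left_diff_distrib)
    then show "e' 1 (e' 2 x) = e 1 (e 2 x)" "e' 4 (e' 5 x) = e 4 (e 5 x)"
      by (simp_all add: det scaleC_one)
  qed
  have eta: "a *\<^sub>C e 1 (e 4 x) + b *\<^sub>C e 1 (e 5 x) + c *\<^sub>C e 2 (e 4 x) + f *\<^sub>C e 2 (e 5 x) =
      \<alpha> *\<^sub>C e' 1 (e' 4 x) + \<beta> *\<^sub>C e' 2 (e' 5 x)" for x
    by (simp add: e' e_add e_scale a b c f scaleC_add_right scaleC_add_left scaleC_scaleC mult_ac add_ac)
  \<comment> \<open>A uniform two-term expression for all six operators, so that anticommutation is
    one bilinear computation instead of a case distinction over pairs.\<close>
  define k l s r where "k i = (if i \<in> {1, 2} then 1 else if i \<in> {4, 5} then 4 else i)"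
    and "l i = (if i \<in> {1, 2} then 2 else if i \<in> {4, 5} then 5 else i)"
    and "s i = (if i = 1 then pa else if i = 2 then pc else if i = 4 then qa else if i = 5 then qc else 1)"
    and "r i = (if i = 1 then pb else if i = 2 then pd else if i = 4 then qb else if i = 5 then qd else 0)"
    for i :: nat
  have form: "e' i x = s i *\<^sub>C e (k i) x + r i *\<^sub>C e (l i) x" for i x
    by (simp add: e'_def change_generators_def k_def l_def s_def r_def scaleC_one)
  have kl: "k i \<in> {1..6}" "l i \<in> {1..6}" if "i \<in> {1..6}" for i
    using that by (simp_all add: k_def l_def)
  show "diagonal_iwasawa e' u V d \<delta> \<alpha> \<beta>"
  proof
    fix x y kk and j i :: nat
    show "e' j (x + y) = e' j x + e' j y" "e' j (kk *\<^sub>C x) = kk *\<^sub>C e' j x"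
      by (simp_all add: e'_def change_generators_def e_add e_scale scaleC_add_right scaleC_scaleC mult.commute)
    show swap: "e' i (e' j x) = - e' j (e' i x)" if ij: "i \<in> {1..6}" "j \<in> {1..6}" for i j
    proof -
      note kl = kl(1)[OF ij(1)] kl(2)[OF ij(1)] kl(1)[OF ij(2)] kl(2)[OF ij(2)]
      note sw = e_swap[OF kl(1) kl(3)] e_swap[OF kl(1) kl(4)] e_swap[OF kl(2) kl(3)] e_swap[OF kl(2) kl(4)]
      have "e' i (e' j x) = - (s j *\<^sub>C s i *\<^sub>C e (k j) (e (k i) x) + r j *\<^sub>C s i *\<^sub>C e (l j) (e (k i) x)
          + (s j *\<^sub>C r i *\<^sub>C e (k j) (e (l i) x) + r j *\<^sub>C r i *\<^sub>C e (l j) (e (l i) x)))"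
        unfolding form e_add e_scale scaleC_add_right scaleC_scaleC sw[of x]
        by (simp only: cvs.scale_minus_right minus_add_distrib mult.commute add_ac)
      then show ?thesis
        unfolding form e_add e_scale scaleC_add_right scaleC_scaleC
        by (simp only: mult.commute add_ac)
    qed
    show "e' i (e' i x) = 0" if "i \<in> {1..6}"
    proof -
      \<comment> \<open>Anticommutation with itself makes the square its own negative, and 2 is
        invertible.\<close>
      have "2 *\<^sub>C e' i (e' i x) = e' i (e' i x) + e' i (e' i x)"
        using scaleC_add_left[of 1 1 "e' i (e' i x)"] by (simp add: scaleC_one)
      also have "\<dots> = 0"
        using swap[OF that that] by (simp add: eq_neg_iff_add_eq_0)
      finally show ?thesis by simp
    qed
    show "u \<in> V" "d u = 0" "\<delta> u = 0"
      by (simp_all add: V_u d_u \<delta>_u)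
    show "cvs.dim (Collect (bigraded e' u (int p) (int q))) = (3 choose p) * (3 choose q)" for p q
      unfolding eq by (rule dim)
    assume x: "x \<in> V"
    show "kk *\<^sub>C x \<in> V" "d (kk *\<^sub>C x) = kk *\<^sub>C d x" "\<delta> (kk *\<^sub>C x) = kk *\<^sub>C \<delta> x"
      using x by (simp_all add: V_scale d_scale \<delta>_scale)
    show "x + y \<in> V" "d (x + y) = d x + d y" "\<delta> (x + y) = \<delta> x + \<delta> y" if "y \<in> V"
      using x that by (simp_all add: V_add d_add \<delta>_add)
    show "e' j x \<in> V" if "j \<in> {1..6}"
      using that x unfolding in_1_to_6
      by (elim disjE; hypsubst; simp add: e' V_simps)
    show "d (e' j x) = - e' j (d x)" if "j \<in> {1, 2, 4, 5, 6}"
      using that x unfolding insert_iff empty_iff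
      by (elim disjE FalseE; hypsubst; simp add: e' V_simps d_simps)
    show "\<delta> (e' j x) = - e' j (\<delta> x)" if "j \<in> {1, 2, 4, 5}"
      using that x unfolding insert_iff empty_iff
      by (elim disjE FalseE; hypsubst; simp add: e' V_simps d_simps)
    show "d (e' 3 x) = - e' 1 (e' 2 x) - e' 3 (d x)"
      unfolding e12 using x by (simp add: e' d_e3)
    show "\<delta> (e' 6 x) = - e' 4 (e' 5 x) - e' 6 (\<delta> x)"
      unfolding e12 using x by (simp add: e' \<delta>_e6)
    show "\<delta> (e' 3 x) = \<alpha> *\<^sub>C e' 1 (e' 4 x) + 0 *\<^sub>C e' 1 (e' 5 x) + 0 *\<^sub>C e' 2 (e' 4 x)
      + \<beta> *\<^sub>C e' 2 (e' 5 x) - e' 3 (\<delta> x)"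
      using x eta[of x] by (simp add: \<delta>_e3 e'(3))
  qed
qed

text \<open>Gaussian elimination by matrices of determinant one, with some nonzero entry of n as
  pivot \<open>\<alpha>\<close>. Unimodularity preserves the determinant, so \<open>\<beta>\<close>
  decides between rank 1 and rank 2.\<close>

lemma diagonalize:
  assumes "(a, b, c, f) \<noteq> (0, 0, 0, 0)"
  obtains e' \<alpha> \<beta> where "diagonal_iwasawa e' u V d \<delta> \<alpha> \<beta>" "bigraded e' u = bigraded e u"
    "\<alpha> \<noteq> 0" "\<alpha> * \<beta> = a * f - b * c"
proof -
  consider "a \<noteq> 0" | "a = 0" "b \<noteq> 0" | "a = 0" "b = 0" "c \<noteq> 0" | "a = 0" "b = 0" "c = 0" "f \<noteq> 0"
    using assms by auto
  then show thesis
  proof cases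
    case 1
    \<comment> \<open>Clearing the row and the column of the pivot \<open>a\<close> leaves the Schur
      complement.\<close>
    show ?thesis
      by (rule that[OF iwasawa_change_generators
            [where pa = 1 and pb = "c / a" and pc = 0 and pd = 1 and qa = 1 and qb = "b / a" and qc = 0
              and qd = 1 and \<alpha> = a and \<beta> = "f - b * c / a"]])
        (use 1 in \<open>simp_all add: field_simps\<close>)
  next
    case 2
    \<comment> \<open>The matrix with rows 0, 1 and -1, 0 exchanges two generators with determinant
      one and so brings another entry into pivot position; its sign reappears in
      \<open>\<beta>\<close>.\<close>
    show ?thesis
      by (rule that[OF iwasawa_change_generators
            [where pa = 1 and pb = "f / b" and pc = 0 and pd = 1 and qa = 0 and qb = 1 and qc = "- 1"
              and qd = 0 and \<alpha> = b and \<beta> = "- c"]])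
        (use 2 in \<open>simp_all add: field_simps\<close>)
  next
    case 3
    show ?thesis
      by (rule that[OF iwasawa_change_generators
            [where pa = 0 and pb = 1 and pc = "- 1" and pd = 0 and qa = 1 and qb = "f / c" and qc = 0
              and qd = 1 and \<alpha> = c and \<beta> = 0]])
        (use 3 in \<open>simp_all add: field_simps\<close>)
  next
    case 4
    show ?thesis
      by (rule that[OF iwasawa_change_generators
            [where pa = 0 and pb = 1 and pc = "- 1" and pd = 0 and qa = 0 and qb = 1 and qc = "- 1"
              and qd = 0 and \<alpha> = f and \<beta> = 0]])
        (use 4 in \<open>simp_all add: field_simps\<close>)
  qed
qed

end

section \<open>The left invariant forms as an instance of the abstract complex\<close>

lemma iwasawa_inv:
  "iwasawa lmul one_form0 inv_space del (delbar_phi (beltrami t))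
    (t $ 2 $ 1) (t $ 2 $ 2) (- t $ 1 $ 1) (- t $ 1 $ 2)"
proof -
  interpret exterior_operators lmul one_form0 by (rule exterior_lmul)
  show ?thesis
  proof
    show "del (lmul j x) = - lmul j (del x)" if "x \<in> inv_space" "j \<in> {1, 2, 4, 5, 6}" for x j
      using that by (rule del_lmul)
    show "delbar_phi (beltrami t) (lmul 3 x) = t $ 2 $ 1 *\<^sub>C lmul 1 (lmul 4 x) + t $ 2 $ 2 *\<^sub>C lmul 1 (lmul 5 x)
      + - t $ 1 $ 1 *\<^sub>C lmul 2 (lmul 4 x) + - t $ 1 $ 2 *\<^sub>C lmul 2 (lmul 5 x) - lmul 3 (delbar_phi (beltrami t) x)"
      if "x \<in> inv_space" for x
      using delbar_phi_lmul(2)[OF that, of t] by (simp add: algebra_simps)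
  qed (simp_all add: generated.unit generated.add generated.scale generated.gen del.differential_one
      delbar_phi_one del_linear delbar_phi_linear delbar_phi_lmul del_lmul dim_bigraded_lmul
      del: insert_iff)
qed

lemma inv_dcomplex_eq:
  "inv_dcomplex t = iwasawa.complex_of lmul one_form0 del (delbar_phi (beltrami t))"
proof -
  interpret iwasawa lmul one_form0 inv_space del "delbar_phi (beltrami t)" "t $ 2 $ 1" "t $ 2 $ 2"
    "- t $ 1 $ 1" "- t $ 1 $ 2" by (rule iwasawa_inv)
  have "inv_forms = G"
    by (intro ext) (simp only: monomials_lmul G_def bigraded_eq_span)
  then show ?thesis
    by (simp add: inv_dcomplex_def complex_of_def)
qed

text \<open>The generators enter the complex only through the bigraded pieces. Diagonalizing n
  therefore changes the description of the complex and not the complex itself, so no isomorphisms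
  need to be composed.\<close>

lemma complex_of_cong:
  assumes "iwasawa e u V d \<delta> a b c f" "iwasawa e' u V d \<delta> a' b' c' f'" "bigraded e' u = bigraded e u"
  shows "iwasawa.complex_of e' u d \<delta> = iwasawa.complex_of e u d \<delta>"
proof -
  have "iwasawa.G e' u = iwasawa.G e u"
    using assms(3) by (intro ext) (simp add: iwasawa.G_def[OF assms(1)] iwasawa.G_def[OF assms(2)])
  then show ?thesis
    by (simp add: iwasawa.complex_of_def[OF assms(1)] iwasawa.complex_of_def[OF assms(2)])
qed

theorem theorem1p1:
  fixes \<epsilon> :: real and t :: kparam
  assumes "\<epsilon> > 0" and "t \<in> Kuranishi_base \<epsilon>"
  shows "double_complex (inv_dcomplex t) \<and> bounded_dcomplex (inv_dcomplex t) \<and>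
    ((t $ 1 $ 1, t $ 1 $ 2, t $ 2 $ 1, t $ 2 $ 2) = (0, 0, 0, 0) \<longrightarrow>
      inv_dcomplex t \<cong>\<^sub>d\<^sub>c dc_sum_mult
       [(1, Sq 1 1),
        (1, Hor 1 0), (2, Hor 1 1), (2, Hor 1 2), (1, Hor 1 3),
        (1, Ver 0 1), (2, Ver 1 1), (2, Ver 2 1), (1, Ver 3 1),
        (1, Dot 0 0), (2, Dot 1 0), (2, Dot 2 0), (1, Dot 3 0),
        (2, Dot 0 1), (4, Dot 1 1), (4, Dot 2 1), (2, Dot 3 1),
        (2, Dot 0 2), (4, Dot 1 2), (4, Dot 2 2), (2, Dot 3 2),
        (1, Dot 0 3), (2, Dot 1 3), (2, Dot 2 3), (1, Dot 3 3)]) \<and>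
    ((t $ 1 $ 1, t $ 1 $ 2, t $ 2 $ 1, t $ 2 $ 2) \<noteq> (0, 0, 0, 0) \<and> D_par t = 0 \<longrightarrow>
      inv_dcomplex t \<cong>\<^sub>d\<^sub>c dc_sum_mult
       [(1, Sq 1 1),
        (1, Hor 1 1), (1, Hor 1 2),
        (1, Ver 0 1), (2, Ver 1 1), (2, Ver 2 1), (1, Ver 3 1),
        (1, Lzz 1 0), (1, Lzz 1 2), (1, Rzz 2 1), (1, Rzz 2 3),
        (1, Dot 0 0), (2, Dot 1 0), (1, Dot 2 0), (1, Dot 3 0),
        (2, Dot 0 1), (3, Dot 1 1), (4, Dot 2 1), (2, Dot 3 1),
        (2, Dot 0 2), (4, Dot 1 2), (3, Dot 2 2), (2, Dot 3 2),
        (1, Dot 0 3), (1, Dot 1 3), (2, Dot 2 3), (1, Dot 3 3)]) \<and>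
    ((t $ 1 $ 1, t $ 1 $ 2, t $ 2 $ 1, t $ 2 $ 2) \<noteq> (0, 0, 0, 0) \<and> D_par t \<noteq> 0 \<longrightarrow>
      inv_dcomplex t \<cong>\<^sub>d\<^sub>c dc_sum_mult
       [(1, Sq 1 1),
        (1, Ver 0 1), (2, Ver 1 1), (2, Ver 2 1), (1, Ver 3 1),
        (1, Lzz 1 0), (2, Lzz 1 2), (2, Rzz 2 1), (1, Rzz 2 3),
        (1, Dot 0 0), (2, Dot 1 0), (1, Dot 3 0),
        (2, Dot 0 1), (3, Dot 1 1), (4, Dot 2 1), (2, Dot 3 1),
        (2, Dot 0 2), (4, Dot 1 2), (3, Dot 2 2), (2, Dot 3 2),
        (1, Dot 0 3), (2, Dot 2 3), (1, Dot 3 3)])"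
    (is "_ \<and> _ \<and> (_ \<longrightarrow> _ \<cong>\<^sub>d\<^sub>c ?M0) \<and> (_ \<longrightarrow> _ \<cong>\<^sub>d\<^sub>c ?M1) \<and> (_ \<longrightarrow> _ \<cong>\<^sub>d\<^sub>c ?M2)")
proof -
  interpret iwasawa lmul one_form0 inv_space del "delbar_phi (beltrami t)" "t $ 2 $ 1" "t $ 2 $ 2"
    "- t $ 1 $ 1" "- t $ 1 $ 2" by (rule iwasawa_inv)
  note eq = inv_dcomplex_eq[of t]
  \<comment> \<open>The left side is the determinant of n.\<close>
  have D: "t $ 2 $ 1 * - t $ 1 $ 2 - t $ 2 $ 2 * - t $ 1 $ 1 = D_par t"
    by (simp add: D_par_def algebra_simps)
  show ?thesis
  proof (intro conjI impI; (elim conjE)?)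
    show "double_complex (inv_dcomplex t)" "bounded_dcomplex (inv_dcomplex t)"
      unfolding eq by (rule double_complex_complex_of, rule bounded_complex_of)
  next
    assume t0: "(t $ 1 $ 1, t $ 1 $ 2, t $ 2 $ 1, t $ 2 $ 2) = (0, 0, 0, 0)"
    have "diagonal_iwasawa lmul one_form0 inv_space del (delbar_phi (beltrami t)) 0 0"
      unfolding diagonal_iwasawa_def using iwasawa_inv[of t] t0 by simp
    then show "inv_dcomplex t \<cong>\<^sub>d\<^sub>c ?M0"
      unfolding eq by (rule diagonal_iwasawa.rank0_iso) simp_all
  next
    assume t0: "(t $ 1 $ 1, t $ 1 $ 2, t $ 2 $ 1, t $ 2 $ 2) \<noteq> (0, 0, 0, 0)" and D0: "D_par t = 0"
    \<comment> \<open>Since \<open>\<alpha> \<noteq> 0\<close> and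
      \<open>\<alpha> * \<beta> = D_par t\<close>, here \<open>\<beta> = 0\<close>, so the normal
      form has rank 1.\<close>
    then obtain e' \<alpha> \<beta> where *: "diagonal_iwasawa e' one_form0 inv_space del (delbar_phi (beltrami t)) \<alpha> \<beta>"
      "bigraded e' one_form0 = bigraded lmul one_form0" "\<alpha> \<noteq> 0" "\<alpha> * \<beta> = D_par t"
      using diagonalize D by auto
    then show "inv_dcomplex t \<cong>\<^sub>d\<^sub>c ?M1"
      unfolding eq complex_of_cong[OF iwasawa_axioms diagonal_iwasawa.axioms[OF *(1)] *(2), symmetric]
      using D0 by (intro diagonal_iwasawa.rank1_iso[OF *(1)]) auto
  next
    assume t0: "(t $ 1 $ 1, t $ 1 $ 2, t $ 2 $ 1, t $ 2 $ 2) \<noteq> (0, 0, 0, 0)" and D0: "D_par t \<noteq> 0"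
    then obtain e' \<alpha> \<beta> where *: "diagonal_iwasawa e' one_form0 inv_space del (delbar_phi (beltrami t)) \<alpha> \<beta>"
      "bigraded e' one_form0 = bigraded lmul one_form0" "\<alpha> \<noteq> 0" "\<alpha> * \<beta> = D_par t"
      using diagonalize D by auto
    then show "inv_dcomplex t \<cong>\<^sub>d\<^sub>c ?M2"
      unfolding eq complex_of_cong[OF iwasawa_axioms diagonal_iwasawa.axioms[OF *(1)] *(2), symmetric]
      using D0 by (intro diagonal_iwasawa.rank2_iso[OF *(1)]) auto
  qed
qed

end
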